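(* Let $n\geq 1$ be a natural number, let $L$ be a lattice with $|L|=n$, and let $(\cdot^{\Delta},\cdot^{\nabla})$ be a weak dicomplementation on $L$. Write $\mathrm{Con}(L,\cdot^{\Delta},\cdot^{\nabla})$ for the lattice of congruences of the weakly dicomplemented lattice $(L,\cdot^{\Delta},\cdot^{\nabla})$. Then: (1) $|\mathrm{Con}(L,\cdot^{\Delta},\cdot^{\nabla})|\leq 2^{n-1}$; (2) $|\mathrm{Con}(L,\cdot^{\Delta},\cdot^{\nabla})|=2^{n-1}$ iff $n\in\{1,2\}$; (3) $|\mathrm{Con}(L,\cdot^{\Delta},\cdot^{\nabla})|=2^{n-2}$ iff $n=4$ and $\mathrm{Con}(L,\cdot^{\Delta},\cdot^{\nabla})\cong C_2^2$ iff $L\cong C_2^2$ and $\cdot^{\Delta}=\cdot^{\nabla}$ is the Boolean complementation; (4) if $L\not\cong C_2^2$ or the weak dicomplementation of $L$ is not Boolean (i.e. it is not the case that both $\cdot^{\Delta}$ and $\cdot^{\nabla}$ equal the Boolean complementation), then: $|\mathrm{Con}(L,\cdot^{\Delta},\cdot^{\nabla})|<2^{n-1}$ iff $|\mathrm{Con}(L,\cdot^{\Delta},\cdot^{\nabla})|\leq 2^{n-3}+1$; (5) $|\mathrm{Con}(L,\cdot^{\Delta},\cdot^{\nabla})|=2^{n-3}+1$ iff $\mathrm{Con}(L,\cdot^{\Delta},\cdot^{\nabla})\cong C_2^{n-3}\oplus C_2$ iff $n\geq 3$ and $L\cong C_n$; (6) $|\mathrm{Con}(L,\cdot^{\Delta},\cdot^{\nabla})|\leq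 2^{n-3}$ iff $|\mathrm{Con}(L,\cdot^{\Delta},\cdot^{\nabla})|\leq 2^{n-4}+1$; (7) $|\mathrm{Con}(L,\cdot^{\Delta},\cdot^{\nabla})|=2^{n-4}+1$ iff $\mathrm{Con}(L,\cdot^{\Delta},\cdot^{\nabla})\cong C_2^{n-4}\oplus C_2$ iff one of the following holds: (a) $n\geq 5$, $L\cong C_k\boxplus C_{n-k+2}$ for some integer $k\in[3,n-2]$ and $(\cdot^{\Delta},\cdot^{\nabla})$ is the trivial weak dicomplementation on $L$; (b) $n\geq 6$ and $L\cong C_k\oplus C_2^2\oplus C_{n-k-2}$ for some integer $k\in[2,n-4]$.
   Context: A weak complementation on a bounded lattice $(L,\wedge,\vee,0,1)$ is an order-reversing unary operation $\cdot^{\Delta}$ with $x^{\Delta\Delta}\leq x$ and $(x\wedge y)\vee(x\wedge y^{\Delta})=x$ for all $x,y\in L$. A dual weak complementation is an order-reversing unary operation $\cdot^{\nabla}$ with $x\leq x^{\nabla\nabla}$ and $(x\vee y)\wedge(x\vee y^{\nabla})=x$ for all $x,y\in L$. A weak dicomplementation on $L$ is a pair $(\cdot^{\Delta},\cdot^{\nabla})$ of a weak complementation and a dual weak complementation; then $(L,\cdot^{\Delta},\cdot^{\nabla})$ is a weakly dicomplemented lattice, whose congruences are the lattice congruences of $L$ preserving both operations, ordered by inclusion. The trivial weak dicomplementation consists of the operation $\cdot^{\Delta}$ sending $1$ to $0$ and all other elements to $1$, and the operation $\cdot^{\nabla}$ sending $0$ to $1$ and all other elements to $0$. $C_m$ is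 the $m$-element chain; powers denote direct powers (so $C_2^2$ is the four-element Boolean lattice, $C_2^0=C_1$). For bounded lattices $L,M$, the ordinal sum $L\oplus M$ is obtained by placing $M$ on top of $L$ and identifying the top of $L$ with the bottom of $M$. For nontrivial bounded lattices $L,M$, the horizontal sum $L\boxplus M$ is obtained by identifying the bottoms of $L$ and $M$ and identifying their tops, every element of $L\setminus\{0,1\}$ being incomparable to every element of $M\setminus\{0,1\}$. Here $\cong$ between lattices is lattice isomorphism.
   Formalization: The first equivalence of (3) is stated only for n ≠ 3, (4) and (6) only for n ≠ 1, and the second equivalence of (7) only for n ≠ 4, because they fail for C_3, for C_1, and for C_2^2 with the trivial weak dicomplementation, respectively. *)

theory Defs
  imports Complex_Main "HOL-Algebra.Lattice"
begin

section \<open>Weakly dicomplemented lattices\<close>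

locale weak_complementation = bounded_lattice L for L (structure) +
  fixes wc :: "'a \<Rightarrow> 'a"
  assumes wc_closed: "x \<in> carrier L \<Longrightarrow> wc x \<in> carrier L"
    and wc_antitone: "\<lbrakk>x \<in> carrier L; y \<in> carrier L; x \<sqsubseteq> y\<rbrakk> \<Longrightarrow> wc y \<sqsubseteq> wc x"
    and wc_wc_le: "x \<in> carrier L \<Longrightarrow> wc (wc x) \<sqsubseteq> x"
    and wc_split: "\<lbrakk>x \<in> carrier L; y \<in> carrier L\<rbrakk> \<Longrightarrow> (x \<sqinter> y) \<squnion> (x \<sqinter> wc y) = x"

locale dual_weak_complementation = bounded_lattice L for L (structure) +
  fixes dwc :: "'a \<Rightarrow> 'a"
  assumes dwc_closed: "x \<in> carrier L \<Longrightarrow> dwc x \<in> carrier L"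
    and dwc_antitone: "\<lbrakk>x \<in> carrier L; y \<in> carrier L; x \<sqsubseteq> y\<rbrakk> \<Longrightarrow> dwc y \<sqsubseteq> dwc x"
    and dwc_dwc_ge: "x \<in> carrier L \<Longrightarrow> x \<sqsubseteq> dwc (dwc x)"
    and dwc_split: "\<lbrakk>x \<in> carrier L; y \<in> carrier L\<rbrakk> \<Longrightarrow> (x \<squnion> y) \<sqinter> (x \<squnion> dwc y) = x"

locale weakly_dicomplemented_lattice =
  weak_complementation L wc + dual_weak_complementation L dwc
  for L (structure) and wc dwc

definition trivial_weak_dicomplementation ::
  "'a gorder \<Rightarrow> ('a \<Rightarrow> 'a) \<Rightarrow> ('a \<Rightarrow> 'a) \<Rightarrow> bool" where
  "trivial_weak_dicomplementation L wc dwc \<longleftrightarrow>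
     (\<forall>x\<in>carrier L.
        wc x = (if x = \<top>\<^bsub>L\<^esub> then \<bottom>\<^bsub>L\<^esub> else \<top>\<^bsub>L\<^esub>) \<and>
        dwc x = (if x = \<bottom>\<^bsub>L\<^esub> then \<top>\<^bsub>L\<^esub> else \<bottom>\<^bsub>L\<^esub>))"

text \<open>Only meant for Boolean lattices, where complements are unique; then the predicate
  determines the operation on the carrier.\<close>

definition boolean_complementation :: "'a gorder \<Rightarrow> ('a \<Rightarrow> 'a) \<Rightarrow> bool" where
  "boolean_complementation L c \<longleftrightarrow>
     (\<forall>x\<in>carrier L. c x \<in> carrier L \<and>
        x \<sqinter>\<^bsub>L\<^esub> c x = \<bottom>\<^bsub>L\<^esub> \<and> x \<squnion>\<^bsub>L\<^esub> c x = \<top>\<^bsub>L\<^esub>)"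


section \<open>Congruences\<close>

definition lattice_congruence :: "'a gorder \<Rightarrow> ('a \<times> 'a) set \<Rightarrow> bool" where
  "lattice_congruence L r \<longleftrightarrow> equiv (carrier L) r \<and>
     (\<forall>x x' y y'. (x, x') \<in> r \<longrightarrow> (y, y') \<in> r \<longrightarrow>
        (x \<sqinter>\<^bsub>L\<^esub> y, x' \<sqinter>\<^bsub>L\<^esub> y') \<in> r \<and> (x \<squnion>\<^bsub>L\<^esub> y, x' \<squnion>\<^bsub>L\<^esub> y') \<in> r)"

definition Con :: "'a gorder \<Rightarrow> ('a \<Rightarrow> 'a) \<Rightarrow> ('a \<Rightarrow> 'a) \<Rightarrow> ('a \<times> 'a) set gorder" where
  "Con L wc dwc =
     \<lparr>carrier = {r. lattice_congruence L r \<and>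
        (\<forall>x y. (x, y) \<in> r \<longrightarrow> (wc x, wc y) \<in> r \<and> (dwc x, dwc y) \<in> r)},
      eq = (=), le = (\<subseteq>)\<rparr>"


section \<open>Lattice isomorphism, chains, powers and sums\<close>

definition lattice_isomorphic :: "'a gorder \<Rightarrow> 'b gorder \<Rightarrow> bool"  (infix \<open>\<cong>\<^sub>L\<close> 50) where
  "L \<cong>\<^sub>L M \<longleftrightarrow>
     (\<exists>h. bij_betw h (carrier L) (carrier M) \<and> join_pres L M h \<and> meet_pres L M h)"

definition chain :: "nat \<Rightarrow> nat gorder" where
  "chain m = \<lparr>carrier = {..<m}, eq = (=), le = (\<le>)\<rparr>"

definition lattice_power :: "'a gorder \<Rightarrow> nat \<Rightarrow> (nat \<Rightarrow> 'a) gorder" where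
  "lattice_power L k =
     \<lparr>carrier = {..<k} \<rightarrow>\<^sub>E carrier L, eq = (=), le = (\<lambda>f g. \<forall>i<k. f i \<sqsubseteq>\<^bsub>L\<^esub> g i)\<rparr>"

text \<open>The sums live on the disjoint sum type. Where an element of \<open>M\<close> is identified with one
  of \<open>L\<close>, the copy in \<open>L\<close> is kept and the copy in \<open>M\<close> is removed: the bottom of \<open>M\<close> for the
  ordinal sum, both bounds of \<open>M\<close> for the horizontal sum. The horizontal sum is only meant for
  lattices with distinct bounds.\<close>

definition ordinal_sum :: "'a gorder \<Rightarrow> 'b gorder \<Rightarrow> ('a + 'b) gorder"
    (infixl \<open>\<oplus>\<^sub>L\<close> 65) where
  "L \<oplus>\<^sub>L M =
     \<lparr>carrier = Inl ` carrier L \<union> Inr ` (carrier M - {\<bottom>\<^bsub>M\<^esub>}),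
      eq = (=),
      le = (\<lambda>u v. case (u, v) of
          (Inl x, Inl y) \<Rightarrow> x \<sqsubseteq>\<^bsub>L\<^esub> y
        | (Inl x, Inr y) \<Rightarrow> True
        | (Inr x, Inl y) \<Rightarrow> False
        | (Inr x, Inr y) \<Rightarrow> x \<sqsubseteq>\<^bsub>M\<^esub> y)\<rparr>"

definition horizontal_sum :: "'a gorder \<Rightarrow> 'b gorder \<Rightarrow> ('a + 'b) gorder"
    (infixl \<open>\<boxplus>\<^sub>L\<close> 65) where
  "L \<boxplus>\<^sub>L M =
     \<lparr>carrier = Inl ` carrier L \<union> Inr ` (carrier M - {\<bottom>\<^bsub>M\<^esub>, \<top>\<^bsub>M\<^esub>}),
      eq = (=),
      le = (\<lambda>u v. case (u, v) of
          (Inl x, Inl y) \<Rightarrow> x \<sqsubseteq>\<^bsub>L\<^esub> y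
        | (Inl x, Inr y) \<Rightarrow> x = \<bottom>\<^bsub>L\<^esub>
        | (Inr x, Inl y) \<Rightarrow> y = \<top>\<^bsub>L\<^esub>
        | (Inr x, Inr y) \<Rightarrow> x \<sqsubseteq>\<^bsub>M\<^esub> y)\<rparr>"

end

theory Submission
  imports Defs
begin

text \<open>
  A congruence of a finite lattice is determined by the join-irreducible elements \<open>j\<close> that it
  identifies with their lower cover, and congruences are ordered in the same way as these sets
  (\<open>E_reflects\<close>). So the congruences embed into the powerset of the set \<open>J\<close> of join-irreducible
  elements. In a lattice with \<open>n\<close> elements, \<open>J\<close> has \<open>n - 1\<close> elements for a chain and
  \<open>n - 1 - |R|\<close> in general, where \<open>R\<close> is the set of nonzero join-reducible elements. What remains is
  to count the edges that the two operations freeze or tie together.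

  Suppose that both operations are trivial. Then a congruence that is not full has the classes
  \<open>{0}\<close> and \<open>{1}\<close>, so it collapses no atom. A chain loses its lowest and its highest edge, which
  leaves \<open>2^(n-3)\<close> proper congruences. If \<open>L\<close> is not a chain, two atoms together with one element of
  \<open>R\<close> leave at most \<open>n - 4\<close> edges (\<open>several_atoms_bound\<close>); with a single atom, either \<open>|R| \<ge> 2\<close>,
  or the edge below 1 or two edges at a branching are lost as well (\<open>unique_atom_bound\<close>). Equality
  means that every set of the remaining edges is collapsed exactly by some congruence. The one-element
  sets already force the shape of \<open>L\<close>: a horizontal sum of two chains, or a chain with one
  square inserted strictly inside. For these shapes and for chains, every set of remaining edges does
  occur (\<open>dissolve\<close>).

  Suppose that the weak complementation is not trivial and \<open>n \<ge> 5\<close>. Then there are at most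
  \<open>2^(n-4)\<close> congruences, the full one included. Take a minimal element \<open>u\<close> other than 0 with
  \<open>wc (wc u) = u \<noteq> 1\<close>. If \<open>u\<close> is join-irreducible and not an atom, then the edge below \<open>u\<close> and an
  atom below \<open>u\<close> are always collapsed together (\<open>min_closed_atom_equivalent\<close>); if \<open>u\<close> is an atom and
  a coatom, then \<open>u\<close> and an atom below \<open>wc u\<close> are collapsed by the full congruence only
  (\<open>atom_coatom_full\<close>). Each such coincidence halves the bound \<open>2^|J|\<close>. Since \<open>1 \<in> R\<close>, one
  coincidence is enough for \<open>|R| = 2\<close>, two are found for \<open>|R| = 1\<close>, and for \<open>|R| \<ge> 3\<close> the bound
  \<open>2^|J|\<close> suffices. A nontrivial dual weak complementation is treated by passing to the dual lattice.

  Lattices with at most three elements are chains, and the nonchain with four elements is the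
  square, where both operations are Boolean or only the two extreme congruences exist.
\<close>

section \<open>Finite lattices\<close>

text \<open>The order is confined to \<open>A\<close>, so that membership of the elements need not be carried along,
  and all constants are parameters, so that the dual lattice is another instance.\<close>

locale finite_lattice =
  fixes A :: "'a set"
    and leq :: "'a \<Rightarrow> 'a \<Rightarrow> bool"  (infix \<open>\<preceq>\<close> 50)
    and meet :: "'a \<Rightarrow> 'a \<Rightarrow> 'a"  (infixl \<open>\<^bold>\<sqinter>\<close> 70)
    and join :: "'a \<Rightarrow> 'a \<Rightarrow> 'a"  (infixl \<open>\<^bold>\<squnion>\<close> 65)
    and zero :: 'a  (\<open>\<^bold>0\<close>)
    and one :: 'a  (\<open>\<^bold>1\<close>)
  assumes finite_A: "finite A"
    and leq_mem: "x \<preceq> y \<Longrightarrow> x \<in> A \<and> y \<in> A"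
    and refl: "x \<in> A \<Longrightarrow> x \<preceq> x"
    and antisym: "x \<preceq> y \<Longrightarrow> y \<preceq> x \<Longrightarrow> x = y"
    and trans: "x \<preceq> y \<Longrightarrow> y \<preceq> z \<Longrightarrow> x \<preceq> z"
    and meet_le1: "x \<in> A \<Longrightarrow> y \<in> A \<Longrightarrow> x \<^bold>\<sqinter> y \<preceq> x"
    and meet_le2: "x \<in> A \<Longrightarrow> y \<in> A \<Longrightarrow> x \<^bold>\<sqinter> y \<preceq> y"
    and meet_greatest: "z \<preceq> x \<Longrightarrow> z \<preceq> y \<Longrightarrow> z \<preceq> x \<^bold>\<sqinter> y"
    and join_ge1: "x \<in> A \<Longrightarrow> y \<in> A \<Longrightarrow> x \<preceq> x \<^bold>\<squnion> y"
    and join_ge2: "x \<in> A \<Longrightarrow> y \<in> A \<Longrightarrow> y \<preceq> x \<^bold>\<squnion> y"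
    and join_least: "x \<preceq> z \<Longrightarrow> y \<preceq> z \<Longrightarrow> x \<^bold>\<squnion> y \<preceq> z"
    and zero_le: "x \<in> A \<Longrightarrow> \<^bold>0 \<preceq> x"
    and le_one: "x \<in> A \<Longrightarrow> x \<preceq> \<^bold>1"
    and zero_mem: "\<^bold>0 \<in> A"
    and one_mem: "\<^bold>1 \<in> A"
begin

definition lt :: "'a \<Rightarrow> 'a \<Rightarrow> bool"  (infix \<open>\<prec>\<close> 50) where
  "x \<prec> y \<longleftrightarrow> x \<preceq> y \<and> x \<noteq> y"

definition incomparable :: "'a \<Rightarrow> 'a \<Rightarrow> bool"  (infix \<open>\<parallel>\<close> 50) where
  "x \<parallel> y \<longleftrightarrow> x \<in> A \<and> y \<in> A \<and> \<not> x \<preceq> y \<and> \<not> y \<preceq> x"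

lemma leq_mem1: "x \<preceq> y \<Longrightarrow> x \<in> A" and leq_mem2: "x \<preceq> y \<Longrightarrow> y \<in> A"
  using leq_mem by auto

lemma meet_mem: "x \<in> A \<Longrightarrow> y \<in> A \<Longrightarrow> x \<^bold>\<sqinter> y \<in> A"
  and join_mem: "x \<in> A \<Longrightarrow> y \<in> A \<Longrightarrow> x \<^bold>\<squnion> y \<in> A"
  using meet_le1 join_ge1 leq_mem by blast+

lemma lt_le: "x \<prec> y \<Longrightarrow> x \<preceq> y"
  by (simp add: lt_def)

lemma lt_trans1: "x \<preceq> y \<Longrightarrow> y \<prec> z \<Longrightarrow> x \<prec> z"
  unfolding lt_def using antisym trans by blast

lemma lt_mem1: "x \<prec> y \<Longrightarrow> x \<in> A" and lt_mem2: "x \<prec> y \<Longrightarrow> y \<in> A"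
  using lt_le leq_mem by auto

lemma meet_absorb: "x \<preceq> y \<Longrightarrow> x \<^bold>\<sqinter> y = x" "x \<preceq> y \<Longrightarrow> y \<^bold>\<sqinter> x = x"
  using antisym meet_greatest meet_le1 meet_le2 refl leq_mem by meson+

lemma join_absorb: "x \<preceq> y \<Longrightarrow> x \<^bold>\<squnion> y = y" "x \<preceq> y \<Longrightarrow> y \<^bold>\<squnion> x = y"
  using antisym join_least join_ge1 join_ge2 refl leq_mem by meson+

lemma meet_commute: "x \<in> A \<Longrightarrow> y \<in> A \<Longrightarrow> x \<^bold>\<sqinter> y = y \<^bold>\<sqinter> x"
  using antisym meet_greatest meet_le1 meet_le2 by meson

lemma join_commute: "x \<in> A \<Longrightarrow> y \<in> A \<Longrightarrow> x \<^bold>\<squnion> y = y \<^bold>\<squnion> x"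
  using antisym join_least join_ge1 join_ge2 by meson

lemma le_zero: "x \<preceq> \<^bold>0 \<Longrightarrow> x = \<^bold>0"
  using antisym zero_le leq_mem by blast

lemma one_le: "\<^bold>1 \<preceq> x \<Longrightarrow> x = \<^bold>1"
  using antisym le_one leq_mem by blast

lemma incomparable_sym: "x \<parallel> y \<Longrightarrow> y \<parallel> x"
  by (simp add: incomparable_def)

lemma incomparable_mem: "x \<parallel> y \<Longrightarrow> x \<in> A" "x \<parallel> y \<Longrightarrow> y \<in> A"
  by (simp_all add: incomparable_def)

lemma incomparable_not_bound:
  "x \<parallel> y \<Longrightarrow> x \<noteq> \<^bold>0" "x \<parallel> y \<Longrightarrow> x \<noteq> \<^bold>1" "x \<parallel> y \<Longrightarrow> y \<noteq> \<^bold>0" "x \<parallel> y \<Longrightarrow> y \<noteq> \<^bold>1"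
  unfolding incomparable_def using zero_le le_one by blast+

lemma incomparable_lt_join: "x \<parallel> y \<Longrightarrow> x \<prec> x \<^bold>\<squnion> y" "x \<parallel> y \<Longrightarrow> y \<prec> x \<^bold>\<squnion> y"
  unfolding incomparable_def lt_def by (metis join_ge1 join_ge2)+

lemma meet_lt_incomparable: "x \<parallel> y \<Longrightarrow> x \<^bold>\<sqinter> y \<prec> x" "x \<parallel> y \<Longrightarrow> x \<^bold>\<sqinter> y \<prec> y"
  unfolding incomparable_def lt_def by (metis meet_le1 meet_le2)+

lemma below_induct [consumes 1, case_names below]:
  assumes "x \<in> A" and step: "\<And>x. x \<in> A \<Longrightarrow> (\<And>y. y \<prec> x \<Longrightarrow> P y) \<Longrightarrow> P x"
  shows "P x"
  using assms(1)
proof (induction "card {y. y \<prec> x}" arbitrary: x rule: less_induct)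
  case less
  show ?case
  proof (rule step[OF less.prems])
    fix y assume y: "y \<prec> x"
    have "finite {y. y \<prec> x}"
      by (rule finite_subset[OF _ finite_A]) (use lt_mem1 in blast)
    moreover have "{z. z \<prec> y} \<subset> {z. z \<prec> x}"
      using y lt_trans1 lt_le by (auto simp: lt_def)
    ultimately have "card {z. z \<prec> y} < card {z. z \<prec> x}"
      by (rule psubset_card_mono)
    then show "P y"
      using less.hyps lt_mem1[OF y] by blast
  qed
qed

lemma exists_minimal:
  assumes "S \<subseteq> A" "x \<in> S"
  obtains m where "m \<in> S" "m \<preceq> x" "\<And>y. y \<prec> m \<Longrightarrow> y \<notin> S"
proof -
  have "x \<in> A" using assms by auto
  then have "x \<in> S \<longrightarrow> (\<exists>m\<in>S. m \<preceq> x \<and> (\<forall>y. y \<prec> m \<longrightarrow> y \<notin> S))"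
  proof (induction x rule: below_induct)
    case (below x)
    show ?case
    proof (cases "\<exists>y\<in>S. y \<prec> x")
      case True
      then show ?thesis using below.IH lt_le trans by blast
    next
      case False
      then show ?thesis using refl[OF below.hyps] by blast
    qed
  qed
  then show thesis using assms(2) that by blast
qed

section \<open>Join-irreducible elements\<close>

definition J :: "'a set" where
  "J = {j. \<exists>k. k \<prec> j \<and> (\<forall>x. x \<prec> j \<longrightarrow> x \<preceq> k)}"

definition lower_cover :: "'a \<Rightarrow> 'a" where
  "lower_cover j = (THE k. k \<prec> j \<and> (\<forall>x. x \<prec> j \<longrightarrow> x \<preceq> k))"

definition R :: "'a set" where
  "R = A - J - {\<^bold>0}"

lemma lower_cover:
  assumes "j \<in> J"
  shows "lower_cover j \<prec> j" and "\<And>x. x \<prec> j \<Longrightarrow> x \<preceq> lower_cover j"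
proof -
  obtain k where k: "k \<prec> j" "\<forall>x. x \<prec> j \<longrightarrow> x \<preceq> k"
    using assms J_def by auto
  have "lower_cover j = k"
    unfolding lower_cover_def by (rule the_equality) (use k antisym in blast)+
  with k show "lower_cover j \<prec> j" and "\<And>x. x \<prec> j \<Longrightarrow> x \<preceq> lower_cover j"
    by auto
qed

lemma J_mem: "j \<in> J \<Longrightarrow> j \<in> A"
  using lower_cover(1) lt_mem2 by blast

lemma J_subset: "J \<subseteq> A"
  using J_mem by blast

lemma finite_J: "finite J"
  using J_subset finite_A finite_subset by blast

lemma lower_cover_mem: "j \<in> J \<Longrightarrow> lower_cover j \<in> A"
  using lower_cover(1) lt_mem1 by blast

lemma J_nonzero: "j \<in> J \<Longrightarrow> j \<noteq> \<^bold>0"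
  using lower_cover(1)[of j] le_zero by (auto simp: lt_def)

lemma card_J_R: "card J + card R + 1 = card A"
proof -
  have "A = insert \<^bold>0 (J \<union> R)"
    using J_subset zero_mem by (auto simp: R_def)
  moreover have "\<^bold>0 \<notin> J \<union> R" "J \<inter> R = {}"
    using J_nonzero by (auto simp: R_def)
  moreover have "finite J" "finite R"
    using finite_J finite_A by (auto simp: R_def)
  ultimately show ?thesis
    by (metis Suc_eq_plus1 card_Un_disjoint card_insert_disjoint finite_UnI)
qed

lemma join_irreducible:
  assumes "j \<in> J" "x \<^bold>\<squnion> y = j" "x \<in> A" "y \<in> A"
  shows "x = j \<or> y = j"
proof (rule ccontr)
  assume "\<not> ?thesis"
  then have "x \<prec> j" "y \<prec> j"
    using assms join_ge1 join_ge2 lt_def by blast+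
  then have "j \<preceq> lower_cover j"
    using lower_cover(2)[OF assms(1)] join_least assms(2) by blast
  then show False
    using lower_cover(1)[OF assms(1)] antisym lt_def by blast
qed

lemma incomparable_join_R:
  assumes "x \<parallel> y" shows "x \<^bold>\<squnion> y \<in> R"
proof -
  have m: "x \<in> A" "y \<in> A" using assms by (auto simp: incomparable_def)
  have "x \<^bold>\<squnion> y \<notin> J"
    using join_irreducible[of "x \<^bold>\<squnion> y" x y] m incomparable_lt_join[OF assms] by (auto simp: lt_def)
  moreover have "x \<^bold>\<squnion> y \<noteq> \<^bold>0"
    using incomparable_lt_join[OF assms] le_zero by (auto simp: lt_def)
  ultimately show ?thesis using m join_mem by (auto simp: R_def)
qed

lemma R_join:
  assumes "r \<in> R" obtains x y where "x \<parallel> y" "x \<^bold>\<squnion> y = r"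
proof -
  have r: "r \<in> A" "r \<noteq> \<^bold>0" "r \<notin> J" using assms by (auto simp: R_def)
  let ?S = "{x. x \<prec> r}"
  have fin: "finite ?S"
    by (rule finite_subset[OF _ finite_A]) (use lt_mem1 in blast)
  have "\<^bold>0 \<in> ?S" using r zero_le by (auto simp: lt_def)
  define rk where "rk x = card {z. z \<prec> x}" for x
  \<comment> \<open>A maximal element \<open>x\<close> below \<open>r\<close> is not the greatest one; with \<open>y\<close> not below \<open>x\<close> the join
     is strictly above \<open>x\<close>, hence equal to \<open>r\<close>.\<close>
  have "Max (rk ` ?S) \<in> rk ` ?S"
    using fin \<open>\<^bold>0 \<in> ?S\<close> by (intro Max_in) auto
  then obtain x where x: "x \<in> ?S" "rk x = Max (rk ` ?S)" by auto
  have mx: "rk y \<le> rk x" if "y \<in> ?S" for y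
    using that fin x by auto
  obtain y where y: "y \<prec> r" "\<not> y \<preceq> x"
    using x(1) r J_def by blast
  have m: "x \<in> A" "y \<in> A" using x y lt_mem1 by blast+
  have "x \<prec> x \<^bold>\<squnion> y"
    using m y join_ge1 join_ge2 by (metis lt_def)
  have *: "x \<^bold>\<squnion> y \<preceq> r" using x y join_least lt_le by simp
  have "x \<^bold>\<squnion> y = r"
  proof (rule ccontr)
    assume "x \<^bold>\<squnion> y \<noteq> r"
    then have "x \<^bold>\<squnion> y \<in> ?S" using * lt_def by simp
    moreover have "rk x < rk (x \<^bold>\<squnion> y)"
      unfolding rk_def
    proof (rule psubset_card_mono)
      show "finite {z. z \<prec> x \<^bold>\<squnion> y}"
        by (rule finite_subset[OF _ finite_A]) (use lt_mem1 in blast)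
      show "{z. z \<prec> x} \<subset> {z. z \<prec> x \<^bold>\<squnion> y}"
        using \<open>x \<prec> x \<^bold>\<squnion> y\<close> lt_trans1 lt_le by (auto simp: lt_def)
    qed
    ultimately show False using mx by fastforce
  qed
  moreover have "x \<parallel> y"
    using m y x(1) \<open>x \<^bold>\<squnion> y = r\<close> join_absorb(1)[of x y] by (auto simp: incomparable_def lt_def)
  ultimately show thesis using that by blast
qed

text \<open>The form in which join-reducibility enters inductions along the order.\<close>

lemma not_J_join:
  assumes "x \<in> A" "x \<noteq> \<^bold>0" "x \<notin> J"
  obtains y z where "y \<prec> x" "z \<prec> x" "y \<^bold>\<squnion> z = x"
  using R_join[of x] incomparable_lt_join assms unfolding R_def by (metis DiffI singletonD)

lemma R_empty_iff: "R = {} \<longleftrightarrow> (\<forall>x\<in>A. \<forall>y\<in>A. x \<preceq> y \<or> y \<preceq> x)"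
  using R_join incomparable_join_R unfolding incomparable_def by (metis all_not_in_conv)

definition atoms :: "'a set" where
  "atoms = {a \<in> J. lower_cover a = \<^bold>0}"

lemma atom_below:
  assumes "x \<in> A" "x \<noteq> \<^bold>0"
  obtains a where "a \<in> atoms" "a \<preceq> x"
proof -
  have "A - {\<^bold>0} \<subseteq> A" "x \<in> A - {\<^bold>0}" using assms by auto
  then obtain a where a: "a \<in> A - {\<^bold>0}" "a \<preceq> x" "\<And>y. y \<prec> a \<Longrightarrow> y \<notin> A - {\<^bold>0}"
    by (rule exists_minimal) blast
  have z: "y = \<^bold>0" if "y \<prec> a" for y using a(3)[OF that] lt_mem1[OF that] by auto
  have "\<^bold>0 \<prec> a" using a zero_le by (auto simp: lt_def)
  then have "a \<in> J" unfolding J_def using z refl zero_mem by blast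
  moreover have "lower_cover a = \<^bold>0" using lower_cover(1)[OF \<open>a \<in> J\<close>] z by blast
  ultimately show thesis using that a(2) by (simp add: atoms_def)
qed

lemma below_atom: "a \<in> atoms \<Longrightarrow> x \<preceq> a \<Longrightarrow> x = \<^bold>0 \<or> x = a"
  using lower_cover(2)[of a x] le_zero by (auto simp: atoms_def lt_def)

lemma atom_J: "a \<in> atoms \<Longrightarrow> a \<in> J"
  by (simp add: atoms_def)

lemma atoms_incomparable: "a \<in> atoms \<Longrightarrow> b \<in> atoms \<Longrightarrow> a \<noteq> b \<Longrightarrow> a \<parallel> b"
  using below_atom J_nonzero J_mem unfolding incomparable_def atoms_def by blast

section \<open>Congruences and the edges they collapse\<close>

definition congs :: "('a \<times> 'a) set set" where
  "congs = {r. equiv A r \<and> (\<forall>x x' y y'. (x, x') \<in> r \<longrightarrow> (y, y') \<in> r \<longrightarrow>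
      (x \<^bold>\<sqinter> y, x' \<^bold>\<sqinter> y') \<in> r \<and> (x \<^bold>\<squnion> y, x' \<^bold>\<squnion> y') \<in> r)}"

text \<open>An edge between a join-irreducible element and its lower cover is represented by its top.\<close>

definition E :: "('a \<times> 'a) set \<Rightarrow> 'a set" where
  "E r = {j \<in> J. (lower_cover j, j) \<in> r}"

context
  fixes r assumes r: "r \<in> congs"
begin

lemma cong_mem: "(x, y) \<in> r \<Longrightarrow> x \<in> A \<and> y \<in> A"
  using r by (auto simp: congs_def equiv_def refl_on_def)

lemma cong_refl: "x \<in> A \<Longrightarrow> (x, x) \<in> r"
  using r by (auto simp: congs_def equiv_def refl_on_def)

lemma cong_sym: "(x, y) \<in> r \<Longrightarrow> (y, x) \<in> r"
  using r by (auto simp: congs_def equiv_def sym_def)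

lemma cong_trans: "(x, y) \<in> r \<Longrightarrow> (y, z) \<in> r \<Longrightarrow> (x, z) \<in> r"
  using r unfolding congs_def equiv_def trans_def by blast

lemma cong_meet: "(x, y) \<in> r \<Longrightarrow> z \<in> A \<Longrightarrow> (x \<^bold>\<sqinter> z, y \<^bold>\<sqinter> z) \<in> r"
  using r cong_refl[of z] by (auto simp: congs_def)

lemma cong_join: "(x, y) \<in> r \<Longrightarrow> z \<in> A \<Longrightarrow> (x \<^bold>\<squnion> z, y \<^bold>\<squnion> z) \<in> r"
  using r cong_refl[of z] by (auto simp: congs_def)

lemma cong_join2: "(x, y) \<in> r \<Longrightarrow> (x', y') \<in> r \<Longrightarrow> (x \<^bold>\<squnion> x', y \<^bold>\<squnion> y') \<in> r"
  using r by (auto simp: congs_def)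

lemma cong_convex:
  assumes "(x, y) \<in> r" "x \<preceq> z" "z \<preceq> y"
  shows "(x, z) \<in> r" and "(z, y) \<in> r"
proof -
  have "z \<in> A" using assms leq_mem by blast
  then show "(x, z) \<in> r"
    using cong_meet[OF assms(1)] assms meet_absorb by metis
  then show "(z, y) \<in> r" using assms(1) cong_sym cong_trans by blast
qed

lemma E_subset: "E r \<subseteq> J"
  by (auto simp: E_def)

text \<open>By convexity, since an interval with a join-irreducible top contains the edge below that top.\<close>

lemma collapse_E:
  assumes "(x, j) \<in> r" "x \<prec> j" "j \<in> J" shows "j \<in> E r"
  using cong_convex(2)[OF assms(1), of "lower_cover j"] lower_cover[OF assms(3)] assms lt_le
  by (auto simp: E_def)

lemma E_atom: "a \<in> atoms \<Longrightarrow> a \<in> E r \<longleftrightarrow> (\<^bold>0, a) \<in> r"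
  by (auto simp: E_def atoms_def)

end

text \<open>It is enough to collapse \<open>x \<^bold>\<sqinter> z\<close> with \<open>z\<close> for all \<open>z \<preceq> y\<close> whenever the first congruence identifies
  \<open>x \<preceq> y\<close>. By induction on \<open>z\<close>: a join-reducible \<open>z\<close> is the join of smaller elements, and a
  join-irreducible \<open>z\<close> not below \<open>x\<close> has its edge collapsed, because \<open>x \<^bold>\<sqinter> z \<preceq> lower_cover z\<close>.\<close>

lemma E_reflects:
  assumes r: "r \<in> congs" and s: "s \<in> congs" and sub: "E r \<subseteq> E s"
  shows "r \<subseteq> s"
proof -
  have key: "(x \<^bold>\<sqinter> z, z) \<in> s" if xy: "(x, y) \<in> r" "x \<preceq> y" and z: "z \<in> A" "z \<preceq> y" for x y z
    using z
  proof (induction z rule: below_induct)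
    case (below z)
    have x: "x \<in> A" using xy leq_mem by blast
    consider "z \<preceq> x" | "\<not> z \<preceq> x" "z \<in> J" | "\<not> z \<preceq> x" "z \<notin> J" by blast
    then show ?case
    proof cases
      case 1
      then show ?thesis using meet_absorb cong_refl[OF s] below.hyps by metis
    next
      case 2
      let ?k = "lower_cover z"
      have lt: "x \<^bold>\<sqinter> z \<prec> z"
        using meet_le1 meet_le2 x below.hyps 2(1) by (metis lt_def)
      have "(x \<^bold>\<sqinter> z, y \<^bold>\<sqinter> z) \<in> r" using cong_meet[OF r xy(1) below.hyps] .
      then have "(x \<^bold>\<sqinter> z, z) \<in> r" using meet_absorb(2)[OF below.prems] by simp
      then have "z \<in> E r" using collapse_E[OF r _ lt 2(2)] by blast
      then have kz: "(?k, z) \<in> s" using sub by (auto simp: E_def)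
      have "(x \<^bold>\<sqinter> ?k, ?k) \<in> s"
        using below.IH[OF lower_cover(1)[OF 2(2)]] lower_cover(1)[OF 2(2)] below.prems trans lt_le
        by blast
      moreover have "x \<^bold>\<sqinter> ?k = x \<^bold>\<sqinter> z"
      proof (rule antisym)
        have kA: "?k \<in> A" by (rule lower_cover_mem[OF 2(2)])
        show "x \<^bold>\<sqinter> ?k \<preceq> x \<^bold>\<sqinter> z"
          using meet_greatest meet_le1[OF x kA] meet_le2[OF x kA] lower_cover(1)[OF 2(2)] lt_le trans
          by blast
        show "x \<^bold>\<sqinter> z \<preceq> x \<^bold>\<sqinter> ?k"
          using meet_greatest meet_le1[OF x below.hyps] lower_cover(2)[OF 2(2) lt] by blast
      qed
      ultimately show ?thesis using kz cong_trans[OF s] by metis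
    next
      case 3
      then have "z \<noteq> \<^bold>0" using zero_le x by blast
      then obtain z1 z2 where z: "z1 \<prec> z" "z2 \<prec> z" "z1 \<^bold>\<squnion> z2 = z"
        using not_J_join[OF below.hyps _ 3(2)] by blast
      have m: "z1 \<in> A" "z2 \<in> A" using z lt_mem1 by blast+
      have "(x \<^bold>\<sqinter> z1, z1) \<in> s" "(x \<^bold>\<sqinter> z2, z2) \<in> s"
        using below.IH z below.prems trans lt_le by blast+
      then have "((x \<^bold>\<sqinter> z1) \<^bold>\<squnion> (x \<^bold>\<sqinter> z2), z) \<in> s"
        using cong_join2[OF s] z(3) by metis
      moreover have "(x \<^bold>\<sqinter> z1) \<^bold>\<squnion> (x \<^bold>\<sqinter> z2) \<preceq> x \<^bold>\<sqinter> z"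
        using join_least meet_greatest meet_le1 meet_le2 m x z(1,2) lt_le trans by meson
      ultimately show ?thesis
        using cong_convex(2)[OF s] meet_le2[OF x below.hyps] by blast
    qed
  qed
  have "(x, y) \<in> s" if "(x, y) \<in> r" for x y
  proof -
    have m: "x \<in> A" "y \<in> A" using that cong_mem[OF r] by blast+
    have 1: "(x \<^bold>\<sqinter> y, y) \<in> r"
      using cong_meet[OF r that m(2)] meet_absorb(1)[OF refl[OF m(2)]] by simp
    have 2: "(y \<^bold>\<sqinter> x, x) \<in> r"
      using cong_meet[OF r cong_sym[OF r that] m(1)] meet_absorb(1)[OF refl[OF m(1)]] by simp
    have "((x \<^bold>\<sqinter> y) \<^bold>\<sqinter> y, y) \<in> s"
      using key[OF 1] meet_le2 m refl by blast
    moreover have "((y \<^bold>\<sqinter> x) \<^bold>\<sqinter> x, x) \<in> s"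
      using key[OF 2] meet_le2 m refl by blast
    ultimately have "(x \<^bold>\<sqinter> y, y) \<in> s" "(x \<^bold>\<sqinter> y, x) \<in> s"
      using meet_absorb(1) meet_le1 meet_le2 m meet_commute by metis+
    then show ?thesis using cong_sym[OF s] cong_trans[OF s] by blast
  qed
  then show ?thesis by auto
qed

lemma E_mono: "r \<subseteq> s \<Longrightarrow> E r \<subseteq> E s"
  by (auto simp: E_def)

lemma E_inj: "inj_on E congs"
  using E_reflects by (intro inj_onI) (metis order_refl subset_antisym)

lemma finite_congs: "finite congs"
proof (rule finite_subset)
  show "congs \<subseteq> Pow (A \<times> A)" using cong_mem by auto
qed (use finite_A in auto)

text \<open>In a distributive lattice the map from \<open>x\<close> to the set of join-irreducible elements below \<open>x\<close>
  respects joins as well as meets, and this is the congruence collapsing exactly the edges in \<open>X\<close>. In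
  general joins need not be respected.\<close>

definition dissolve :: "'a set \<Rightarrow> ('a \<times> 'a) set" where
  "dissolve X = {(x, y). x \<in> A \<and> y \<in> A \<and> (\<forall>j\<in>J - X. j \<preceq> x \<longleftrightarrow> j \<preceq> y)}"

lemma dissolve_congs:
  assumes "\<And>j x y z. j \<in> J - X \<Longrightarrow> (x, y) \<in> dissolve X \<Longrightarrow> z \<in> A \<Longrightarrow> j \<preceq> x \<^bold>\<squnion> z \<Longrightarrow> j \<preceq> y \<^bold>\<squnion> z"
  shows "dissolve X \<in> congs"
proof -
  have sy: "(y, x) \<in> dissolve X" if "(x, y) \<in> dissolve X" for x y
    using that by (auto simp: dissolve_def)
  have tr: "(x, z) \<in> dissolve X" if "(x, y) \<in> dissolve X" "(y, z) \<in> dissolve X" for x y z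
    using that by (auto simp: dissolve_def)
  have mem: "x \<in> A" "y \<in> A" if "(x, y) \<in> dissolve X" for x y
    using that by (auto simp: dissolve_def)
  have le_meet: "j \<preceq> x \<^bold>\<sqinter> y \<longleftrightarrow> j \<preceq> x \<and> j \<preceq> y" if "x \<in> A" "y \<in> A" for j x y
    using that meet_le1 meet_le2 trans meet_greatest by blast
  have jn: "(x \<^bold>\<squnion> z, y \<^bold>\<squnion> z) \<in> dissolve X" if xy: "(x, y) \<in> dissolve X" and z: "z \<in> A" for x y z
  proof -
    have "j \<preceq> x \<^bold>\<squnion> z \<longleftrightarrow> j \<preceq> y \<^bold>\<squnion> z" if "j \<in> J - X" for j
      using assms[OF that xy z] assms[OF that sy[OF xy] z] by blast
    then show ?thesis using mem[OF xy] z join_mem by (auto simp: dissolve_def)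
  qed
  have "equiv A (dissolve X)"
    by (auto intro!: equivI refl_onI symI transI sy intro: tr simp: dissolve_def)
  moreover have "(x \<^bold>\<sqinter> y, x' \<^bold>\<sqinter> y') \<in> dissolve X \<and> (x \<^bold>\<squnion> y, x' \<^bold>\<squnion> y') \<in> dissolve X"
    if h: "(x, x') \<in> dissolve X" "(y, y') \<in> dissolve X" for x x' y y'
  proof
    note m = mem[OF h(1)] mem[OF h(2)]
    show "(x \<^bold>\<sqinter> y, x' \<^bold>\<sqinter> y') \<in> dissolve X"
      using h m meet_mem le_meet by (auto simp: dissolve_def)
    have "(x \<^bold>\<squnion> y, x' \<^bold>\<squnion> y) \<in> dissolve X" "(y \<^bold>\<squnion> x', y' \<^bold>\<squnion> x') \<in> dissolve X"
      using jn h m by blast+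
    then show "(x \<^bold>\<squnion> y, x' \<^bold>\<squnion> y') \<in> dissolve X"
      using tr join_commute m by metis
  qed
  ultimately show ?thesis by (auto simp: congs_def)
qed

lemma E_dissolve:
  assumes "X \<subseteq> J" shows "E (dissolve X) = X"
proof (rule Set.set_eqI)
  fix j
  show "j \<in> E (dissolve X) \<longleftrightarrow> j \<in> X"
  proof (cases "j \<in> J")
    case True
    note lc = lower_cover[OF True]
    show ?thesis
    proof
      assume "j \<in> E (dissolve X)"
      then have "j \<in> J - X \<Longrightarrow> j \<preceq> lower_cover j"
        using refl J_mem by (auto simp: E_def dissolve_def)
      then show "j \<in> X" using True lc(1) antisym lt_def by blast
    next
      assume "j \<in> X"
      then have "i \<preceq> j \<longleftrightarrow> i \<preceq> lower_cover j" if "i \<in> J - X" for i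
        using lc that trans by (metis DiffD2 lt_def)
      then show "j \<in> E (dissolve X)"
        using True lower_cover_mem J_mem by (auto simp: E_def dissolve_def)
    qed
  next
    case False
    then show ?thesis using assms by (auto simp: E_def)
  qed
qed

end

section \<open>Congruences of a finite weakly dicomplemented lattice\<close>

locale finite_wdl = finite_lattice +
  fixes wc dwc :: "'a \<Rightarrow> 'a"
  assumes wc_mem: "x \<in> A \<Longrightarrow> wc x \<in> A"
    and wc_anti: "x \<preceq> y \<Longrightarrow> wc y \<preceq> wc x"
    and wc_wc: "x \<in> A \<Longrightarrow> wc (wc x) \<preceq> x"
    and wc_split: "x \<in> A \<Longrightarrow> y \<in> A \<Longrightarrow> (x \<^bold>\<sqinter> y) \<^bold>\<squnion> (x \<^bold>\<sqinter> wc y) = x"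
    and dwc_mem: "x \<in> A \<Longrightarrow> dwc x \<in> A"
    and dwc_anti: "x \<preceq> y \<Longrightarrow> dwc y \<preceq> dwc x"
    and dwc_dwc: "x \<in> A \<Longrightarrow> x \<preceq> dwc (dwc x)"
    and dwc_split: "x \<in> A \<Longrightarrow> y \<in> A \<Longrightarrow> (x \<^bold>\<squnion> y) \<^bold>\<sqinter> (x \<^bold>\<squnion> dwc y) = x"
begin

lemma dual: "finite_wdl A (\<lambda>x y. y \<preceq> x) (\<^bold>\<squnion>) (\<^bold>\<sqinter>) \<^bold>1 \<^bold>0 dwc wc"
proof unfold_locales
  fix x y z
  show "y \<preceq> x \<Longrightarrow> z \<preceq> y \<Longrightarrow> z \<preceq> x" by (rule trans)
  show "y \<preceq> x \<Longrightarrow> x \<in> A \<and> y \<in> A" using leq_mem by blast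
qed (use finite_A refl antisym meet_le1 meet_le2 meet_greatest join_ge1 join_ge2 join_least
      zero_le le_one zero_mem one_mem wc_mem wc_anti wc_wc wc_split dwc_mem dwc_anti dwc_dwc dwc_split
    in auto)

lemma join_wc:
  assumes "x \<in> A" shows "x \<^bold>\<squnion> wc x = \<^bold>1"
  using wc_split[OF one_mem assms] meet_absorb(2)[OF le_one] assms wc_mem by metis

lemma meet_dwc:
  assumes "x \<in> A" shows "x \<^bold>\<sqinter> dwc x = \<^bold>0"
  using dwc_split[OF zero_mem assms] join_absorb(1)[OF zero_le] assms dwc_mem by metis

lemma wc_zero: "wc \<^bold>0 = \<^bold>1"
  using join_wc[OF zero_mem] join_absorb(1)[OF zero_le[OF wc_mem[OF zero_mem]]] by simp

lemma wc_one: "wc \<^bold>1 = \<^bold>0"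
  using wc_wc[OF zero_mem] le_zero by (simp add: wc_zero)

lemma dwc_one: "dwc \<^bold>1 = \<^bold>0"
  using meet_dwc[OF one_mem] meet_absorb(2)[OF le_one[OF dwc_mem[OF one_mem]]] by simp

lemma dwc_zero: "dwc \<^bold>0 = \<^bold>1"
  using dwc_dwc[OF one_mem] one_le by (simp add: dwc_one)

lemma wc_wc_wc:
  assumes "x \<in> A" shows "wc (wc (wc x)) = wc x"
  by (rule antisym) (use assms wc_wc wc_mem wc_anti in auto)

definition K :: "('a \<times> 'a) set set" where
  "K = {r \<in> congs. \<forall>x y. (x, y) \<in> r \<longrightarrow> (wc x, wc y) \<in> r \<and> (dwc x, dwc y) \<in> r}"

lemma K_congs: "r \<in> K \<Longrightarrow> r \<in> congs"
  by (simp add: K_def)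

lemma K_wc: "r \<in> K \<Longrightarrow> (x, y) \<in> r \<Longrightarrow> (wc x, wc y) \<in> r"
  and K_dwc: "r \<in> K \<Longrightarrow> (x, y) \<in> r \<Longrightarrow> (dwc x, dwc y) \<in> r"
  by (auto simp: K_def)

lemma finite_K: "finite K"
  using finite_congs by (simp add: K_def)

text \<open>Classes of lattice congruences are convex, so identifying the bounds identifies everything.\<close>

lemma K_bounds_collapsed:
  assumes "r \<in> K" "(\<^bold>0, \<^bold>1) \<in> r" shows "r = A \<times> A"
proof -
  note c = K_congs[OF assms(1)]
  have "(\<^bold>0, x) \<in> r" if "x \<in> A" for x
    using cong_convex(1)[OF c assms(2)] zero_le le_one that by blast
  then have "(x, y) \<in> r" if "x \<in> A" "y \<in> A" for x y
    using that cong_sym[OF c] cong_trans[OF c] by blast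
  then show ?thesis using cong_mem[OF c] by auto
qed

lemma K_bounds_E:
  assumes "r \<in> K" "(\<^bold>0, \<^bold>1) \<in> r" shows "E r = J"
  using K_bounds_collapsed[OF assms] J_mem lower_cover_mem by (auto simp: E_def)

text \<open>The sets \<open>E r\<close> are determined by their trace on \<open>D\<close> when every other edge is collapsed together
  with an edge in \<open>D\<close>.\<close>

lemma card_K_le:
  assumes D: "D \<subseteq> J"
    and det: "\<And>i. i \<in> J - D \<Longrightarrow> \<exists>d\<in>D. \<forall>r\<in>K. i \<in> E r \<longleftrightarrow> d \<in> E r"
  shows "card K \<le> 2 ^ card D"
proof -
  have sub: "E r \<subseteq> E s" if rs: "r \<in> K" "s \<in> K" "E r \<inter> D = E s \<inter> D" for r s
  proof
    fix i assume i: "i \<in> E r"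
    show "i \<in> E s"
    proof (cases "i \<in> D")
      case True then show ?thesis using i rs by auto
    next
      case False
      then have "i \<in> J - D" using i by (simp add: E_def)
      from det[OF this] obtain d where d: "d \<in> D" "\<forall>r\<in>K. i \<in> E r \<longleftrightarrow> d \<in> E r" ..
      then have "d \<in> E r" using i rs(1) by blast
      then have "d \<in> E s" using d(1) rs(3) by blast
      then show ?thesis using d(2) rs(2) by blast
    qed
  qed
  have "inj_on (\<lambda>r. E r \<inter> D) K"
  proof (rule inj_onI)
    fix r s assume "r \<in> K" "s \<in> K" "E r \<inter> D = E s \<inter> D"
    then have "E r = E s" using sub[of r s] sub[of s r] by auto
    then show "r = s" using \<open>r \<in> K\<close> \<open>s \<in> K\<close> E_inj K_congs by (auto simp: inj_on_def)
  qed
  moreover have "(\<lambda>r. E r \<inter> D) ` K \<subseteq> Pow D" by auto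
  moreover have fin: "finite D" using D finite_J finite_subset by blast
  ultimately have "card K \<le> card (Pow D)"
    by (intro card_inj_on_le[of "\<lambda>r. E r \<inter> D"]) auto
  then show ?thesis using fin by (simp add: card_Pow)
qed

lemma card_K_le_half:
  assumes "i \<in> J" "j \<in> J" "i \<noteq> j" "\<forall>r\<in>K. i \<in> E r \<longleftrightarrow> j \<in> E r"
  shows "card K \<le> 2 ^ (card J - 1)"
  using card_K_le[of "J - {i}"] assms finite_J by auto

section \<open>Nontrivial weak complementations\<close>

text \<open>These are the values of \<open>wc\<close> other than the bounds; they exist exactly if \<open>wc\<close> is not trivial,
  and \<open>wc\<close> is an involution on them.\<close>

definition closed :: "'a \<Rightarrow> bool" where
  "closed u \<longleftrightarrow> u \<in> A \<and> u \<noteq> \<^bold>0 \<and> u \<noteq> \<^bold>1 \<and> wc (wc u) = u"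

definition min_closed :: "'a \<Rightarrow> bool" where
  "min_closed u \<longleftrightarrow> closed u \<and> (\<forall>y. y \<prec> u \<longrightarrow> \<not> closed y)"

lemma closed_wc: "closed u \<Longrightarrow> closed (wc u)"
  unfolding closed_def by (metis wc_mem wc_one wc_zero)

lemma wc_closed:
  assumes "x \<in> A" "x \<noteq> \<^bold>1" "wc x \<noteq> \<^bold>1"
  shows "closed (wc x)"
proof -
  have "wc x \<noteq> \<^bold>0"
    using join_wc[OF assms(1)] join_absorb(2)[OF zero_le[OF assms(1)]] assms(2) by auto
  then show ?thesis using assms wc_mem wc_wc_wc by (simp add: closed_def)
qed

lemma min_closed_below:
  assumes "closed u" obtains m where "min_closed m" "m \<preceq> u"
proof -
  have "Collect closed \<subseteq> A" "u \<in> Collect closed" using assms by (auto simp: closed_def)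
  then obtain m where "m \<in> Collect closed" "m \<preceq> u" "\<And>y. y \<prec> m \<Longrightarrow> y \<notin> Collect closed"
    by (rule exists_minimal) blast
  then have "min_closed m" unfolding min_closed_def by blast
  then show thesis using that \<open>m \<preceq> u\<close> by blast
qed

text \<open>Otherwise \<open>wc (wc y)\<close> would be a closed element below \<open>u\<close>.\<close>

lemma wc_below_min_closed:
  assumes u: "min_closed u" and y: "y \<prec> u" shows "wc y = \<^bold>1"
proof (rule ccontr)
  assume n: "wc y \<noteq> \<^bold>1"
  have yA: "y \<in> A" using lt_mem1[OF y] .
  moreover have "y \<noteq> \<^bold>1" using y one_le by (auto simp: lt_def)
  ultimately have "closed (wc (wc y))" using n wc_closed closed_wc by blast
  moreover have "wc (wc y) \<prec> u" using lt_trans1[OF wc_wc[OF yA] y] .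
  ultimately show False using u by (simp add: min_closed_def)
qed

lemma closed_incomparable:
  assumes "closed u" shows "u \<parallel> wc u"
  using assms join_wc[of u] join_absorb closed_wc[OF assms]
  by (metis closed_def incomparable_def)

text \<open>Splitting \<open>j\<close> by \<open>u\<close> writes it as a join of two elements, one of which must be \<open>j\<close>.\<close>

lemma below_closed_or_wc:
  assumes j: "j \<in> J" and u: "u \<in> A" shows "j \<preceq> u \<or> j \<preceq> wc u"
proof -
  note m = J_mem[OF j] wc_mem[OF u]
  have "j \<^bold>\<sqinter> u = j \<or> j \<^bold>\<sqinter> wc u = j"
    using join_irreducible[OF j wc_split[OF m(1) u]] meet_mem m u by blast
  then show ?thesis using meet_le2 m u by metis
qed

lemma collapse_closed:
  assumes r: "r \<in> K" and u: "closed u"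
  shows "(\<^bold>0, u) \<in> r \<longleftrightarrow> (wc u, \<^bold>1) \<in> r"
proof
  have wu: "wc (wc u) = u" using u by (simp add: closed_def)
  show "(wc u, \<^bold>1) \<in> r" if h: "(\<^bold>0, u) \<in> r"
    using cong_sym[OF K_congs[OF r] K_wc[OF r h]] by (simp add: wc_zero)
  show "(\<^bold>0, u) \<in> r" if h: "(wc u, \<^bold>1) \<in> r"
    using cong_sym[OF K_congs[OF r] K_wc[OF r h]] by (simp add: wc_one wu)
qed

text \<open>The elements strictly below \<open>u\<close> are sent to 1, while \<open>u\<close> is sent to \<open>wc u\<close>; so any collapse just
  below \<open>u\<close> identifies \<open>wc u\<close> with 1, hence \<open>u\<close> with 0.\<close>

lemma collapse_below_min_closed:
  assumes r: "r \<in> K" and u: "min_closed u" and y: "(y, u) \<in> r" "y \<prec> u"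
  shows "(\<^bold>0, u) \<in> r"
proof -
  have "(\<^bold>1, wc u) \<in> r" using K_wc[OF r y(1)] wc_below_min_closed[OF u y(2)] by simp
  then show ?thesis
    using collapse_closed[OF r] u cong_sym[OF K_congs[OF r]] by (auto simp: min_closed_def)
qed

text \<open>Collapsing the edge below \<open>u\<close> collapses everything below \<open>u\<close>. Conversely, if \<open>a\<close> is identified with
  0, then \<open>dwc a\<close> is identified with 1 and \<open>dwc a \<^bold>\<sqinter> u\<close> with \<open>u\<close>; the former is strictly below \<open>u\<close>
  because \<open>a \<^bold>\<sqinter> dwc a = 0\<close>.\<close>

lemma min_closed_atom_equivalent:
  assumes u: "min_closed u" "u \<in> J" and a: "a \<in> atoms" "a \<prec> u" and r: "r \<in> K"
  shows "a \<in> E r \<longleftrightarrow> u \<in> E r"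
proof
  note c = K_congs[OF r]
  have aA: "a \<in> A" and uA: "u \<in> A" using a(2) lt_mem1 lt_mem2 by blast+
  have dA: "dwc a \<in> A" using dwc_mem aA by blast
  {
    assume "a \<in> E r"
    then have "(\<^bold>0, a) \<in> r" using E_atom[OF c a(1)] by simp
    then have "(\<^bold>1, dwc a) \<in> r" using K_dwc[OF r, of "\<^bold>0" a] dwc_zero by simp
    then have "(\<^bold>1 \<^bold>\<sqinter> u, dwc a \<^bold>\<sqinter> u) \<in> r" using cong_meet[OF c _ uA] by blast
    then have "(dwc a \<^bold>\<sqinter> u, u) \<in> r"
      using meet_absorb(2)[OF le_one[OF uA]] cong_sym[OF c] by simp
    moreover have "dwc a \<^bold>\<sqinter> u \<noteq> u"
    proof
      assume "dwc a \<^bold>\<sqinter> u = u"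
      then have "a \<preceq> dwc a" using meet_le1[OF dA uA] a(2) trans lt_le by metis
      then have "a = \<^bold>0" using meet_dwc[OF aA] meet_absorb(1) by metis
      then show False using atom_J[OF a(1)] J_nonzero by blast
    qed
    then have "dwc a \<^bold>\<sqinter> u \<prec> u" using meet_le2[OF dA uA] by (simp add: lt_def)
    ultimately show "u \<in> E r" using collapse_E[OF c _ _ u(2)] by blast
  }
  assume "u \<in> E r"
  then have "(\<^bold>0, u) \<in> r"
    using collapse_below_min_closed[OF r u(1)] lower_cover(1)[OF u(2)] by (auto simp: E_def)
  then show "a \<in> E r"
    using cong_convex(1)[OF c _ zero_le[OF aA] lt_le[OF a(2)]] E_atom[OF c a(1)] by blast
qed

lemma min_closed_non_atom:
  assumes u: "min_closed u" "u \<in> J" "lower_cover u \<noteq> \<^bold>0"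
  obtains a where "a \<in> atoms" "a \<prec> u" "\<forall>r\<in>K. a \<in> E r \<longleftrightarrow> u \<in> E r"
proof -
  obtain a where a: "a \<in> atoms" "a \<preceq> lower_cover u"
    using atom_below[OF lower_cover_mem[OF u(2)] u(3)] by blast
  have au: "a \<prec> u" using lt_trans1[OF a(2) lower_cover(1)[OF u(2)]] .
  have "\<forall>r\<in>K. a \<in> E r \<longleftrightarrow> u \<in> E r"
    using min_closed_atom_equivalent[OF u(1,2) a(1) au] by (rule ballI)
  with a(1) au show thesis by (rule that)
qed

text \<open>A closed element strictly below \<open>wc u\<close> is the image of a closed element above \<open>u\<close>.\<close>

lemma min_closed_wc:
  assumes u: "closed u" and up: "\<And>x. u \<preceq> x \<Longrightarrow> closed x \<Longrightarrow> wc x \<prec> wc u \<Longrightarrow> False"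
  shows "min_closed (wc u)"
  unfolding min_closed_def
proof (intro conjI allI impI notI)
  show "closed (wc u)" using closed_wc[OF u] .
  fix y assume y: "y \<prec> wc u" "closed y"
  have "u \<preceq> wc y" using wc_anti[OF lt_le[OF y(1)]] u by (simp add: closed_def)
  moreover have "closed (wc y)" using closed_wc[OF y(2)] .
  ultimately show False using up[of "wc y"] y by (simp add: closed_def)
qed

text \<open>Here \<open>u\<close> is both an atom and a coatom; write \<open>v\<close> for \<open>wc u\<close>, which is again minimal closed, and let
  \<open>a\<close> be an atom below \<open>v\<close>. If \<open>a = v\<close>, splitting by \<open>u\<close> leaves only the four elements 0, \<open>u\<close>, \<open>v\<close>, 1.
  Otherwise \<open>a \<^bold>\<squnion> u = 1\<close>. Identifying \<open>a\<close> with 0 identifies \<open>u\<close> with 1 and so \<open>v\<close> with 0; but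
  \<open>dwc v = 0\<close>, since the only other candidate \<open>u\<close> contradicts the dual splitting of \<open>a\<close> by \<open>v\<close>.
  Identifying \<open>u\<close> with 0 identifies \<open>a\<close> with 1, and \<open>wc a = 1\<close>.\<close>

lemma atom_coatom_full:
  assumes u: "min_closed u" and low: "\<And>x. x \<prec> u \<Longrightarrow> x = \<^bold>0" and up: "\<And>x. u \<prec> x \<Longrightarrow> x = \<^bold>1"
    and n: "card A \<ge> 5"
  obtains a where "a \<in> atoms" "a \<prec> wc u" "a \<noteq> u"
    "\<forall>r\<in>K. (\<^bold>0, a) \<in> r \<or> (\<^bold>0, u) \<in> r \<longrightarrow> (\<^bold>0, \<^bold>1) \<in> r"
proof -
  define v where "v = wc u"
  have cu: "closed u" using u by (simp add: min_closed_def)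
  have cv: "closed v" using closed_wc[OF cu] v_def by simp
  have A: "u \<in> A" "v \<in> A" and nz: "u \<noteq> \<^bold>0" "v \<noteq> \<^bold>0" "u \<noteq> \<^bold>1" "v \<noteq> \<^bold>1" and wv: "wc v = u"
    using cu cv by (auto simp: closed_def v_def)
  have inc: "u \<parallel> v" using closed_incomparable[OF cu] v_def by simp
  have mv: "min_closed v"
    unfolding v_def
  proof (rule min_closed_wc[OF cu])
    fix x assume "u \<preceq> x" "closed x" "wc x \<prec> wc u"
    then show False using up[of x] by (auto simp: lt_def closed_def)
  qed
  obtain a where a: "a \<in> atoms" "a \<preceq> v" using atom_below[OF A(2) nz(2)] .
  have aA: "a \<in> A" using a leq_mem by blast
  have au: "\<not> a \<preceq> u" using a low inc J_nonzero[OF atom_J[OF a(1)]]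
    by (metis incomparable_def lt_def)
  have le_u: "x \<^bold>\<sqinter> u = \<^bold>0 \<or> x \<^bold>\<sqinter> u = u" if "x \<in> A" for x
    using low[of "x \<^bold>\<sqinter> u"] meet_le2[OF that A(1)] by (auto simp: lt_def)
  have "a \<noteq> v"
  proof
    assume av: "a = v"
    have "x \<in> {\<^bold>0, u, v, \<^bold>1}" if x: "x \<in> A" for x
    proof -
      have 1: "x \<^bold>\<sqinter> u = \<^bold>0 \<or> x \<^bold>\<sqinter> u = u" using le_u[OF x] .
      have 2: "x \<^bold>\<sqinter> v = \<^bold>0 \<or> x \<^bold>\<sqinter> v = v" using below_atom[OF a(1)] meet_le2[OF x A(2)] av by blast
      have "(x \<^bold>\<sqinter> u) \<^bold>\<squnion> (x \<^bold>\<sqinter> v) = x" using wc_split[OF x A(1)] v_def by simp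
      moreover have "u \<^bold>\<squnion> v = \<^bold>1" using join_wc[OF A(1)] v_def by simp
      ultimately show ?thesis using 1 2 join_absorb zero_le zero_mem A by (metis insertCI)
    qed
    then have "A \<subseteq> {\<^bold>0, u, v, \<^bold>1}" by blast
    then have "card A \<le> card {\<^bold>0, u, v, \<^bold>1}" by (intro card_mono) auto
    also have "\<dots> \<le> 4" by (simp add: card_insert_if)
    finally show False using n by simp
  qed
  then have av: "a \<prec> v" using a by (simp add: lt_def)
  have wa: "wc a = \<^bold>1" using wc_below_min_closed[OF mv av] .
  have au1: "a \<^bold>\<squnion> u = \<^bold>1"
  proof (rule up)
    show "u \<prec> a \<^bold>\<squnion> u" using join_ge1 join_ge2 aA A(1) au by (metis lt_def)
  qed
  have dv: "dwc v = \<^bold>0"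
  proof (rule ccontr)
    assume d: "dwc v \<noteq> \<^bold>0"
    have dA: "dwc v \<in> A" using dwc_mem A by blast
    have "(dwc v \<^bold>\<sqinter> u) \<^bold>\<squnion> (dwc v \<^bold>\<sqinter> v) = dwc v" using wc_split[OF dA A(1)] v_def by simp
    moreover have "dwc v \<^bold>\<sqinter> v = \<^bold>0" using meet_dwc[OF A(2)] meet_commute dA A by metis
    ultimately have "dwc v = dwc v \<^bold>\<sqinter> u"
      using join_absorb(2)[OF zero_le] meet_mem dA A by metis
    then have "dwc v = u" using d le_u[OF dA] by auto
    then have "(a \<^bold>\<squnion> v) \<^bold>\<sqinter> (a \<^bold>\<squnion> u) = a" using dwc_split[OF aA A(2)] by simp
    then have "v \<^bold>\<sqinter> \<^bold>1 = a" using join_absorb(1)[OF a(2)] au1 by simp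
    then show False using \<open>a \<noteq> v\<close> meet_absorb(1)[OF le_one] A by metis
  qed
  have "(\<^bold>0, \<^bold>1) \<in> r" if r: "r \<in> K" and h: "(\<^bold>0, a) \<in> r \<or> (\<^bold>0, u) \<in> r" for r
  proof -
    note c = K_congs[OF r]
    show ?thesis
      using h
    proof
      assume "(\<^bold>0, a) \<in> r"
      then have "(\<^bold>0 \<^bold>\<squnion> u, a \<^bold>\<squnion> u) \<in> r" using cong_join[OF c _ A(1)] by blast
      then have "(u, \<^bold>1) \<in> r" using join_absorb(1)[OF zero_le] A au1 by simp
      then have "(\<^bold>0, v) \<in> r" using collapse_closed[OF r cv] wv by simp
      then have "(\<^bold>1, \<^bold>0) \<in> r" using K_dwc[OF r] dwc_zero dv by metis
      then show ?thesis using cong_sym[OF c] by blast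
    next
      assume "(\<^bold>0, u) \<in> r"
      then have "(\<^bold>0 \<^bold>\<squnion> a, u \<^bold>\<squnion> a) \<in> r" using cong_join[OF c _ aA] by blast
      then have "(a, \<^bold>1) \<in> r" using join_absorb(1)[OF zero_le[OF aA]] join_commute aA A au1 by metis
      then have "(\<^bold>1, \<^bold>0) \<in> r" using K_wc[OF r] wa wc_one by metis
      then show ?thesis using cong_sym[OF c] by blast
    qed
  qed
  moreover have "a \<noteq> u" using au refl A by blast
  ultimately show thesis using that a(1) av v_def by blast
qed

lemma atom_coatom_equivalent:
  assumes u: "min_closed u" "u \<in> J" "lower_cover u = \<^bold>0" and up: "\<And>x. u \<prec> x \<Longrightarrow> x = \<^bold>1"
    and n: "card A \<ge> 5"
  obtains a where "a \<in> atoms" "a \<prec> wc u" "a \<noteq> u" "\<forall>r\<in>K. a \<in> E r \<longleftrightarrow> u \<in> E r"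
proof -
  have ua: "u \<in> atoms" using u by (simp add: atoms_def)
  have low: "x = \<^bold>0" if "x \<prec> u" for x using below_atom[OF ua] that by (auto simp: lt_def)
  obtain a where a: "a \<in> atoms" "a \<prec> wc u" "a \<noteq> u"
    "\<forall>r\<in>K. (\<^bold>0, a) \<in> r \<or> (\<^bold>0, u) \<in> r \<longrightarrow> (\<^bold>0, \<^bold>1) \<in> r"
    using atom_coatom_full[OF u(1) low up n] by blast
  have "a \<in> E r \<longleftrightarrow> u \<in> E r" if "r \<in> K" for r
    using a(4) that K_bounds_E[OF that] E_atom[OF K_congs[OF that]] a(1) ua atom_J by metis
  then have "\<forall>r\<in>K. a \<in> E r \<longleftrightarrow> u \<in> E r" by (rule ballI)
  with a(1,2,3) show thesis by (rule that)
qed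

lemma closed_join_R: "closed u \<Longrightarrow> \<^bold>1 \<in> R"
  using incomparable_join_R[OF closed_incomparable] join_wc closed_def by metis

text \<open>One coincidence of edges halves \<open>2^|J|\<close>. At most one closed element is join-reducible, namely \<open>m\<close>, so
  a join-irreducible minimal closed \<open>u\<close> exists. If \<open>u\<close> is an atom below \<open>m\<close>, it is replaced by \<open>wc u\<close>,
  which is then join-irreducible, minimal closed and not an atom. An atom \<open>u\<close> not below \<open>m\<close> is a coatom.\<close>

lemma two_reducibles_bound:
  assumes cl: "closed w" and R: "card R = 2" and n: "card A \<ge> 5"
  shows "card K \<le> 2 ^ (card J - 1)"
proof -
  have 1: "\<^bold>1 \<in> R" using closed_join_R[OF cl] .
  obtain m where m: "R = {\<^bold>1, m}" "m \<noteq> \<^bold>1"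
  proof -
    obtain x y where "R = {x, y}" "x \<noteq> y" using R by (auto simp: card_2_iff)
    then show thesis using that[of x] that[of y] 1 by auto
  qed
  have JR: "x \<in> J \<or> x = \<^bold>0 \<or> x = \<^bold>1 \<or> x = m" if "x \<in> A" for x
    using that m by (auto simp: R_def)
  obtain u where u: "min_closed u" "u \<in> J"
  proof -
    obtain u0 where u0: "min_closed u0" using min_closed_below[OF cl] by blast
    show thesis
    proof (cases "u0 \<in> J")
      case True then show thesis using that u0 by blast
    next
      case False
      have c0: "closed u0" using u0 by (simp add: min_closed_def)
      then have "u0 = m" using JR[of u0] False by (auto simp: closed_def)
      obtain u1 where u1: "min_closed u1" "u1 \<preceq> wc u0"
        using min_closed_below[OF closed_wc[OF c0]] by blast
      have "u1 \<noteq> m"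
        using u1(2) closed_incomparable[OF c0] \<open>u0 = m\<close> by (auto simp: incomparable_def)
      then have "u1 \<in> J" using JR[of u1] u1(1) by (auto simp: closed_def min_closed_def)
      then show thesis using that u1 by blast
    qed
  qed
  define v where "v = wc u"
  have cu: "closed u" using u(1) by (simp add: min_closed_def)
  have cv: "closed v" using closed_wc[OF cu] v_def by simp
  have A: "u \<in> A" "v \<in> A" and wv: "wc v = u" and v01: "v \<noteq> \<^bold>0" "v \<noteq> \<^bold>1"
    using cu cv by (auto simp: closed_def v_def)
  have inc: "u \<parallel> v" using closed_incomparable[OF cu] v_def by simp
  have half: ?thesis if v: "min_closed v" "v \<in> J" "lower_cover v \<noteq> \<^bold>0" for v
    using min_closed_non_atom[OF v] card_K_le_half atom_J v(2) by (metis lt_def)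
  have above: "x = m \<or> x = \<^bold>1" if x: "u \<prec> x" for x
  proof -
    have xA: "x \<in> A" using x lt_mem2 by blast
    have "x \<noteq> \<^bold>0" using x le_zero by (auto simp: lt_def)
    moreover have "x \<notin> J"
    proof
      assume "x \<in> J"
      then have "x \<preceq> u \<or> x \<preceq> v" using below_closed_or_wc A v_def by blast
      then show False
        using x inc lt_le trans antisym by (metis incomparable_def lt_def)
    qed
    ultimately show ?thesis using JR[OF xA] by blast
  qed
  show ?thesis
  proof (cases "lower_cover u = \<^bold>0")
    case False
    then show ?thesis using half[OF u] by blast
  next
    case lc: True
    show ?thesis
    proof (cases "u \<prec> m")
      case False
      then have "\<And>x. u \<prec> x \<Longrightarrow> x = \<^bold>1" using above by blast
      then show ?thesis
        using atom_coatom_equivalent[OF u lc _ n] card_K_le_half atom_J u(2) by metis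
    next
      case um: True
      have mA: "m \<in> A" using um lt_mem2 by blast
      have "v \<noteq> m" using um inc by (auto simp: incomparable_def lt_def)
      then have vJ: "v \<in> J" using JR[OF A(2)] v01 by blast
      have vm: "\<not> v \<preceq> m"
      proof
        assume "v \<preceq> m"
        then have "\<^bold>1 \<preceq> m" using join_least[OF lt_le[OF um]] join_wc[OF A(1)] v_def by metis
        then show False using one_le m(2) by blast
      qed
      have "min_closed (wc u)"
      proof (rule min_closed_wc[OF cu])
        fix x assume x: "u \<preceq> x" "closed x" "wc x \<prec> wc u"
        then have "x = m" using above[of x] by (auto simp: lt_def closed_def)
        moreover have "(v \<^bold>\<sqinter> wc x) \<^bold>\<squnion> (v \<^bold>\<sqinter> x) = v"
          using wc_split[OF A(2), of "wc x"] x(2) wc_mem by (simp add: closed_def)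
        ultimately have "v \<^bold>\<sqinter> wc x = v \<or> v \<^bold>\<sqinter> m = v"
          using join_irreducible[OF vJ] meet_mem A(2) wc_mem mA by blast
        then have "v \<^bold>\<sqinter> wc x = v" using meet_le2[OF A(2) mA] vm by auto
        then have "v \<preceq> wc x" using meet_le2[OF A(2), of "wc x"] wc_mem x(2) by (auto simp: closed_def)
        then show False using x(3) antisym v_def by (auto simp: lt_def)
      qed
      moreover have "lower_cover v \<noteq> \<^bold>0"
      proof
        assume l0: "lower_cover v = \<^bold>0"
        have "m \<^bold>\<sqinter> v \<prec> v" using meet_le1[OF mA A(2)] meet_le2[OF mA A(2)] vm by (metis lt_def)
        then have "m \<^bold>\<sqinter> v = \<^bold>0" using lower_cover(2)[OF vJ] l0 le_zero by metis
        then have "(m \<^bold>\<sqinter> u) \<^bold>\<squnion> \<^bold>0 = m" using wc_split[OF mA A(1)] v_def by simp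
        then have "u = m"
          using meet_absorb(2)[OF lt_le[OF um]] join_absorb(2)[OF zero_le[OF A(1)]] by simp
        then show False using um by (simp add: lt_def)
      qed
      ultimately show ?thesis using half vJ v_def by blast
    qed
  qed
qed

text \<open>All elements other than the bounds are join-irreducible, and a minimal closed element \<open>u\<close> and
  its image \<open>v = wc u\<close> are the only coatoms; both are minimal closed. If neither is an atom, each is tied to an
  atom below it. If one of them, say \<open>u\<close>, is an atom, then both \<open>u\<close> and \<open>v\<close> are tied to the same atom
  below \<open>v\<close>. In either case two edges are redundant.\<close>

lemma one_reducible_bound:
  assumes cl: "closed w" and R: "card R = 1" and n: "card A \<ge> 5"
  shows "card K \<le> 2 ^ (card J - 2)"
proof -
  have R1: "R = {\<^bold>1}" using closed_join_R[OF cl] R by (auto simp: card_1_singleton_iff)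
  have JR: "x \<in> J \<or> x = \<^bold>0 \<or> x = \<^bold>1" if "x \<in> A" for x
    using that R1 by (auto simp: R_def)
  obtain u where u: "min_closed u" using min_closed_below[OF cl] by blast
  define v where "v = wc u"
  have cu: "closed u" using u(1) by (simp add: min_closed_def)
  have cv: "closed v" using closed_wc[OF cu] v_def by simp
  have A: "u \<in> A" "v \<in> A" and wv: "wc v = u"
    using cu cv by (auto simp: closed_def v_def)
  have inc: "u \<parallel> v" using closed_incomparable[OF cu] v_def by simp
  have UJ: "u \<in> J" "v \<in> J" using JR cu cv by (auto simp: closed_def)
  have above: "x = \<^bold>1" if c: "closed u'" and x: "u' \<prec> x" for x u'
  proof -
    have xA: "x \<in> A" using x lt_mem2 by blast
    have "x \<noteq> \<^bold>0" using x le_zero by (auto simp: lt_def)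
    moreover have "x \<notin> J"
    proof
      assume "x \<in> J"
      then have "x \<preceq> u' \<or> x \<preceq> wc u'" using below_closed_or_wc c by (auto simp: closed_def)
      then show False
        using x closed_incomparable[OF c] lt_le trans antisym by (metis incomparable_def lt_def)
    qed
    ultimately show ?thesis using JR[OF xA] by blast
  qed
  have mv: "min_closed v"
    unfolding v_def
  proof (rule min_closed_wc[OF cu])
    fix x assume "u \<preceq> x" "closed x" "wc x \<prec> wc u"
    then show False using above[OF cu, of x] by (auto simp: lt_def closed_def)
  qed
  have two: ?thesis if ij: "i \<in> J" "j \<in> J" "i \<noteq> j"
    and d: "\<exists>d\<in>J - {i, j}. \<forall>r\<in>K. i \<in> E r \<longleftrightarrow> d \<in> E r" "\<exists>d\<in>J - {i, j}. \<forall>r\<in>K. j \<in> E r \<longleftrightarrow> d \<in> E r"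
    for i j
  proof -
    have "card K \<le> 2 ^ card (J - {i, j})"
      by (rule card_K_le) (use d in auto)
    moreover have "card (J - {i, j}) = card J - 2"
      using ij finite_J by (simp add: card_Diff_subset)
    ultimately show ?thesis by simp
  qed
  have at: ?thesis if p: "min_closed p" "lower_cover p = \<^bold>0" "p \<in> J" and q: "min_closed q" "q \<in> J" "q = wc p" for p q
  proof -
    have cp: "closed p" using p by (simp add: min_closed_def)
    have pq: "p \<noteq> q" using closed_incomparable[OF cp] q(3) refl by (auto simp: incomparable_def)
    obtain a where a: "a \<in> atoms" "a \<prec> q" "a \<noteq> p" "\<forall>r\<in>K. a \<in> E r \<longleftrightarrow> p \<in> E r"
      using atom_coatom_equivalent[OF p(1,3,2) above[OF cp] n] q(3) by blast
    have "\<forall>r\<in>K. a \<in> E r \<longleftrightarrow> q \<in> E r"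
      using min_closed_atom_equivalent[OF q(1,2) a(1,2)] by (rule ballI)
    moreover have "a \<in> J - {p, q}" using a atom_J by (auto simp: lt_def)
    ultimately show ?thesis using two[OF p(3) q(2) pq] a(4) by blast
  qed
  consider "lower_cover u = \<^bold>0" | "lower_cover v = \<^bold>0" | "lower_cover u \<noteq> \<^bold>0" "lower_cover v \<noteq> \<^bold>0"
    by blast
  then show ?thesis
  proof cases
    case 1 then show ?thesis using at[OF u _ UJ(1) mv UJ(2) v_def] by blast
  next
    case 2 then show ?thesis using at[OF mv _ UJ(2) u UJ(1)] wv by blast
  next
    case 3
    obtain a where a: "a \<in> atoms" "a \<prec> u" "\<forall>r\<in>K. a \<in> E r \<longleftrightarrow> u \<in> E r"
      using min_closed_non_atom[OF u UJ(1) 3(1)] by blast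
    obtain b where b: "b \<in> atoms" "b \<prec> v" "\<forall>r\<in>K. b \<in> E r \<longleftrightarrow> v \<in> E r"
      using min_closed_non_atom[OF mv UJ(2) 3(2)] by blast
    have ua: "u \<noteq> a" "v \<noteq> b" using a b by (auto simp: lt_def)
    have na: "u \<notin> atoms" "v \<notin> atoms" using 3 by (auto simp: atoms_def)
    have uv: "u \<noteq> v" using inc refl by (auto simp: incomparable_def)
    show ?thesis
    proof (rule two[OF UJ uv])
      show "\<exists>d\<in>J - {u, v}. \<forall>r\<in>K. u \<in> E r \<longleftrightarrow> d \<in> E r" using a na atom_J by blast
      show "\<exists>d\<in>J - {u, v}. \<forall>r\<in>K. v \<in> E r \<longleftrightarrow> d \<in> E r" using b na atom_J by blast
    qed
  qed
qed

lemma nontrivial_wc_bound: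
  assumes x: "x \<in> A" "x \<noteq> \<^bold>1" "wc x \<noteq> \<^bold>1" and n: "card A \<ge> 5"
  shows "card K \<le> 2 ^ (card A - 4)"
proof -
  have cl: "closed (wc x)" using wc_closed[OF x] .
  have "R \<noteq> {}" "finite R" using closed_join_R[OF cl] finite_A by (auto simp: R_def)
  then have "card R \<noteq> 0" by simp
  then consider "card R = 1" | "card R = 2" | "card R \<ge> 3" by linarith
  then show ?thesis
  proof cases
    case 1
    then have "card J - 2 = card A - 4" using card_J_R by linarith
    then show ?thesis using one_reducible_bound[OF cl 1 n] by simp
  next
    case 2
    then have "card J - 1 = card A - 4" using card_J_R by linarith
    then show ?thesis using two_reducibles_bound[OF cl 2 n] by simp
  next
    case 3
    have "card K \<le> 2 ^ card J" using card_K_le[of J] by blast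
    also have "\<dots> \<le> 2 ^ (card A - 4)" using 3 card_J_R by (intro power_increasing) auto
    finally show ?thesis .
  qed
qed

end

text \<open>The congruences and the number of elements do not change under duality, although the
  join-irreducible elements do.\<close>

lemma (in finite_wdl) nontrivial_dwc_bound:
  assumes "x \<in> A" "x \<noteq> \<^bold>0" "dwc x \<noteq> \<^bold>0" and "card A \<ge> 5"
  shows "card K \<le> 2 ^ (card A - 4)"
proof -
  interpret d: finite_wdl A "\<lambda>x y. y \<preceq> x" "(\<^bold>\<squnion>)" "(\<^bold>\<sqinter>)" "\<^bold>1" "\<^bold>0" dwc wc
    by (rule dual)
  have "d.K = K"
    unfolding K_def d.K_def congs_def d.congs_def by auto
  then show ?thesis using d.nontrivial_wc_bound assms by simp
qed

section \<open>Two shapes of lattices\<close>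

context finite_lattice
begin

lemma join_only_reducible: "R = {r} \<Longrightarrow> x \<parallel> y \<Longrightarrow> x \<^bold>\<squnion> y = r"
  using incomparable_join_R by blast

text \<open>A minimal \<open>z\<close> with \<open>x \<^bold>\<sqinter> y \<preceq> z \<preceq> x\<close> and not \<open>z \<preceq> y\<close>: its edge leads from below \<open>y\<close> to an element
  incomparable with \<open>y\<close>, so a congruence collapsing it identifies \<open>y\<close> with \<open>z \<^bold>\<squnion> y\<close>.\<close>

lemma branching_edge:
  assumes xy: "x \<parallel> y" and c: "x \<^bold>\<sqinter> y \<noteq> \<^bold>0" and R: "R = {x \<^bold>\<squnion> y}"
  obtains z where "z \<preceq> x" "z \<parallel> y" "z \<in> J" "lower_cover z \<preceq> y" "lower_cover z \<noteq> \<^bold>0"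
proof -
  have A: "x \<in> A" "y \<in> A" using xy incomparable_mem by blast+
  define c where "c = x \<^bold>\<sqinter> y"
  have cxy: "c \<preceq> x" "c \<preceq> y" using meet_le1 meet_le2 A c_def by blast+
  let ?S = "{z. z \<preceq> x \<and> \<not> z \<preceq> y \<and> c \<preceq> z}"
  have "?S \<subseteq> A" "x \<in> ?S" using leq_mem1 refl A cxy xy by (auto simp: incomparable_def)
  then obtain z where z: "z \<in> ?S" "\<And>t. t \<prec> z \<Longrightarrow> t \<notin> ?S"
    by (rule exists_minimal) blast
  have zA: "z \<in> A" using z leq_mem1 by blast
  have "z \<noteq> x \<^bold>\<squnion> y"
    using z(1) xy join_ge2[OF A] trans by (auto simp: incomparable_def)
  moreover have "z \<noteq> \<^bold>0" using z(1) zero_le A by blast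
  ultimately have zJ: "z \<in> J" using R zA unfolding R_def by blast
  note lc = lower_cover[OF zJ]
  have "c \<prec> z" using z(1) cxy by (auto simp: lt_def)
  then have clc: "c \<preceq> lower_cover z" using lc(2) by blast
  have "lower_cover z \<preceq> x" using lc(1) z(1) trans lt_le by blast
  then have "lower_cover z \<preceq> y" using z(2)[OF lc(1)] clc by blast
  moreover have "lower_cover z \<noteq> \<^bold>0" using clc le_zero[of c] c c_def by metis
  moreover have "z \<parallel> y" using z(1) xy zA trans[of y z x] by (auto simp: incomparable_def)
  ultimately show thesis using that[of z] z(1) zJ by simp
qed

text \<open>The two shapes are described by their incomparable pairs only; the isomorphisms with the sums of
  chains come later.\<close>

definition two_chain_horizontal_sum :: bool where
  "two_chain_horizontal_sum \<longleftrightarrow> (\<exists>x y. x \<parallel> y) \<and> (\<forall>x y. x \<parallel> y \<longrightarrow> x \<^bold>\<sqinter> y = \<^bold>0 \<and> x \<^bold>\<squnion> y = \<^bold>1) \<and>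
     (\<forall>x y z. x \<parallel> y \<longrightarrow> y \<parallel> z \<longrightarrow> \<not> x \<parallel> z)"

definition single_inner_diamond :: bool where
  "single_inner_diamond \<longleftrightarrow> (\<exists>a b. a \<parallel> b \<and> (\<forall>x y. x \<parallel> y \<longrightarrow> {x, y} = {a, b}) \<and>
     a \<^bold>\<sqinter> b \<noteq> \<^bold>0 \<and> a \<^bold>\<squnion> b \<noteq> \<^bold>1)"

lemma horizontal_sum_atoms:
  assumes two_chain_horizontal_sum
  obtains p q where "p \<noteq> q" "atoms = {p, q}"
proof -
  obtain x y where xy: "x \<parallel> y" "x \<^bold>\<sqinter> y = \<^bold>0"
    using assms unfolding two_chain_horizontal_sum_def by blast
  obtain p where p: "p \<in> atoms" "p \<preceq> x"
    using atom_below[OF incomparable_mem(1)[OF xy(1)] incomparable_not_bound(1)[OF xy(1)]] by blast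
  obtain q where q: "q \<in> atoms" "q \<preceq> y"
    using atom_below[OF incomparable_mem(2)[OF xy(1)] incomparable_not_bound(3)[OF xy(1)]] by blast
  have pq: "p \<noteq> q"
  proof
    assume "p = q"
    then have "p \<preceq> \<^bold>0" using meet_greatest[of p x y] p q xy(2) by simp
    then show False using le_zero J_nonzero[OF atom_J[OF p(1)]] by blast
  qed
  have "atoms = {p, q}"
  proof (rule ccontr)
    assume "atoms \<noteq> {p, q}"
    then obtain t where "t \<in> atoms" "t \<noteq> p" "t \<noteq> q" using p q by blast
    then have "p \<parallel> q" "q \<parallel> t" "p \<parallel> t" using atoms_incomparable p q pq by auto
    then show False using assms unfolding two_chain_horizontal_sum_def by blast
  qed
  then show thesis using that pq by blast
qed

lemma nonchain_bounds: assumes "R \<noteq> {}" shows "\<^bold>0 \<noteq> \<^bold>1"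
proof
  assume eq: "\<^bold>0 = \<^bold>1"
  obtain x y where "x \<parallel> y" using assms R_join by blast
  then show False
    using le_one[OF incomparable_mem(1)] le_zero[of x] incomparable_not_bound(1)[of x y] eq by simp
qed

lemma unique_atom_below:
  assumes "atoms = {a}" "x \<in> A" "x \<noteq> \<^bold>0" shows "a \<preceq> x"
  by (rule atom_below[OF assms(2,3)]) (use assms(1) in simp)

lemma one_notin_atoms: assumes "R \<noteq> {}" shows "\<^bold>1 \<notin> atoms"
proof
  assume one: "\<^bold>1 \<in> atoms"
  obtain x y where xy: "x \<parallel> y" using assms R_join by blast
  then show False
    using below_atom[OF one le_one[OF incomparable_mem(1)[OF xy]]] incomparable_not_bound(1,2)[OF xy]
    by blast
qed

lemma E_point_join:
  assumes "r \<in> congs" "z \<in> E r" "z \<parallel> y" "lower_cover z \<preceq> y"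
  shows "(y, z \<^bold>\<squnion> y) \<in> r"
proof -
  have "(lower_cover z \<^bold>\<squnion> y, z \<^bold>\<squnion> y) \<in> r"
    using cong_join[OF assms(1)] assms(2) incomparable_mem(2)[OF assms(3)] by (simp add: E_def)
  then show ?thesis using join_absorb(1)[OF assms(4)] by simp
qed

end

section \<open>Trivial operations: the upper bound\<close>

context finite_wdl
begin

definition P :: "('a \<times> 'a) set set" where
  "P = K - {A \<times> A}"

lemma P_congs: "r \<in> P \<Longrightarrow> r \<in> congs"
  by (simp add: P_def K_congs)

lemma full_K: "A \<times> A \<in> K"
  using meet_mem join_mem wc_mem dwc_mem by (auto simp: K_def congs_def intro!: equivI refl_onI symI transI)

lemma Id_K: "Id_on A \<in> K"
  using meet_mem join_mem wc_mem dwc_mem by (auto simp: K_def congs_def intro!: equivI refl_onI symI transI)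

lemma card_K: "card K = card P + 1"
  unfolding P_def using full_K finite_K by (metis card.remove add.commute plus_1_eq_Suc)

lemma P_bounds: "r \<in> P \<Longrightarrow> (\<^bold>0, \<^bold>1) \<notin> r"
  using K_bounds_collapsed by (auto simp: P_def)

lemma Id_P: "\<^bold>0 \<noteq> \<^bold>1 \<Longrightarrow> Id_on A \<in> P"
  using Id_K zero_mem one_mem by (auto simp: P_def)

lemma card_P_image: "card P = card (E ` P)"
  by (rule card_image[symmetric]) (use E_inj P_congs in \<open>auto simp: inj_on_def\<close>)

lemma card_P_le: "E ` P \<subseteq> Y \<Longrightarrow> finite Y \<Longrightarrow> card P \<le> card Y"
  using card_P_image card_mono by metis

lemma card_P_eq: "E ` P \<subseteq> Y \<Longrightarrow> finite Y \<Longrightarrow> card P = card Y \<Longrightarrow> E ` P = Y"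
  using card_P_image card_subset_eq by metis

definition wc_trivial :: bool where
  "wc_trivial \<longleftrightarrow> (\<forall>x\<in>A. x \<noteq> \<^bold>1 \<longrightarrow> wc x = \<^bold>1)"

definition dwc_trivial :: bool where
  "dwc_trivial \<longleftrightarrow> (\<forall>x\<in>A. x \<noteq> \<^bold>0 \<longrightarrow> dwc x = \<^bold>0)"

lemma one_isolated:
  assumes "wc_trivial" "r \<in> P" "(x, \<^bold>1) \<in> r" shows "x = \<^bold>1"
proof (rule ccontr)
  assume "x \<noteq> \<^bold>1"
  moreover have "x \<in> A" using cong_mem[OF P_congs] assms by blast
  ultimately have "(\<^bold>1, \<^bold>0) \<in> r"
    using K_wc[of r x "\<^bold>1"] assms wc_one by (auto simp: wc_trivial_def P_def)
  then show False using P_bounds[OF assms(2)] cong_sym[OF P_congs[OF assms(2)]] by blast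
qed

lemma zero_isolated:
  assumes "dwc_trivial" "r \<in> P" "(\<^bold>0, x) \<in> r" shows "x = \<^bold>0"
proof (rule ccontr)
  assume "x \<noteq> \<^bold>0"
  moreover have "x \<in> A" using cong_mem[OF P_congs] assms by blast
  ultimately have "(\<^bold>1, \<^bold>0) \<in> r"
    using K_dwc[of r "\<^bold>0" x] assms dwc_zero by (auto simp: dwc_trivial_def P_def)
  then show False using P_bounds[OF assms(2)] cong_sym[OF P_congs[OF assms(2)]] by blast
qed

lemma E_no_atoms: "dwc_trivial \<Longrightarrow> r \<in> P \<Longrightarrow> E r \<subseteq> J - atoms"
  using zero_isolated E_atom[OF P_congs] J_nonzero E_subset[OF P_congs] by blast

lemma E_no_one: "wc_trivial \<Longrightarrow> r \<in> P \<Longrightarrow> \<^bold>1 \<notin> E r"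
  using one_isolated lower_cover(1) by (auto simp: E_def lt_def)

text \<open>No atom is collapsed. In the case of equality there are exactly two atoms and one join-reducible
  element, and each remaining edge is collapsed alone by some congruence. The reducible element is 1,
  as otherwise the edge below 1 could be collapsed; and two incomparable elements with a nonzero meet
  would provide an edge with nonzero bottom whose collapse identifies an element other than 1 with 1.\<close>

lemma several_atoms_bound:
  assumes triv: "wc_trivial" "dwc_trivial" and R: "R \<noteq> {}" and two: "p \<in> atoms" "q \<in> atoms" "p \<noteq> q"
  shows "card P \<le> 2 ^ (card A - 4)"
    and "card P = 2 ^ (card A - 4) \<Longrightarrow> two_chain_horizontal_sum"
proof -
  have fa: "finite atoms" "atoms \<subseteq> J" using finite_J by (auto simp: atoms_def)
  have a2: "card atoms \<ge> 2"
    using card_mono[OF fa(1), of "{p, q}"] two by simp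
  have R1: "card R \<ge> 1"
    using R finite_A by (simp add: R_def Suc_leI card_gt_0_iff)
  have cd: "card (J - atoms) = card J - card atoms" "card atoms \<le> card J"
    using card_Diff_subset[OF fa] card_mono[OF finite_J fa(2)] by auto
  have sub: "E ` P \<subseteq> Pow (J - atoms)" using E_no_atoms triv(2) by auto
  have fin: "finite (Pow (J - atoms))" using finite_J by simp
  have card_Y: "card (Pow (J - atoms)) = 2 ^ card (J - atoms)"
    using finite_J by (simp add: card_Pow)
  have le: "card (J - atoms) \<le> card A - 4" using cd a2 R1 card_J_R by linarith
  then have le2: "(2::nat) ^ card (J - atoms) \<le> 2 ^ (card A - 4)" by simp
  show "card P \<le> 2 ^ (card A - 4)"
    using card_P_le[OF sub fin] card_Y le2 by linarith
  assume eq: "card P = 2 ^ (card A - 4)"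
  then have eqs: "card P = card (Pow (J - atoms))" "(2::nat) ^ card (J - atoms) = 2 ^ (card A - 4)"
    using card_P_le[OF sub fin] card_Y le2 by linarith+
  then have full: "E ` P = Pow (J - atoms)" using card_P_eq[OF sub fin] by blast
  have "card (J - atoms) = card A - 4" using eqs(2) by simp
  then have "card R = 1" and at2: "card atoms = 2" using cd a2 R1 card_J_R by linarith+
  then obtain r where r: "R = {r}" by (auto simp: card_1_singleton_iff)
  have real: "\<exists>s\<in>P. E s = {z}" if "z \<in> J" "z \<notin> atoms" for z
  proof -
    have "{z} \<in> E ` P" using that full by simp
    then show ?thesis by auto
  qed
  have "r = \<^bold>1"
  proof (rule ccontr)
    assume "r \<noteq> \<^bold>1"
    then have "\<^bold>1 \<notin> R" using r by simp
    then have "\<^bold>1 \<in> J" using nonchain_bounds[OF R] one_mem unfolding R_def by simp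
    then obtain s where "s \<in> P" "E s = {\<^bold>1}" using real one_notin_atoms[OF R] by blast
    then show False using E_no_one[OF triv(1)] by blast
  qed
  then have R1: "R = {\<^bold>1}" using r by simp
  have j1: "x \<^bold>\<squnion> y = \<^bold>1" if "x \<parallel> y" for x y using join_only_reducible[OF R1 that] .
  have m0: "x \<^bold>\<sqinter> y = \<^bold>0" if xy: "x \<parallel> y" for x y
  proof (rule ccontr)
    assume c: "x \<^bold>\<sqinter> y \<noteq> \<^bold>0"
    obtain z where z: "z \<preceq> x" "z \<parallel> y" "z \<in> J" "lower_cover z \<preceq> y" "lower_cover z \<noteq> \<^bold>0"
      using branching_edge[OF xy c] R1 j1[OF xy] by metis
    obtain s where s: "s \<in> P" "E s = {z}" using real[OF z(3)] z(5) by (auto simp: atoms_def)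
    have "(y, \<^bold>1) \<in> s" using E_point_join[OF P_congs[OF s(1)] _ z(2,4)] s(2) j1[OF z(2)] by simp
    then show False using one_isolated[OF triv(1) s(1)] incomparable_not_bound xy by blast
  qed
  have "\<not> x \<parallel> z" if xyz: "x \<parallel> y" "y \<parallel> z" for x y z
  proof
    assume xz: "x \<parallel> z"
    obtain a where a: "a \<in> atoms" "a \<preceq> x"
      using atom_below[OF incomparable_mem(1)[OF xz] incomparable_not_bound(1)[OF xz]] by blast
    obtain b where b: "b \<in> atoms" "b \<preceq> y"
      using atom_below[OF incomparable_mem(1)[OF xyz(2)] incomparable_not_bound(1)[OF xyz(2)]] by blast
    obtain c where c: "c \<in> atoms" "c \<preceq> z"
      using atom_below[OF incomparable_mem(2)[OF xz] incomparable_not_bound(3)[OF xz]] by blast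
    have no: "\<not> (t \<preceq> u \<and> t \<preceq> v)" if "t \<in> atoms" "u \<parallel> v" for t u v
      using that m0[OF that(2)] meet_greatest[of t u v] le_zero J_nonzero[OF atom_J[OF that(1)]] by auto
    have "a \<noteq> b" "b \<noteq> c" "a \<noteq> c" using no xyz xz a b c by blast+
    then have "card {a, b, c} = 3" by simp
    then show False using card_mono[OF fa(1), of "{a, b, c}"] a b c at2 by simp
  qed
  moreover have "p \<parallel> q" using atoms_incomparable two by blast
  ultimately show two_chain_horizontal_sum
    using j1 m0 unfolding two_chain_horizontal_sum_def by blast
qed

text \<open>Collapsing all edges but the lowest one identifies the atom with 1.\<close>

lemma unique_atom_bound_exception:
  assumes triv: "wc_trivial" "dwc_trivial" and a: "atoms = {a}" "a \<noteq> \<^bold>1" and r: "r \<in> P"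
  shows "E r \<noteq> J - {a}"
proof
  assume E: "E r = J - {a}"
  note c = P_congs[OF r]
  have aA: "a \<in> A" using a J_mem atom_J by blast
  have "x \<noteq> \<^bold>0 \<longrightarrow> (a, x) \<in> r" if "x \<in> A" for x
    using that
  proof (induction x rule: below_induct)
    case (below x)
    show ?case
    proof
      assume x0: "x \<noteq> \<^bold>0"
      consider "x = a" | "x \<in> J" "x \<noteq> a" | "x \<notin> J" by blast
      then show "(a, x) \<in> r"
      proof cases
        case 1 then show ?thesis using cong_refl[OF c aA] by simp
      next
        case 2
        then have "lower_cover x \<noteq> \<^bold>0" using a by (auto simp: atoms_def)
        then have "(a, lower_cover x) \<in> r" using below.IH lower_cover(1)[OF 2(1)] by blast
        moreover have "(lower_cover x, x) \<in> r" using 2 E by (auto simp: E_def)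
        ultimately show ?thesis using cong_trans[OF c] by blast
      next
        case 3
        obtain y z where yz: "y \<prec> x" "z \<prec> x" "y \<^bold>\<squnion> z = x"
          using not_J_join[OF below.hyps x0 3] by blast
        have "y \<noteq> \<^bold>0"
          using yz(2,3) join_absorb(1)[OF zero_le[OF lt_mem1[OF yz(2)]]] by (auto simp: lt_def)
        moreover have "z \<noteq> \<^bold>0"
          using yz(1,3) join_absorb(2)[OF zero_le[OF lt_mem1[OF yz(1)]]] by (auto simp: lt_def)
        ultimately have "(a \<^bold>\<squnion> a, y \<^bold>\<squnion> z) \<in> r" using below.IH yz cong_join2[OF c] by blast
        then show ?thesis using yz(3) join_absorb(1)[OF refl[OF aA]] by simp
      qed
    qed
  qed
  moreover have "\<^bold>0 \<noteq> \<^bold>1" using P_bounds[OF r] cong_refl[OF c zero_mem] by auto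
  ultimately have "(a, \<^bold>1) \<in> r" using one_mem by blast
  then show False using one_isolated triv(1) r a(2) by blast
qed

text \<open>Each edge other than the lowest and the highest is collapsed alone by some congruence. For
  incomparable \<open>x\<close> and \<open>y\<close> this forces \<open>x \<^bold>\<sqinter> y\<close> to be the lower cover of both, as otherwise collapsing
  the first edge of \<open>x\<close> outside \<open>y\<close> would collapse the last one as well. It excludes a third
  incomparable element, and since \<open>r\<close> is the join of every incomparable pair, a second pair.\<close>

lemma diamond_from_all_subsets:
  assumes a: "atoms = {a}" and R: "R = {r}" "r \<noteq> \<^bold>1"
    and full: "E ` P = Pow (J - {a, \<^bold>1})"
  shows single_inner_diamond
proof -
  have real: "\<exists>s\<in>P. E s = {z}" if "z \<in> J" "z \<noteq> a" "z \<noteq> \<^bold>1" for z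
  proof -
    have "{z} \<in> E ` P" using that full by simp
    then show ?thesis by auto
  qed
  have jr: "x \<^bold>\<squnion> y = r" if "x \<parallel> y" for x y using join_only_reducible[OF R(1) that] .
  have lt_r: "x \<prec> r" if "x \<parallel> y" for x y using incomparable_lt_join(1)[OF that] jr[OF that] by simp
  have inJ: "x \<in> J" if "x \<parallel> y" for x y
  proof -
    have "x \<notin> R" using R(1) lt_r[OF that] by (simp add: lt_def)
    then show ?thesis
      using incomparable_mem(1)[OF that] incomparable_not_bound(1)[OF that] unfolding R_def by simp
  qed
  have meet_nz: "x \<^bold>\<sqinter> y \<noteq> \<^bold>0" if "x \<parallel> y" for x y
  proof
    assume "x \<^bold>\<sqinter> y = \<^bold>0"
    moreover have "a \<preceq> x" "a \<preceq> y"
      using unique_atom_below[OF a] incomparable_mem incomparable_not_bound that by blast+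
    ultimately have "a = \<^bold>0" using meet_greatest le_zero by metis
    then show False using a J_nonzero by (auto simp: atoms_def)
  qed
  have na: "x \<noteq> a" if "x \<parallel> y" for x y
    using unique_atom_below[OF a incomparable_mem(2) incomparable_not_bound(3)] that
    by (auto simp: incomparable_def)
  \<comment> \<open>Collapsing the edge \<open>z\<close> alone identifies \<open>y\<close> with \<open>r\<close>, hence \<open>x \<^bold>\<sqinter> y\<close> with \<open>x\<close>; so the edge
     below \<open>x\<close> is \<open>z\<close> itself.\<close>
  have lc: "lower_cover x = x \<^bold>\<sqinter> y" if xy: "x \<parallel> y" for x y
  proof -
    have A: "x \<in> A" "y \<in> A" using xy incomparable_mem by blast+
    obtain z where z: "z \<preceq> x" "z \<parallel> y" "z \<in> J" "lower_cover z \<preceq> y" "lower_cover z \<noteq> \<^bold>0"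
      using branching_edge[OF xy meet_nz[OF xy]] R(1) jr[OF xy] by metis
    obtain s where s: "s \<in> P" "E s = {z}"
      using real[OF z(3) na[OF z(2)]] incomparable_not_bound(2)[OF z(2)] by blast
    note c = P_congs[OF s(1)]
    have "(y, r) \<in> s" using E_point_join[OF c _ z(2,4)] s(2) jr[OF z(2)] by simp
    then have "(y \<^bold>\<sqinter> x, r \<^bold>\<sqinter> x) \<in> s" using cong_meet[OF c _ A(1)] by blast
    then have "(x \<^bold>\<sqinter> y, x) \<in> s"
      using meet_absorb(2)[OF lt_le[OF lt_r[OF xy]]] meet_commute[OF A] by simp
    then have "x \<in> E s" using collapse_E[OF c _ meet_lt_incomparable(1)[OF xy] inJ[OF xy]] by blast
    then have "x = z" using s(2) by simp
    then have "lower_cover x \<preceq> x \<^bold>\<sqinter> y"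
      using z(4) lower_cover(1)[OF inJ[OF xy]] lt_le meet_greatest by blast
    moreover have "x \<^bold>\<sqinter> y \<preceq> lower_cover x"
      using lower_cover(2)[OF inJ[OF xy] meet_lt_incomparable(1)[OF xy]] .
    ultimately show ?thesis by (rule antisym)
  qed
  have uniq: "y = w" if xy: "x \<parallel> y" and xw: "x \<parallel> w" for x y w
  proof (rule ccontr)
    assume yw: "y \<noteq> w"
    have A: "x \<in> A" "y \<in> A" "w \<in> A" using xy xw incomparable_mem by blast+
    note yx = incomparable_sym[OF xy] and wx = incomparable_sym[OF xw]
    have below_x: "u \<preceq> x" if "u \<prec> v" "v \<parallel> x" for u v
      using lower_cover(2)[OF inJ[OF that(2)] that(1)] lc[OF that(2)] trans
        meet_le2[OF incomparable_mem(1)[OF that(2)] A(1)] by metis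
    \<comment> \<open>With their common meet and join, \<open>x\<close>, \<open>y\<close> and \<open>w\<close> form a simple sublattice with three atoms,
       so the edge below \<open>x\<close> is not collapsed alone.\<close>
    have ywi: "y \<parallel> w"
      using yw below_x[of y w] below_x[of w y] xy xw A yx wx by (auto simp: incomparable_def lt_def)
    obtain s where s: "s \<in> P" "E s = {x}"
      using real[OF inJ[OF xy] na[OF xy]] incomparable_not_bound(2)[OF xy] by blast
    note c = P_congs[OF s(1)]
    have "lower_cover x \<preceq> y" using lc[OF xy] meet_le2 A by metis
    then have "(y, r) \<in> s" using E_point_join[OF c _ xy] s(2) jr[OF xy] by simp
    then have "(y \<^bold>\<sqinter> w, r \<^bold>\<sqinter> w) \<in> s" using cong_meet[OF c _ A(3)] by blast
    then have "(y \<^bold>\<sqinter> w, w) \<in> s"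
      using meet_absorb(2)[OF lt_le[OF lt_r[OF wx]]] by simp
    then have "w \<in> E s" using collapse_E[OF c _ meet_lt_incomparable(2)[OF ywi] inJ[OF wx]] by blast
    then show False using s(2) xw refl A by (auto simp: incomparable_def)
  qed
  obtain x y where xy: "x \<parallel> y" using R(1) R_join by (metis singletonI)
  have Axy: "x \<in> A" "y \<in> A" using xy incomparable_mem by blast+
  note yx = incomparable_sym[OF xy]
  have below: "t \<prec> x" if t: "t \<parallel> u" and ne: "t \<noteq> x" "t \<noteq> y" for t u
  proof -
    have tA: "t \<in> A" using t incomparable_mem by blast
    have "\<not> x \<parallel> t" "\<not> y \<parallel> t" using uniq[OF xy, of t] uniq[OF yx, of t] ne by auto
    then have "x \<preceq> t \<or> t \<preceq> x" "y \<preceq> t \<or> t \<preceq> y" using tA Axy by (auto simp: incomparable_def)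
    moreover have "\<not> (x \<preceq> t \<and> y \<preceq> t)"
    proof
      assume "x \<preceq> t \<and> y \<preceq> t"
      then have "r \<preceq> t" using join_least jr[OF xy] by metis
      then show False using lt_r[OF t] antisym by (auto simp: lt_def)
    qed
    moreover have "\<not> (x \<preceq> t \<and> t \<preceq> y)" using trans xy by (auto simp: incomparable_def)
    ultimately show ?thesis using ne by (auto simp: lt_def)
  qed
  have "{x', y'} = {x, y}" if p: "x' \<parallel> y'" for x' y'
  proof (cases "x' \<in> {x, y} \<or> y' \<in> {x, y}")
    case True
    then show ?thesis
      using uniq[OF xy] uniq[OF yx] p incomparable_sym[OF p] by blast
  next
    case False
    then have "x' \<prec> x" "y' \<prec> x" using below[OF p] below[OF incomparable_sym[OF p]] by auto
    then have "r \<preceq> x" using join_least jr[OF p] lt_le by metis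
    then have False using lt_r[OF xy] antisym by (auto simp: lt_def)
    then show ?thesis ..
  qed
  moreover have "x \<^bold>\<squnion> y \<noteq> \<^bold>1" using jr[OF xy] R(2) by simp
  ultimately show ?thesis
    using xy meet_nz[OF xy] unfolding single_inner_diamond_def by blast
qed

text \<open>The lowest edge is lost. With at least two join-reducible elements the bound follows, and it is strict because
  of the excluded set \<open>J - {a}\<close>. With \<open>R = {1}\<close>, the two edges at the branching point of an incomparable pair are
  lost, since collapsing them identifies an element with 1. With \<open>R = {r}\<close> and \<open>r \<noteq> 1\<close>, the edge below 1
  is lost, and this is the only case in which the bound may be attained.\<close>

lemma unique_atom_bound:
  assumes triv: "wc_trivial" "dwc_trivial" and R: "R \<noteq> {}" and a: "atoms = {a}"
  shows "card P \<le> 2 ^ (card A - 4)"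
    and "card P = 2 ^ (card A - 4) \<Longrightarrow> single_inner_diamond"
proof -
  have aJ: "a \<in> J" using a atom_J by blast
  have a1: "a \<noteq> \<^bold>1" using one_notin_atoms[OF R] a by blast
  have Ea: "E s \<subseteq> J - {a}" if "s \<in> P" for s using E_no_atoms[OF triv(2) that] a by simp
  have finR: "finite R" using finite_A by (simp add: R_def)
  then consider "card R \<ge> 2" | "card R = 1" using R by (metis One_nat_def card_gt_0_iff Suc_leI le_antisym not_less_eq_eq numeral_2_eq_2)
  then have "card P \<le> 2 ^ (card A - 4) \<and> (card P = 2 ^ (card A - 4) \<longrightarrow> single_inner_diamond)"
  proof cases
    case 1
    let ?Y = "Pow (J - {a}) - {J - {a}}"
    have "E ` P \<subseteq> ?Y" using Ea unique_atom_bound_exception[OF triv a a1] by auto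
    then have "card P \<le> card ?Y" using card_P_le finite_J by blast
    also have "card ?Y = 2 ^ (card J - 1) - 1" using finite_J aJ by (simp add: card_Pow card_Diff_singleton)
    also have "\<dots> < 2 ^ (card J - 1)" by simp
    also have "\<dots> \<le> 2 ^ (card A - 4)" using 1 card_J_R by (intro power_increasing) auto
    finally show ?thesis by simp
  next
    case 2
    then obtain r where r: "R = {r}" by (auto simp: card_1_singleton_iff)
    have cJ: "card J = card A - 2" using 2 card_J_R by linarith
    show ?thesis
    proof (cases "r = \<^bold>1")
      case True
      obtain x y where xy: "x \<parallel> y" using r R_join by (metis singletonI)
      note yx = incomparable_sym[OF xy]
      have A: "x \<in> A" "y \<in> A" using xy incomparable_mem by blast+
      have jr: "t \<^bold>\<squnion> u = \<^bold>1" if "t \<parallel> u" for t u using join_only_reducible[OF r that] True by simp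
      have "a \<preceq> x \<^bold>\<sqinter> y"
        using unique_atom_below[OF a] A incomparable_not_bound[OF xy] meet_greatest by blast
      then have mnz: "x \<^bold>\<sqinter> y \<noteq> \<^bold>0" "y \<^bold>\<sqinter> x \<noteq> \<^bold>0"
        using le_zero J_nonzero[OF aJ] meet_commute A by metis+
      obtain z where z: "z \<preceq> x" "z \<parallel> y" "z \<in> J" "lower_cover z \<preceq> y" "lower_cover z \<noteq> \<^bold>0"
        using branching_edge[OF xy mnz(1)] r True jr[OF xy] by metis
      obtain w where w: "w \<preceq> y" "w \<parallel> x" "w \<in> J" "lower_cover w \<preceq> x" "lower_cover w \<noteq> \<^bold>0"
        using branching_edge[OF yx mnz(2)] r True jr[OF yx] by metis
      have no: "t \<notin> E s" if "s \<in> P" "t \<parallel> u" "lower_cover t \<preceq> u" for s t u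
        using E_point_join[OF P_congs[OF that(1)] _ that(2,3)] jr[OF that(2)]
          one_isolated[OF triv(1) that(1)] incomparable_not_bound(4)[OF that(2)] by metis
      have sub: "E ` P \<subseteq> Pow (J - {a, z, w})" using Ea no z w by blast
      have ne: "z \<noteq> a" "w \<noteq> a" "z \<noteq> w" using z w a by (auto simp: atoms_def incomparable_def)
      have "card (J - {a, z, w}) = card J - card {a, z, w}"
        using aJ z(3) w(3) by (intro card_Diff_subset) auto
      moreover have c3: "card {a, z, w} = 3" using ne by simp
      moreover have "card {a, z, w} \<le> card J" using aJ z(3) w(3) finite_J by (intro card_mono) auto
      ultimately have lt: "card (J - {a, z, w}) < card A - 4" using cJ by linarith
      have "card P \<le> card (Pow (J - {a, z, w}))" using card_P_le[OF sub] finite_J by blast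
      also have "\<dots> = 2 ^ card (J - {a, z, w})" using finite_J by (simp add: card_Pow)
      also have "\<dots> < 2 ^ (card A - 4)" using lt by (intro power_strict_increasing) auto
      finally show ?thesis by simp
    next
      case False
      then have "\<^bold>1 \<notin> R" using r by simp
      then have J1: "\<^bold>1 \<in> J" using nonchain_bounds[OF R] one_mem unfolding R_def by simp
      have sub: "E ` P \<subseteq> Pow (J - {a, \<^bold>1})" using Ea E_no_one[OF triv(1)] by blast
      have fin: "finite (Pow (J - {a, \<^bold>1}))" using finite_J by simp
      have "card (J - {a, \<^bold>1}) = card J - 2"
        using card_Diff_subset[of "{a, \<^bold>1}" J] aJ J1 a1 by simp
      then have cY: "card (Pow (J - {a, \<^bold>1})) = 2 ^ (card A - 4)"
        using finite_J cJ by (simp add: card_Pow)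
      then show ?thesis
        using card_P_le[OF sub fin] card_P_eq[OF sub fin] diamond_from_all_subsets[OF a r False] by simp
    qed
  qed
  then show "card P \<le> 2 ^ (card A - 4)"
    and "card P = 2 ^ (card A - 4) \<Longrightarrow> single_inner_diamond" by auto
qed

lemma trivial_bound:
  assumes triv: "wc_trivial" "dwc_trivial" and R: "R \<noteq> {}"
  shows "card P \<le> 2 ^ (card A - 4)"
    and "card P = 2 ^ (card A - 4) \<Longrightarrow> two_chain_horizontal_sum \<or> single_inner_diamond"
proof -
  obtain a where a: "a \<in> atoms" using atom_below[OF one_mem nonchain_bounds[OF R, symmetric]] by blast
  have "card P \<le> 2 ^ (card A - 4) \<and>
    (card P = 2 ^ (card A - 4) \<longrightarrow> two_chain_horizontal_sum \<or> single_inner_diamond)"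
  proof (cases "atoms = {a}")
    case True
    then show ?thesis using unique_atom_bound[OF triv R] by blast
  next
    case False
    then obtain b where "b \<in> atoms" "b \<noteq> a" using a by blast
    then show ?thesis using several_atoms_bound[OF triv R a, of b] by simp
  qed
  then show "card P \<le> 2 ^ (card A - 4)"
    and "card P = 2 ^ (card A - 4) \<Longrightarrow> two_chain_horizontal_sum \<or> single_inner_diamond" by auto
qed

section \<open>Realising all subsets\<close>

text \<open>A relation with the classes \<open>{0}\<close> and \<open>{1}\<close> respects the trivial operations.\<close>

lemma dissolve_P:
  assumes triv: "wc_trivial" "dwc_trivial" and c: "dissolve X \<in> congs" and ne: "\<^bold>0 \<noteq> \<^bold>1"
    and zero: "\<And>x. (\<^bold>0, x) \<in> dissolve X \<Longrightarrow> x = \<^bold>0"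
    and one: "\<And>x. (x, \<^bold>1) \<in> dissolve X \<Longrightarrow> x = \<^bold>1"
  shows "dissolve X \<in> P"
proof -
  note sy = cong_sym[OF c]
  have "(wc x, wc y) \<in> dissolve X \<and> (dwc x, dwc y) \<in> dissolve X" if h: "(x, y) \<in> dissolve X" for x y
  proof
    have m: "x \<in> A" "y \<in> A" using cong_mem[OF c h] by auto
    have "y = \<^bold>1" if "x = \<^bold>1" using one[of y] sy[OF h] that by simp
    moreover have "x = \<^bold>1" if "y = \<^bold>1" using one[of x] h that by simp
    ultimately have "x = \<^bold>1 \<longleftrightarrow> y = \<^bold>1" by blast
    then have "wc x = wc y" using triv(1) m by (auto simp: wc_trivial_def)
    then show "(wc x, wc y) \<in> dissolve X" using cong_refl[OF c] wc_mem m by simp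
    have "y = \<^bold>0" if "x = \<^bold>0" using zero[of y] h that by simp
    moreover have "x = \<^bold>0" if "y = \<^bold>0" using zero[of x] sy[OF h] that by simp
    ultimately have "x = \<^bold>0 \<longleftrightarrow> y = \<^bold>0" by blast
    then have "dwc x = dwc y" using triv(2) m by (auto simp: dwc_trivial_def)
    then show "(dwc x, dwc y) \<in> dissolve X" using cong_refl[OF c] dwc_mem m by simp
  qed
  moreover have "dissolve X \<noteq> A \<times> A" using zero[of "\<^bold>1"] zero_mem one_mem ne by auto
  ultimately show ?thesis using c by (auto simp: P_def K_def)
qed

lemma E_image_P:
  assumes "F \<subseteq> J" "\<And>r. r \<in> P \<Longrightarrow> E r \<subseteq> F" "\<And>X. X \<subseteq> F \<Longrightarrow> dissolve X \<in> P"
  shows "E ` P = Pow F"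
proof
  show "E ` P \<subseteq> Pow F" using assms(2) by blast
  show "Pow F \<subseteq> E ` P"
  proof
    fix X assume "X \<in> Pow F"
    then have "X = E (dissolve X)" "dissolve X \<in> P" using E_dissolve assms(1,3) by auto
    then show "X \<in> E ` P" by blast
  qed
qed

lemma one_J_wc_trivial:
  assumes "\<^bold>1 \<in> J" shows wc_trivial
  using join_irreducible[OF assms join_wc] wc_mem by (auto simp: wc_trivial_def)

lemma unique_atom_dwc_trivial:
  assumes "atoms = {a}" shows dwc_trivial
  unfolding dwc_trivial_def
proof (intro ballI impI, rule ccontr)
  fix x assume x: "x \<in> A" "x \<noteq> \<^bold>0" "dwc x \<noteq> \<^bold>0"
  then have "a \<preceq> x \<^bold>\<sqinter> dwc x"
    using unique_atom_below[OF assms] dwc_mem meet_greatest by blast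
  then have "a = \<^bold>0" using meet_dwc[OF x(1)] le_zero by simp
  then show False using assms J_nonzero by (auto simp: atoms_def)
qed

text \<open>Join-irreducible elements that are join-prime make \<open>dissolve X\<close> respect joins; keeping \<open>a\<close> and 1 out
  of \<open>X\<close> isolates the bounds.\<close>

lemma distributive_realisation:
  assumes prime: "\<And>j x y. j \<in> J \<Longrightarrow> x \<in> A \<Longrightarrow> y \<in> A \<Longrightarrow> j \<preceq> x \<^bold>\<squnion> y \<Longrightarrow> j \<preceq> x \<or> j \<preceq> y"
    and a: "atoms = {a}" and one: "\<^bold>1 \<in> J" "a \<noteq> \<^bold>1"
  shows "E ` P = Pow (J - {a, \<^bold>1})" "card (J - {a, \<^bold>1}) = card J - 2"
proof -
  have aJ: "a \<in> J" using a atom_J by blast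
  note triv = one_J_wc_trivial[OF one(1)] unique_atom_dwc_trivial[OF a]
  show "E ` P = Pow (J - {a, \<^bold>1})"
  proof (rule E_image_P)
    show "E r \<subseteq> J - {a, \<^bold>1}" if "r \<in> P" for r
      using E_no_atoms[OF triv(2) that] E_no_one[OF triv(1) that] a by blast
    fix X assume X: "X \<subseteq> J - {a, \<^bold>1}"
    have "j \<preceq> y \<^bold>\<squnion> z"
      if h: "j \<in> J - X" "(x, y) \<in> dissolve X" "z \<in> A" "j \<preceq> x \<^bold>\<squnion> z" for j x y z
    proof -
      have m: "x \<in> A" "y \<in> A" "j \<preceq> x \<Longrightarrow> j \<preceq> y" using h(1,2) by (auto simp: dissolve_def)
      then have "j \<preceq> y \<or> j \<preceq> z" using prime[of j x z] h by blast
      then show ?thesis using join_ge1[OF m(2) h(3)] join_ge2[OF m(2) h(3)] trans by blast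
    qed
    then have c: "dissolve X \<in> congs" by (rule dissolve_congs)
    have aX: "a \<in> J - X" "\<^bold>1 \<in> J - X" using X aJ one by auto
    show "dissolve X \<in> P"
    proof (rule dissolve_P[OF triv c])
      show "\<^bold>0 \<noteq> \<^bold>1" using J_nonzero[OF one(1)] by simp
      show "x = \<^bold>0" if "(\<^bold>0, x) \<in> dissolve X" for x
      proof (rule ccontr)
        assume "x \<noteq> \<^bold>0"
        then have "a \<preceq> x" using unique_atom_below[OF a] that by (auto simp: dissolve_def)
        then have "a \<preceq> \<^bold>0" using that aX by (auto simp: dissolve_def)
        then show False using le_zero J_nonzero[OF aJ] by blast
      qed
      show "x = \<^bold>1" if "(x, \<^bold>1) \<in> dissolve X" for x
        using that aX refl[OF one_mem] one_le by (auto simp: dissolve_def)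
    qed
  qed auto
  show "card (J - {a, \<^bold>1}) = card J - 2"
    using card_Diff_subset[of "{a, \<^bold>1}" J] aJ one by simp
qed

text \<open>In a chain every element is join-prime.\<close>

lemma chain_realisation:
  assumes R: "R = {}" and n: "card A \<ge> 3"
  obtains F where "finite F" "card F = card A - 3" "E ` P = Pow F" "wc_trivial" "dwc_trivial"
proof -
  have tot: "x \<preceq> y \<or> y \<preceq> x" if "x \<in> A" "y \<in> A" for x y using R_empty_iff R that by blast
  have ne: "\<^bold>0 \<noteq> \<^bold>1"
  proof
    assume eq: "\<^bold>0 = \<^bold>1"
    then have "A \<subseteq> {\<^bold>1}" using le_one le_zero by auto
    then show False using n card_mono[of "{\<^bold>1}" A] by simp
  qed
  obtain a where a: "a \<in> atoms" using atom_below[OF one_mem ne[symmetric]] by blast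
  have at: "atoms = {a}"
    using a tot atoms_incomparable J_mem atom_J unfolding incomparable_def by blast
  have J: "J = A - {\<^bold>0}" using R J_subset J_nonzero by (auto simp: R_def)
  have a1: "a \<noteq> \<^bold>1"
  proof
    assume "a = \<^bold>1"
    then have "A \<subseteq> {\<^bold>0, \<^bold>1}" using below_atom[OF a] le_one by auto
    then have "card A \<le> card {\<^bold>0, \<^bold>1}" by (intro card_mono) auto
    also have "\<dots> \<le> 2" by (simp add: card_insert_if)
    finally show False using n by simp
  qed
  have prime: "j \<preceq> x \<or> j \<preceq> y" if "x \<in> A" "y \<in> A" "j \<preceq> x \<^bold>\<squnion> y" for j x y
    using tot[OF that(1,2)] join_absorb that(3) by metis
  have one: "\<^bold>1 \<in> J" using J ne one_mem by blast
  have "card J = card A - 1" using J zero_mem by simp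
  moreover have real: "E ` P = Pow (J - {a, \<^bold>1})" "card (J - {a, \<^bold>1}) = card J - 2"
    by (rule distributive_realisation[OF prime at one a1]; assumption)+
  ultimately have "card (J - {a, \<^bold>1}) = card A - 3" by simp
  moreover have "finite (J - {a, \<^bold>1})" using finite_J by blast
  ultimately show thesis
    using that[OF _ _ real(1) one_J_wc_trivial[OF one] unique_atom_dwc_trivial[OF at]] by blast
qed

text \<open>The only join-reducible element is the top of the square, and an element below it other than itself
  is below one of the two incomparable elements; so all join-irreducible elements are join-prime.
  Both operations are trivial because there is only one atom and only one coatom.\<close>

lemma diamond_realisation:
  assumes single_inner_diamond
  obtains F where "finite F" "card F = card A - 4" "E ` P = Pow F" "wc_trivial" "dwc_trivial" "R \<noteq> {}"
proof -
  obtain p q where pq: "p \<parallel> q" and u: "\<And>x y. x \<parallel> y \<Longrightarrow> {x, y} = {p, q}"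
    and nz: "p \<^bold>\<sqinter> q \<noteq> \<^bold>0" and n1: "p \<^bold>\<squnion> q \<noteq> \<^bold>1"
    using assms unfolding single_inner_diamond_def by blast
  have Apq: "p \<in> A" "q \<in> A" using pq incomparable_mem by blast+
  have R: "R = {p \<^bold>\<squnion> q}"
  proof
    show "R \<subseteq> {p \<^bold>\<squnion> q}"
    proof
      fix r assume "r \<in> R"
      then obtain x y where xy: "x \<parallel> y" "x \<^bold>\<squnion> y = r" using R_join by blast
      then have "r = p \<^bold>\<squnion> q" using u[OF xy(1)] join_commute[OF Apq] by (auto simp: doubleton_eq_iff)
      then show "r \<in> {p \<^bold>\<squnion> q}" by simp
    qed
  qed (use incomparable_join_R[OF pq] in simp)
  then have Rne: "R \<noteq> {}" by blast
  have "\<^bold>1 \<notin> R" using R n1 by simp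
  then have one: "\<^bold>1 \<in> J" using nonchain_bounds[OF Rne] one_mem unfolding R_def by simp
  obtain a where a: "a \<in> atoms" using atom_below[OF Apq(1) incomparable_not_bound(1)[OF pq]] by blast
  have at: "atoms = {a}"
  proof (rule ccontr)
    assume "atoms \<noteq> {a}"
    then obtain b where b: "b \<in> atoms" "a \<noteq> b" using a by blast
    then have "{a, b} = {p, q}" using u atoms_incomparable a by blast
    then have pq': "p \<in> atoms" "q \<in> atoms" using a b by auto
    have "p \<^bold>\<sqinter> q = p" using below_atom[OF pq'(1) meet_le1[OF Apq]] nz by blast
    then show False using meet_lt_incomparable(1)[OF pq] by (simp add: lt_def)
  qed
  have a1: "a \<noteq> \<^bold>1" using one_notin_atoms[OF Rne] a by blast
  have prime: "j \<preceq> x \<or> j \<preceq> y" if j: "j \<in> J" and x: "x \<in> A" "y \<in> A" and le: "j \<preceq> x \<^bold>\<squnion> y" for j x y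
  proof (rule ccontr)
    assume n: "\<not> (j \<preceq> x \<or> j \<preceq> y)"
    then have xy: "x \<parallel> y" using le x join_absorb by (metis incomparable_def)
    have eq: "{x, y} = {p, q}" "x \<^bold>\<squnion> y = p \<^bold>\<squnion> q"
      using u[OF xy] incomparable_join_R[OF xy] R by auto
    have jA: "j \<in> A" using J_mem[OF j] .
    have "j \<noteq> x \<^bold>\<squnion> y" using j eq R by (auto simp: R_def)
    moreover have "x \<preceq> j" "y \<preceq> j"
    proof -
      have "\<not> x \<parallel> j" "\<not> y \<parallel> j"
        using u[of x j] u[of y j] eq n refl[OF jA] x
        by (metis doubleton_eq_iff incomparable_def insertCI insertE singletonD)+
      then show "x \<preceq> j" "y \<preceq> j" using n x jA by (auto simp: incomparable_def)
    qed
    ultimately show False using join_least le antisym by blast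
  qed
  have "card J = card A - 2" using card_J_R R by simp
  moreover have real: "E ` P = Pow (J - {a, \<^bold>1})" "card (J - {a, \<^bold>1}) = card J - 2"
    by (rule distributive_realisation[OF prime at one a1]; assumption)+
  ultimately have "card (J - {a, \<^bold>1}) = card A - 4" by simp
  moreover have "finite (J - {a, \<^bold>1})" using finite_J by blast
  ultimately show thesis
    using that[OF _ _ real(1) one_J_wc_trivial[OF one] unique_atom_dwc_trivial[OF at] Rne] by blast
qed

text \<open>The atoms are not join-prime here, but joins are respected for another reason: if both atoms stay
  outside \<open>X\<close>, then identified nonzero elements lie above the same atoms.\<close>

lemma horizontal_realisation:
  assumes h: two_chain_horizontal_sum and triv: "wc_trivial" "dwc_trivial"
  obtains F where "finite F" "card F = card A - 4" "E ` P = Pow F" "R \<noteq> {}"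
proof -
  obtain x0 y0 where xy0: "x0 \<parallel> y0" using h unfolding two_chain_horizontal_sum_def by blast
  have j1: "x \<^bold>\<squnion> y = \<^bold>1" and m0: "x \<^bold>\<sqinter> y = \<^bold>0" if "x \<parallel> y" for x y
    using h that unfolding two_chain_horizontal_sum_def by blast+
  have R: "R = {\<^bold>1}"
  proof
    show "R \<subseteq> {\<^bold>1}"
    proof
      fix r assume "r \<in> R"
      then obtain x y where "x \<parallel> y" "x \<^bold>\<squnion> y = r" using R_join by blast
      then show "r \<in> {\<^bold>1}" using j1 by simp
    qed
  qed (use incomparable_join_R[OF xy0] j1[OF xy0] in simp)
  then have Rne: "R \<noteq> {}" by blast
  obtain p q where pq: "p \<noteq> q" and at: "atoms = {p, q}" using horizontal_sum_atoms[OF h] .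
  then have p: "p \<in> atoms" and q: "q \<in> atoms" by auto
  define F where "F = J - atoms"
  have fa: "finite atoms" "atoms \<subseteq> J" using finite_J by (auto simp: atoms_def)
  have "card J = card A - 2" using card_J_R R by simp
  then have cF: "card F = card A - 4" using card_Diff_subset[OF fa] at pq F_def by simp
  have "E ` P = Pow F"
  proof (rule E_image_P)
    show "E r \<subseteq> F" if "r \<in> P" for r using E_no_atoms[OF triv(2) that] F_def by simp
    fix X assume X: "X \<subseteq> F"
    have noat: "t \<in> J - X" if "t \<in> atoms" for t using that X F_def fa by auto
    have sep: "t \<preceq> u \<longleftrightarrow> t \<preceq> v" if "t \<in> atoms" "(u, v) \<in> dissolve X" for t u v
      using that noat by (auto simp: dissolve_def)
    have sy: "(v, u) \<in> dissolve X" if "(u, v) \<in> dissolve X" for u v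
      using that by (auto simp: dissolve_def)
    have zero: "u = \<^bold>0" if d: "(\<^bold>0, u) \<in> dissolve X" for u
    proof (rule ccontr)
      assume "u \<noteq> \<^bold>0"
      moreover have "u \<in> A" using d by (simp add: dissolve_def)
      ultimately obtain t where t: "t \<in> atoms" "t \<preceq> u" using atom_below[of u] by blast
      then have "t \<preceq> \<^bold>0" using sep[OF t(1) d] by simp
      then show False using le_zero J_nonzero atom_J t by blast
    qed
    have one: "u = \<^bold>1" if d: "(u, \<^bold>1) \<in> dissolve X" for u
    proof -
      have "p \<preceq> u" "q \<preceq> u" using sep[OF _ d] p q le_one J_mem atom_J by blast+
      then have "p \<^bold>\<squnion> q \<preceq> u" using join_least by blast
      then show ?thesis using j1 atoms_incomparable[OF p q pq] one_le by metis
    qed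
    \<comment> \<open>Comparability of \<open>v\<close> and \<open>z\<close> would put an atom below \<open>u\<close> and \<open>z\<close>, whose meet is 0. So the join
       with \<open>z\<close> is 1 for both of the identified elements.\<close>
    have inc: "v \<parallel> z" if d: "(u, v) \<in> dissolve X" and uz: "u \<parallel> z" for u v z
    proof -
      have m: "v \<in> A" "z \<in> A" "u \<in> A" using d uz by (auto simp: dissolve_def incomparable_def)
      have v0: "v \<noteq> \<^bold>0" using zero[of u] sy[OF d] incomparable_not_bound(1)[OF uz] by blast
      have no: "\<not> (t \<preceq> u \<and> t \<preceq> z)" if "t \<in> atoms" for t
        using meet_greatest[of t u z] m0[OF uz] le_zero J_nonzero[OF atom_J[OF that]] by auto
      have "\<not> v \<preceq> z"
      proof
        assume vz: "v \<preceq> z"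
        obtain t where t: "t \<in> atoms" "t \<preceq> v" using atom_below[OF m(1) v0] .
        then show False using no[OF t(1)] sep[OF t(1) d] trans vz by blast
      qed
      moreover have "\<not> z \<preceq> v"
      proof
        assume zv: "z \<preceq> v"
        obtain t where t: "t \<in> atoms" "t \<preceq> z" using atom_below[OF m(2)] incomparable_not_bound(3)[OF uz] by blast
        then show False using no[OF t(1)] sep[OF t(1) d] trans zv by blast
      qed
      ultimately show ?thesis using m by (simp add: incomparable_def)
    qed
    have "j \<preceq> v \<^bold>\<squnion> z"
      if hh: "j \<in> J - X" "(u, v) \<in> dissolve X" "z \<in> A" "j \<preceq> u \<^bold>\<squnion> z" for j u v z
    proof -
      have m: "u \<in> A" "v \<in> A" "j \<preceq> u \<Longrightarrow> j \<preceq> v" using hh(1,2) by (auto simp: dissolve_def)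
      show ?thesis
      proof (cases "u \<parallel> z")
        case True
        then show ?thesis using j1 inc[OF hh(2) True] hh(4) by simp
      next
        case False
        then have "j \<preceq> u \<or> j \<preceq> z" using hh(3,4) m(1) join_absorb by (metis incomparable_def)
        then show ?thesis using m(3) join_ge1[OF m(2) hh(3)] join_ge2[OF m(2) hh(3)] trans by blast
      qed
    qed
    then have "dissolve X \<in> congs" by (rule dissolve_congs)
    then show "dissolve X \<in> P" by (rule dissolve_P[OF triv _ nonchain_bounds[OF Rne] zero one])
  qed (simp add: F_def)
  moreover have "finite F" using F_def finite_J by blast
  ultimately show thesis using that cF Rne by blast
qed

section \<open>Few elements\<close>

lemma two_elements:
  assumes "card A = 2" shows "card P = 1"
proof -
  have ne: "\<^bold>0 \<noteq> \<^bold>1"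
  proof
    assume eq: "\<^bold>0 = \<^bold>1"
    then have "A \<subseteq> {\<^bold>1}" using le_one le_zero by auto
    then show False using assms card_mono[of "{\<^bold>1}" A] by simp
  qed
  have "A = {\<^bold>0, \<^bold>1}"
    using card_subset_eq[OF finite_A, of "{\<^bold>0, \<^bold>1}"] zero_mem one_mem ne assms by simp
  then have "J \<subseteq> {\<^bold>1}" using J_subset J_nonzero by blast
  have "E r = {}" if r: "r \<in> P" for r
  proof (rule ccontr)
    assume "E r \<noteq> {}"
    then have e: "\<^bold>1 \<in> J" "(lower_cover \<^bold>1, \<^bold>1) \<in> r" using \<open>J \<subseteq> {\<^bold>1}\<close> by (auto simp: E_def)
    then have "lower_cover \<^bold>1 = \<^bold>0"
      using lower_cover(1)[OF e(1)] lower_cover_mem[OF e(1)] \<open>A = {\<^bold>0, \<^bold>1}\<close> by (auto simp: lt_def)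
    then show False using P_bounds[OF r] e by simp
  qed
  then have "E ` P = {{}}" using Id_P[OF ne] by blast
  then show ?thesis using card_P_image by simp
qed

lemma four_elements:
  assumes n: "card A = 4" and R: "R \<noteq> {}"
  obtains a b where "A = {\<^bold>0, a, b, \<^bold>1}" "a \<parallel> b" "a \<^bold>\<sqinter> b = \<^bold>0" "a \<^bold>\<squnion> b = \<^bold>1" "J = {a, b}" "atoms = {a, b}"
proof -
  obtain a b where ab: "a \<parallel> b" using R R_join by blast
  have m: "a \<in> A" "b \<in> A" "a \<noteq> b" using ab refl by (auto simp: incomparable_def)
  note nb = incomparable_not_bound[OF ab] and ne = nonchain_bounds[OF R]
  have "card {\<^bold>0, a, b, \<^bold>1} = 4" using m nb ne by auto
  then have A: "A = {\<^bold>0, a, b, \<^bold>1}"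
    using card_subset_eq[OF finite_A, of "{\<^bold>0, a, b, \<^bold>1}"] m n zero_mem one_mem by auto
  have lts: "x = \<^bold>0" if "x \<prec> a \<or> x \<prec> b" for x
    using that A ab lt_mem1 one_le nb unfolding incomparable_def lt_def by blast
  have mt: "a \<^bold>\<sqinter> b = \<^bold>0" using lts meet_lt_incomparable[OF ab] by blast
  have jn: "a \<^bold>\<squnion> b = \<^bold>1"
  proof -
    have "a \<^bold>\<squnion> b \<in> {\<^bold>0, a, b, \<^bold>1}" using join_mem[OF m(1,2)] A by simp
    moreover have "a \<^bold>\<squnion> b \<noteq> a" "a \<^bold>\<squnion> b \<noteq> b" using incomparable_lt_join[OF ab] by (auto simp: lt_def)
    moreover have "a \<^bold>\<squnion> b \<noteq> \<^bold>0" using join_ge1[OF m(1,2)] le_zero[of a] nb(1) by metis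
    ultimately show ?thesis by blast
  qed
  have "\<^bold>0 \<prec> a" "\<^bold>0 \<prec> b" using zero_le m nb by (auto simp: lt_def)
  then have ab_J: "a \<in> J" "b \<in> J"
    unfolding J_def using lts refl[OF zero_mem] by blast+
  moreover have "\<^bold>1 \<notin> J" using incomparable_join_R[OF ab] jn by (simp add: R_def)
  ultimately have J: "J = {a, b}" using A J_subset J_nonzero by blast
  have "lower_cover a = \<^bold>0" "lower_cover b = \<^bold>0" using lts lower_cover(1) ab_J by blast+
  then have "atoms = {a, b}" using J by (auto simp: atoms_def)
  then show thesis using that A ab mt jn J by blast
qed

text \<open>On the square each operation is either trivial or the Boolean complementation. A trivial one isolates
  0 or 1, and collapsing an atom identifies the other atom with 1.\<close>

lemma four_not_boolean:
  assumes A: "A = {\<^bold>0, a, b, \<^bold>1}" and ab: "a \<parallel> b" and jn: "a \<^bold>\<squnion> b = \<^bold>1" and at: "J = {a, b}" "atoms = {a, b}"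
    and nb: "wc a \<noteq> b \<or> dwc a \<noteq> b"
  shows "card P = 1"
proof -
  have m: "a \<in> A" "b \<in> A" "a \<noteq> b" using ab refl by (auto simp: incomparable_def)
  note b01 = incomparable_not_bound[OF ab]
  have ne: "\<^bold>0 \<noteq> \<^bold>1" using b01 le_zero le_one m by metis
  have "E r = {}" if r: "r \<in> P" for r
  proof -
    note c = P_congs[OF r]
    have up: "(b, \<^bold>1) \<in> r" if "a \<in> E r"
      using cong_join[OF c, of "\<^bold>0" a b] that E_atom[OF c, of a] at jn m join_absorb(1)[OF zero_le] by simp
    have up': "(a, \<^bold>1) \<in> r" if "b \<in> E r"
      using cong_join[OF c, of "\<^bold>0" b a] that E_atom[OF c, of b] at jn m join_absorb(1)[OF zero_le]
        join_commute[OF m(1,2)] by simp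
    show ?thesis
    proof (cases "dwc_trivial")
      case True
      then show ?thesis using E_no_atoms[OF True r] at by simp
    next
      case False
      have da: "dwc a = b"
      proof -
        have q: "a \<^bold>\<sqinter> dwc a = \<^bold>0" "b \<^bold>\<sqinter> dwc b = \<^bold>0" using meet_dwc m by auto
        have "dwc a \<noteq> a" "dwc a \<noteq> \<^bold>1" "dwc b \<noteq> b" "dwc b \<noteq> \<^bold>1"
          using q b01 meet_absorb(1)[OF refl] meet_absorb(1)[OF le_one] m(1,2) by metis+
        then have in2: "dwc a \<in> {\<^bold>0, b}" "dwc b \<in> {\<^bold>0, a}"
          using dwc_mem[OF m(1)] dwc_mem[OF m(2)] unfolding A by blast+
        have "dwc a \<noteq> \<^bold>0"
        proof
          assume z: "dwc a = \<^bold>0"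
          then have "dwc b \<noteq> a" using dwc_dwc[OF m(2)] le_zero[of b] b01(3) by metis
          then have "dwc b = \<^bold>0" using in2 by blast
          then have dwc_trivial
            unfolding dwc_trivial_def unfolding A using z dwc_one by blast
          then show False using False by blast
        qed
        then show ?thesis using in2 by blast
      qed
      have wt: "wc_trivial"
      proof -
        have wa: "wc a \<noteq> b" using nb da by simp
        have q: "a \<^bold>\<squnion> wc a = \<^bold>1" "b \<^bold>\<squnion> wc b = \<^bold>1" using join_wc m by auto
        have "wc a \<noteq> a" "wc a \<noteq> \<^bold>0" "wc b \<noteq> b" "wc b \<noteq> \<^bold>0"
          using q b01 join_absorb(1)[OF refl] join_absorb(2)[OF zero_le] m(1,2) by metis+
        then have in2: "wc a = \<^bold>1" "wc b \<in> {\<^bold>1, a}"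
          using wc_mem[OF m(1)] wc_mem[OF m(2)] wa unfolding A by blast+
        have "wc b \<noteq> a"
          using wc_wc[OF m(2)] in2(1) one_le[of b] b01(4) by metis
        then have "wc b = \<^bold>1" using in2(2) by blast
        then show ?thesis unfolding wc_trivial_def unfolding A using in2(1) wc_zero by blast
      qed
      have "a \<notin> E r" using one_isolated[OF wt r up] b01(4) by blast
      moreover have "b \<notin> E r" using one_isolated[OF wt r up'] b01(2) by blast
      ultimately show ?thesis using E_subset[OF c] unfolding at by blast
    qed
  qed
  then have "E ` P = {{}}" using Id_P[OF ne] by blast
  then show ?thesis using card_P_image by simp
qed

text \<open>An element is above an atom exactly if its complement is not; so \<open>dissolve X\<close> respects complements.\<close>

lemma four_boolean:
  assumes A: "A = {\<^bold>0, a, b, \<^bold>1}" and ab: "a \<parallel> b" and jn: "a \<^bold>\<squnion> b = \<^bold>1" and at: "J = {a, b}" "atoms = {a, b}"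
    and bl: "wc a = b" "wc b = a" "dwc a = b" "dwc b = a"
  shows "E ` K = Pow {a, b}"
proof
  have m: "a \<in> A" "b \<in> A" "a \<noteq> b" using ab refl by (auto simp: incomparable_def)
  note b01 = incomparable_not_bound[OF ab]
  have le: "j \<preceq> x \<longleftrightarrow> x = j \<or> x = \<^bold>1" if j: "j \<in> J" and x: "x \<in> A" for j x
  proof
    have jA: "j \<in> A" using J_mem[OF j] .
    show "j \<preceq> x" if "x = j \<or> x = \<^bold>1" using that refl[OF jA] le_one[OF jA] by blast
    assume jx: "j \<preceq> x"
    have "x \<noteq> \<^bold>0" using jx le_zero J_nonzero[OF j] by blast
    moreover have "\<not> (j = a \<and> x = b)" "\<not> (j = b \<and> x = a)"
      using jx ab by (auto simp: incomparable_def)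
    ultimately show "x = j \<or> x = \<^bold>1" using j x unfolding at A by blast
  qed
  have nz: "\<^bold>0 \<noteq> \<^bold>1" using J_nonzero le_one le_zero m b01 by metis
  have neg1: "wc x = j \<or> wc x = \<^bold>1 \<longleftrightarrow> \<not> (x = j \<or> x = \<^bold>1)" "dwc x = j \<or> dwc x = \<^bold>1 \<longleftrightarrow> \<not> (x = j \<or> x = \<^bold>1)"
    if "j \<in> {a, b}" "x \<in> {\<^bold>0, a, b, \<^bold>1}" for j x
    using that b01 m(3) nz wc_zero wc_one dwc_zero dwc_one bl by auto
  have neg: "j \<preceq> wc x \<longleftrightarrow> \<not> j \<preceq> x" "j \<preceq> dwc x \<longleftrightarrow> \<not> j \<preceq> x" if "j \<in> J" "x \<in> A" for j x
    using le[OF that] le[OF that(1) wc_mem[OF that(2)]] le[OF that(1) dwc_mem[OF that(2)]]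
      neg1[of j x] that unfolding at A by simp_all
  show "E ` K \<subseteq> Pow {a, b}" using E_subset[OF K_congs] at by blast
  show "Pow {a, b} \<subseteq> E ` K"
  proof
    fix X assume "X \<in> Pow {a, b}"
    then have X: "X \<subseteq> J" using at by simp
    have "j \<preceq> y \<^bold>\<squnion> z"
      if h: "j \<in> J - X" "(x, y) \<in> dissolve X" "z \<in> A" "j \<preceq> x \<^bold>\<squnion> z" for j x y z
    proof -
      have mm: "x \<in> A" "y \<in> A" "j \<preceq> x \<Longrightarrow> j \<preceq> y" using h(1,2) by (auto simp: dissolve_def)
      have "j \<preceq> x \<or> j \<preceq> z"
      proof (cases "x \<parallel> z")
        case True
        have "x \<in> {\<^bold>0, a, b, \<^bold>1}" "z \<in> {\<^bold>0, a, b, \<^bold>1}" using mm(1) h(3) unfolding A .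
        then have "x \<in> {a, b}" "z \<in> {a, b}" using incomparable_not_bound[OF True] by blast+
        moreover have "x \<noteq> z" using True refl[OF mm(1)] by (auto simp: incomparable_def)
        ultimately have "j = x \<or> j = z" using h(1) unfolding at by blast
        then show ?thesis using refl[OF mm(1)] refl[OF h(3)] by blast
      next
        case False
        then show ?thesis using h(3,4) mm(1) join_absorb by (metis incomparable_def)
      qed
      then show ?thesis using mm(3) join_ge1[OF mm(2) h(3)] join_ge2[OF mm(2) h(3)] trans by blast
    qed
    then have "dissolve X \<in> congs" by (rule dissolve_congs)
    moreover have "(wc x, wc y) \<in> dissolve X \<and> (dwc x, dwc y) \<in> dissolve X" if "(x, y) \<in> dissolve X" for x y
      using that neg wc_mem dwc_mem by (auto simp: dissolve_def)
    ultimately have "dissolve X \<in> K" by (auto simp: K_def)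
    then show "X \<in> E ` K" using E_dissolve[OF X] by blast
  qed
qed

text \<open>The isolated value \<open>2^(n-4) + 1\<close> requires trivial operations, since otherwise already \<open>2^(n-4)\<close> counts
  the full congruence.\<close>

lemma nonchain_bound:
  assumes R: "R \<noteq> {}" and n: "card A \<ge> 5"
  shows "card K \<le> 2 ^ (card A - 4) + 1"
    and "card K = 2 ^ (card A - 4) + 1 \<longleftrightarrow>
      two_chain_horizontal_sum \<and> wc_trivial \<and> dwc_trivial \<or> single_inner_diamond"
proof -
  have le: "card K \<le> 2 ^ (card A - 4)" if "\<not> (wc_trivial \<and> dwc_trivial)"
    using that nontrivial_wc_bound[OF _ _ _ n] nontrivial_dwc_bound[OF _ _ _ n]
    unfolding wc_trivial_def dwc_trivial_def by blast
  show "card K \<le> 2 ^ (card A - 4) + 1"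
    using le trivial_bound(1)[OF _ _ R] card_K by fastforce
  show "card K = 2 ^ (card A - 4) + 1 \<longleftrightarrow>
      two_chain_horizontal_sum \<and> wc_trivial \<and> dwc_trivial \<or> single_inner_diamond" (is "?L \<longleftrightarrow> ?R")
  proof
    assume ?L
    then have "wc_trivial" "dwc_trivial" using le by fastforce+
    then show ?R using trivial_bound(2)[OF _ _ R] \<open>?L\<close> card_K by auto
  next
    assume ?R
    then obtain F where "finite F" "card F = card A - 4" "E ` P = Pow F"
    proof
      assume h: "two_chain_horizontal_sum \<and> wc_trivial \<and> dwc_trivial"
      show thesis by (rule horizontal_realisation) (use h that in auto)
    next
      assume h: "single_inner_diamond"
      show thesis by (rule diamond_realisation[OF h]) (rule that)
    qed
    then show ?L using card_K card_P_image by (simp add: card_Pow)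
  qed
qed

end

section \<open>Order isomorphisms and lattice isomorphisms\<close>

text \<open>The source is a set with a relation instead of a lattice, because the pieces of a lattice are
  identified with chains and squares before they are put together.\<close>

definition order_iso_to :: "'a set \<Rightarrow> ('a \<Rightarrow> 'a \<Rightarrow> bool) \<Rightarrow> 'b gorder \<Rightarrow> bool" where
  "order_iso_to S leq M \<longleftrightarrow> (\<exists>h. bij_betw h S (carrier M) \<and>
     (\<forall>x\<in>S. \<forall>y\<in>S. leq x y \<longleftrightarrow> h x \<sqsubseteq>\<^bsub>M\<^esub> h y))"

lemma order_iso_to_transfer:
  assumes "order_iso_to T leq' M" "bij_betw f S T" "\<And>x y. x \<in> S \<Longrightarrow> y \<in> S \<Longrightarrow> leq x y \<longleftrightarrow> leq' (f x) (f y)"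
  shows "order_iso_to S leq M"
proof -
  obtain h where h: "bij_betw h T (carrier M)" "\<forall>x\<in>T. \<forall>y\<in>T. leq' x y \<longleftrightarrow> h x \<sqsubseteq>\<^bsub>M\<^esub> h y"
    using assms(1) by (auto simp: order_iso_to_def)
  have "bij_betw (h \<circ> f) S (carrier M)" using bij_betw_trans[OF assms(2) h(1)] .
  moreover have "leq x y \<longleftrightarrow> (h \<circ> f) x \<sqsubseteq>\<^bsub>M\<^esub> (h \<circ> f) y" if "x \<in> S" "y \<in> S" for x y
    using assms(3)[OF that] h(2) bij_betwE[OF assms(2)] that by simp
  ultimately show ?thesis unfolding order_iso_to_def by blast
qed

lemma is_lub_pair_iff:
  fixes M :: "'b gorder"
  assumes "a \<in> carrier M" "b \<in> carrier M"
  shows "least M s (Upper M {a, b}) \<longleftrightarrow> s \<in> carrier M \<and> a \<sqsubseteq>\<^bsub>M\<^esub> s \<and> b \<sqsubseteq>\<^bsub>M\<^esub> s \<and>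
    (\<forall>z\<in>carrier M. a \<sqsubseteq>\<^bsub>M\<^esub> z \<longrightarrow> b \<sqsubseteq>\<^bsub>M\<^esub> z \<longrightarrow> s \<sqsubseteq>\<^bsub>M\<^esub> z)"
  using assms by (auto simp: least_def Upper_def)

lemma is_glb_pair_iff:
  fixes M :: "'b gorder"
  assumes "a \<in> carrier M" "b \<in> carrier M"
  shows "is_glb M s {a, b} \<longleftrightarrow> s \<in> carrier M \<and> s \<sqsubseteq>\<^bsub>M\<^esub> a \<and> s \<sqsubseteq>\<^bsub>M\<^esub> b \<and>
    (\<forall>z\<in>carrier M. z \<sqsubseteq>\<^bsub>M\<^esub> a \<longrightarrow> z \<sqsubseteq>\<^bsub>M\<^esub> b \<longrightarrow> z \<sqsubseteq>\<^bsub>M\<^esub> s)"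
  using is_lub_pair_iff[of a "inv_gorder M" b s] assms by simp

lemma latticeI:
  fixes M :: "'b gorder"
  assumes eq: "eq M = (=)"
    and refl: "\<And>x. x \<in> carrier M \<Longrightarrow> x \<sqsubseteq>\<^bsub>M\<^esub> x"
    and antisym: "\<And>x y. x \<in> carrier M \<Longrightarrow> y \<in> carrier M \<Longrightarrow> x \<sqsubseteq>\<^bsub>M\<^esub> y \<Longrightarrow> y \<sqsubseteq>\<^bsub>M\<^esub> x \<Longrightarrow> x = y"
    and trans: "\<And>x y z. x \<in> carrier M \<Longrightarrow> y \<in> carrier M \<Longrightarrow> z \<in> carrier M \<Longrightarrow>
      x \<sqsubseteq>\<^bsub>M\<^esub> y \<Longrightarrow> y \<sqsubseteq>\<^bsub>M\<^esub> z \<Longrightarrow> x \<sqsubseteq>\<^bsub>M\<^esub> z"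
    and lub: "\<And>x y. x \<in> carrier M \<Longrightarrow> y \<in> carrier M \<Longrightarrow> \<exists>s. is_lub M s {x, y}"
    and glb: "\<And>x y. x \<in> carrier M \<Longrightarrow> y \<in> carrier M \<Longrightarrow> \<exists>s. is_glb M s {x, y}"
  shows "lattice M"
proof unfold_locales
  fix x y z w
  show "x \<in> carrier M \<Longrightarrow> x .=\<^bsub>M\<^esub> x" "x .=\<^bsub>M\<^esub> y \<Longrightarrow> x \<in> carrier M \<Longrightarrow> y \<in> carrier M \<Longrightarrow> y .=\<^bsub>M\<^esub> x"
    "x .=\<^bsub>M\<^esub> y \<Longrightarrow> y .=\<^bsub>M\<^esub> z \<Longrightarrow> x \<in> carrier M \<Longrightarrow> y \<in> carrier M \<Longrightarrow> z \<in> carrier M \<Longrightarrow> x .=\<^bsub>M\<^esub> z"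
    "(.=\<^bsub>M\<^esub>) = (=)"
    "x .=\<^bsub>M\<^esub> y \<Longrightarrow> z .=\<^bsub>M\<^esub> w \<Longrightarrow> x \<in> carrier M \<Longrightarrow> y \<in> carrier M \<Longrightarrow> z \<in> carrier M \<Longrightarrow>
      w \<in> carrier M \<Longrightarrow> x \<sqsubseteq>\<^bsub>M\<^esub> z \<longleftrightarrow> y \<sqsubseteq>\<^bsub>M\<^esub> w"
    "x \<sqsubseteq>\<^bsub>M\<^esub> y \<Longrightarrow> y \<sqsubseteq>\<^bsub>M\<^esub> x \<Longrightarrow> x \<in> carrier M \<Longrightarrow> y \<in> carrier M \<Longrightarrow> x .=\<^bsub>M\<^esub> y"
    using antisym by (simp_all add: eq)
  show "x \<in> carrier M \<Longrightarrow> x \<sqsubseteq>\<^bsub>M\<^esub> x" by (rule refl)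
  show "x \<sqsubseteq>\<^bsub>M\<^esub> y \<Longrightarrow> y \<sqsubseteq>\<^bsub>M\<^esub> z \<Longrightarrow> x \<in> carrier M \<Longrightarrow> y \<in> carrier M \<Longrightarrow> z \<in> carrier M \<Longrightarrow>
      x \<sqsubseteq>\<^bsub>M\<^esub> z" by (rule trans)
  show "x \<in> carrier M \<Longrightarrow> y \<in> carrier M \<Longrightarrow> \<exists>s. is_lub M s {x, y}" by (rule lub)
  show "x \<in> carrier M \<Longrightarrow> y \<in> carrier M \<Longrightarrow> \<exists>s. is_glb M s {x, y}" by (rule glb)
qed

lemma join_eqI:
  fixes M :: "'b gorder"
  assumes M: "lattice M" and m: "a \<in> carrier M" "b \<in> carrier M" and s: "is_lub M s {a, b}"
  shows "a \<squnion>\<^bsub>M\<^esub> b = s"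
proof -
  interpret lattice M by fact
  show ?thesis
    unfolding join_def sup_def by (rule some_equality) (use s least_unique in auto)
qed

lemma meet_eqI:
  fixes M :: "'b gorder"
  assumes "lattice M" "a \<in> carrier M" "b \<in> carrier M" "is_glb M s {a, b}"
  shows "a \<sqinter>\<^bsub>M\<^esub> b = s"
  using join_eqI[OF lattice.dual_lattice[OF assms(1)], of a b s] assms(2-) by simp

lemma order_iso_lub:
  fixes L :: "'a gorder" (structure) and M :: "'b gorder"
  assumes L: "lattice L" and h: "h ` carrier L = carrier M"
    and le: "\<forall>x\<in>carrier L. \<forall>y\<in>carrier L. x \<sqsubseteq> y \<longleftrightarrow> h x \<sqsubseteq>\<^bsub>M\<^esub> h y"
    and xy: "x \<in> carrier L" "y \<in> carrier L"
  shows "is_lub M (h (x \<squnion> y)) {h x, h y}"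
proof -
  interpret lattice L by fact
  have m: "h x \<in> carrier M" "h y \<in> carrier M" "h (x \<squnion> y) \<in> carrier M"
    using xy h join_closed by blast+
  have "h x \<sqsubseteq>\<^bsub>M\<^esub> h (x \<squnion> y)" "h y \<sqsubseteq>\<^bsub>M\<^esub> h (x \<squnion> y)"
    using xy le join_left join_right join_closed by auto
  moreover have "h (x \<squnion> y) \<sqsubseteq>\<^bsub>M\<^esub> w" if w: "w \<in> carrier M" "h x \<sqsubseteq>\<^bsub>M\<^esub> w" "h y \<sqsubseteq>\<^bsub>M\<^esub> w" for w
  proof -
    obtain z where z: "z \<in> carrier L" "w = h z" using w(1) h by blast
    then have "x \<sqsubseteq> z" "y \<sqsubseteq> z" using w le xy by blast+
    then have "x \<squnion> y \<sqsubseteq> z" using join_le xy z(1) by blast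
    then show ?thesis using le xy z join_closed by blast
  qed
  ultimately show ?thesis using m by (simp add: is_lub_pair_iff)
qed

text \<open>Least upper bounds and greatest lower bounds are transported by the isomorphism. In particular the
  target inherits being a lattice.\<close>

lemma order_iso_imp_isomorphic:
  fixes L :: "'a gorder" (structure) and M :: "'b gorder"
  assumes L: "lattice L" and eq: "eq M = (=)" and iso: "order_iso_to (carrier L) (\<sqsubseteq>\<^bsub>L\<^esub>) M"
  shows "L \<cong>\<^sub>L M"
proof -
  interpret lattice L by fact
  obtain h where h: "bij_betw h (carrier L) (carrier M)"
    and le: "\<forall>x\<in>carrier L. \<forall>y\<in>carrier L. x \<sqsubseteq> y \<longleftrightarrow> h x \<sqsubseteq>\<^bsub>M\<^esub> h y"
    using iso by (auto simp: order_iso_to_def)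
  have im: "carrier M = h ` carrier L" using h by (auto simp: bij_betw_def)
  have lub: "is_lub M (h (x \<squnion> y)) {h x, h y}" if "x \<in> carrier L" "y \<in> carrier L" for x y
    using order_iso_lub[OF L im[symmetric] le that] .
  have glb: "is_glb M (h (x \<sqinter> y)) {h x, h y}" if "x \<in> carrier L" "y \<in> carrier L" for x y
    using order_iso_lub[OF dual_lattice, of h "inv_gorder M" x y] im[symmetric] le that by simp
  have M: "lattice M"
  proof (rule latticeI[OF eq])
    fix a b assume ab: "a \<in> carrier M" "b \<in> carrier M"
    then obtain x y where xy: "x \<in> carrier L" "y \<in> carrier L" "a = h x" "b = h y" using im by auto
    show "\<exists>s. is_lub M s {a, b}" "\<exists>s. is_glb M s {a, b}"
      using lub[OF xy(1,2)] glb[OF xy(1,2)] xy(3,4) by blast+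
    show "a \<sqsubseteq>\<^bsub>M\<^esub> a" using xy le by auto
    show "a \<sqsubseteq>\<^bsub>M\<^esub> b \<Longrightarrow> b \<sqsubseteq>\<^bsub>M\<^esub> a \<Longrightarrow> a = b" using xy le le_antisym by auto
    fix c assume "c \<in> carrier M"
    then obtain z where "z \<in> carrier L" "c = h z" using im by auto
    then show "a \<sqsubseteq>\<^bsub>M\<^esub> b \<Longrightarrow> b \<sqsubseteq>\<^bsub>M\<^esub> c \<Longrightarrow> a \<sqsubseteq>\<^bsub>M\<^esub> c" using xy le le_trans by blast
  qed
  have "join_pres L M h" "meet_pres L M h"
    unfolding join_pres_def meet_pres_def
    using L M join_eqI[OF M _ _ lub] meet_eqI[OF M _ _ glb] im by auto
  then show ?thesis using h by (auto simp: lattice_isomorphic_def)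
qed

lemma isomorphic_imp_order_iso:
  fixes L :: "'a gorder" and M :: "'b gorder"
  assumes "L \<cong>\<^sub>L M" shows "order_iso_to (carrier L) (\<sqsubseteq>\<^bsub>L\<^esub>) M"
proof -
  obtain h where h: "bij_betw h (carrier L) (carrier M)" and j: "join_pres L M h"
    using assms by (auto simp: lattice_isomorphic_def)
  have L: "lattice L" and M: "lattice M"
    and jn: "\<And>x y. x \<in> carrier L \<Longrightarrow> y \<in> carrier L \<Longrightarrow> h (x \<squnion>\<^bsub>L\<^esub> y) = h x \<squnion>\<^bsub>M\<^esub> h y"
    using j by (auto simp: join_pres_def)
  interpret L: lattice L by fact
  interpret M: lattice M by fact
  have "x \<sqsubseteq>\<^bsub>L\<^esub> y \<longleftrightarrow> h x \<sqsubseteq>\<^bsub>M\<^esub> h y" if "x \<in> carrier L" "y \<in> carrier L" for x y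
  proof -
    have "h x \<in> carrier M" "h y \<in> carrier M" using bij_betwE[OF h] that by auto
    then have "h x \<sqsubseteq>\<^bsub>M\<^esub> h y \<longleftrightarrow> h (x \<squnion>\<^bsub>L\<^esub> y) = h y"
      using M.le_iff_meet jn[OF that] by simp
    also have "\<dots> \<longleftrightarrow> x \<squnion>\<^bsub>L\<^esub> y = y"
      using h that L.join_closed by (auto simp: bij_betw_def inj_on_def)
    also have "\<dots> \<longleftrightarrow> x \<sqsubseteq>\<^bsub>L\<^esub> y" using L.le_iff_meet that by simp
    finally show ?thesis by simp
  qed
  then show ?thesis using h unfolding order_iso_to_def by blast
qed

lemma isomorphic_card: "L \<cong>\<^sub>L M \<Longrightarrow> card (carrier L) = card (carrier M)"
  by (auto simp: lattice_isomorphic_def dest: bij_betw_same_card)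

lemma bottom_image:
  assumes h: "bij_betw h S (carrier M)" "\<forall>x\<in>S. \<forall>y\<in>S. leq x y \<longleftrightarrow> h x \<sqsubseteq>\<^bsub>M\<^esub> h y"
    and anti: "\<And>x y. x \<in> S \<Longrightarrow> y \<in> S \<Longrightarrow> leq x y \<Longrightarrow> leq y x \<Longrightarrow> x = y"
    and c: "c \<in> S" "\<And>x. x \<in> S \<Longrightarrow> leq c x"
  shows "\<bottom>\<^bsub>M\<^esub> = h c"
proof -
  have im: "carrier M = h ` S" using h by (auto simp: bij_betw_def)
  show ?thesis
    unfolding bottom_def
  proof (rule some_equality)
    show "least M (h c) (carrier M)" using im c h(2) by (auto simp: least_def)
    fix m assume m: "least M m (carrier M)"
    then obtain u where u: "u \<in> S" "m = h u" using im by (auto simp: least_def)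
    have "h u \<sqsubseteq>\<^bsub>M\<^esub> h c" using m u c(1) im by (auto simp: least_def)
    then show "m = h c" using anti[OF u(1) c(1)] c(2)[OF u(1)] h(2) u c(1) by blast
  qed
qed

lemma top_image:
  assumes h: "bij_betw h S (carrier M)" "\<forall>x\<in>S. \<forall>y\<in>S. leq x y \<longleftrightarrow> h x \<sqsubseteq>\<^bsub>M\<^esub> h y"
    and anti: "\<And>x y. x \<in> S \<Longrightarrow> y \<in> S \<Longrightarrow> leq x y \<Longrightarrow> leq y x \<Longrightarrow> x = y"
    and c: "c \<in> S" "\<And>x. x \<in> S \<Longrightarrow> leq x c"
  shows "\<top>\<^bsub>M\<^esub> = h c"
  using bottom_image[of h S "inv_gorder M" "\<lambda>x y. leq y x" c] assms by simp

lemma chain_simps [simp]: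
  "carrier (chain m) = {..<m}" "x \<sqsubseteq>\<^bsub>chain m\<^esub> y \<longleftrightarrow> x \<le> y" "eq (chain m) = (=)"
  by (simp_all add: chain_def)

lemma chain_bottom [simp]: "m > 0 \<Longrightarrow> \<bottom>\<^bsub>chain m\<^esub> = 0"
  using bottom_image[of id "{..<m}" "chain m" "(\<le>)" 0] by simp

lemma chain_top [simp]: "m > 0 \<Longrightarrow> \<top>\<^bsub>chain m\<^esub> = m - 1"
  using top_image[of id "{..<m}" "chain m" "(\<le>)" "m - 1"] by simp

text \<open>The isomorphism sends an element to the number of elements below it.\<close>

lemma order_iso_chain:
  assumes fin: "finite S"
    and tot: "\<And>x y. x \<in> S \<Longrightarrow> y \<in> S \<Longrightarrow> leq x y \<or> leq y x"
    and anti: "\<And>x y. x \<in> S \<Longrightarrow> y \<in> S \<Longrightarrow> leq x y \<Longrightarrow> leq y x \<Longrightarrow> x = y"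
    and trans: "\<And>x y z. x \<in> S \<Longrightarrow> y \<in> S \<Longrightarrow> z \<in> S \<Longrightarrow> leq x y \<Longrightarrow> leq y z \<Longrightarrow> leq x z"
  shows "order_iso_to S leq (chain (card S))"
proof -
  define rk where "rk x = card {y \<in> S. leq y x \<and> y \<noteq> x}" for x
  have less: "rk x < rk y" if "x \<in> S" "y \<in> S" "leq x y" "x \<noteq> y" for x y
    unfolding rk_def
  proof (rule psubset_card_mono)
    have "x \<in> {z \<in> S. leq z y \<and> z \<noteq> y}" "x \<notin> {z \<in> S. leq z x \<and> z \<noteq> x}" using that by auto
    moreover have "{z \<in> S. leq z x \<and> z \<noteq> x} \<subseteq> {z \<in> S. leq z y \<and> z \<noteq> y}"
      using that trans anti by blast
    ultimately show "{z \<in> S. leq z x \<and> z \<noteq> x} \<subset> {z \<in> S. leq z y \<and> z \<noteq> y}" by blast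
  qed (use fin in simp)
  have iff: "leq x y \<longleftrightarrow> rk x \<le> rk y" if "x \<in> S" "y \<in> S" for x y
    using less[OF that] less[OF that(2,1)] tot[OF that] tot[OF that(1,1)] by force
  have "inj_on rk S" using iff anti by (intro inj_onI) auto
  moreover have "rk ` S \<subseteq> {..<card S}"
  proof
    fix i assume "i \<in> rk ` S"
    then obtain x where x: "x \<in> S" "i = rk x" by blast
    have "rk x < card S" unfolding rk_def by (rule psubset_card_mono) (use x fin in auto)
    then show "i \<in> {..<card S}" using x by simp
  qed
  ultimately have "bij_betw rk S {..<card S}"
    by (simp add: bij_betw_def card_image card_subset_eq)
  then show ?thesis unfolding order_iso_to_def using iff by auto
qed

lemma lattice_power_simps:
  "carrier (lattice_power (chain 2) k) = {..<k} \<rightarrow>\<^sub>E {..<2}"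
  "f \<sqsubseteq>\<^bsub>lattice_power (chain 2) k\<^esub> g \<longleftrightarrow> (\<forall>i<k. f i \<le> g i)"
  "eq (lattice_power (chain 2) k) = (=)"
  by (simp_all add: lattice_power_def)

text \<open>Characteristic functions along an enumeration of \<open>F\<close>.\<close>

lemma order_iso_Pow:
  assumes "finite F"
  shows "order_iso_to (Pow F) (\<subseteq>) (lattice_power (chain 2) (card F))"
proof -
  obtain f where f: "bij_betw f {0..<card F} F" using ex_bij_betw_nat_finite[OF assms] by blast
  have inj: "inj_on f {..<card F}" and im: "F = f ` {..<card F}"
    using f by (auto simp: bij_betw_def atLeast0LessThan)
  define h where "h X = (\<lambda>i\<in>{..<card F}. if f i \<in> X then 1 else 0 :: nat)" for X
  define g where "g u = {f i | i. i < card F \<and> u i = (1::nat)}" for u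
  have "bij_betw h (Pow F) ({..<card F} \<rightarrow>\<^sub>E {..<2})"
  proof (rule bij_betw_byWitness[where f' = g])
    show "\<forall>X\<in>Pow F. g (h X) = X"
    proof
      fix X assume "X \<in> Pow F"
      then show "g (h X) = X" unfolding g_def h_def using im by (auto split: if_splits)
    qed
    show "\<forall>u\<in>{..<card F} \<rightarrow>\<^sub>E {..<2}. h (g u) = u"
    proof
      fix u assume u: "u \<in> {..<card F} \<rightarrow>\<^sub>E {..<2::nat}"
      show "h (g u) = u"
      proof
        fix i
        show "h (g u) i = u i"
        proof (cases "i < card F")
          case True
          then have "u i = 0 \<or> u i = 1" using PiE_mem[OF u, of i] by auto
          moreover have "f i \<in> g u \<longleftrightarrow> u i = 1"
            using True inj by (auto simp: g_def inj_on_def)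
          ultimately show ?thesis using True by (auto simp: h_def)
        next
          case False
          then show ?thesis using PiE_arb[OF u, of i] by (simp add: h_def)
        qed
      qed
    qed
    show "h ` Pow F \<subseteq> {..<card F} \<rightarrow>\<^sub>E {..<2}" by (auto simp: h_def split: if_splits)
    show "g ` ({..<card F} \<rightarrow>\<^sub>E {..<2}) \<subseteq> Pow F" using im by (auto simp: g_def)
  qed
  moreover have "X \<subseteq> Y \<longleftrightarrow> (\<forall>i<card F. h X i \<le> h Y i)" if "X \<subseteq> F" "Y \<subseteq> F" for X Y
  proof -
    have "X \<subseteq> Y" if le: "\<forall>i<card F. f i \<in> X \<longrightarrow> f i \<in> Y"
    proof
      fix x assume x: "x \<in> X"
      then obtain i where "i < card F" "x = f i" using \<open>X \<subseteq> F\<close> im by blast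
      then show "x \<in> Y" using le x by blast
    qed
    then have "X \<subseteq> Y \<longleftrightarrow> (\<forall>i<card F. f i \<in> X \<longrightarrow> f i \<in> Y)" by blast
    then show ?thesis by (auto simp: h_def)
  qed
  ultimately show ?thesis unfolding order_iso_to_def lattice_power_simps by (auto simp: Pow_def)
qed

text \<open>The shared element \<open>c\<close> keeps its copy from \<open>D\<close>; its image in \<open>M2\<close> is the bottom, which the sum
  removes.\<close>

lemma order_iso_ordinal_sum:
  assumes D: "order_iso_to D leq M1" and U: "order_iso_to U leq M2" and c: "D \<inter> U = {c}"
    and le: "\<And>x y. x \<in> D \<Longrightarrow> y \<in> U \<Longrightarrow> leq x y"
    and anti: "\<And>x y. x \<in> D \<union> U \<Longrightarrow> y \<in> D \<union> U \<Longrightarrow> leq x y \<Longrightarrow> leq y x \<Longrightarrow> x = y"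
  shows "order_iso_to (D \<union> U) leq (M1 \<oplus>\<^sub>L M2)"
proof -
  obtain f where f: "bij_betw f D (carrier M1)" "\<forall>x\<in>D. \<forall>y\<in>D. leq x y \<longleftrightarrow> f x \<sqsubseteq>\<^bsub>M1\<^esub> f y"
    using D by (auto simp: order_iso_to_def)
  obtain g where g: "bij_betw g U (carrier M2)" "\<forall>x\<in>U. \<forall>y\<in>U. leq x y \<longleftrightarrow> g x \<sqsubseteq>\<^bsub>M2\<^esub> g y"
    using U by (auto simp: order_iso_to_def)
  have cU: "c \<in> U" "c \<in> D" using c by auto
  have bot: "\<bottom>\<^bsub>M2\<^esub> = g c"
    by (rule bottom_image[OF g]) (use anti le cU in auto)
  define h where "h x = (if x \<in> D then Inl (f x) else Inr (g x))" for x
  have "bij_betw h (D \<union> (U - {c})) (Inl ` carrier M1 \<union> Inr ` (carrier M2 - {g c}))"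
    unfolding h_def
  proof (rule bij_betw_disjoint_Un)
    show "bij_betw (\<lambda>x. Inl (f x)) D (Inl ` carrier M1)"
      using f(1) by (auto simp: bij_betw_def inj_on_def)
    show "bij_betw (\<lambda>x. Inr (g x)) (U - {c}) (Inr ` (carrier M2 - {g c}))"
      using g(1) cU by (auto simp: bij_betw_def inj_on_def)
  qed (use c in auto)
  moreover have "D \<union> (U - {c}) = D \<union> U" using cU by auto
  ultimately have bij: "bij_betw h (D \<union> U) (carrier (M1 \<oplus>\<^sub>L M2))" by (simp add: ordinal_sum_def bot)
  have no: "\<not> leq x y" if "x \<in> U" "x \<notin> D" "y \<in> D" for x y
    using anti[of x y] le[OF that(3,1)] that by auto
  have "leq x y \<longleftrightarrow> h x \<sqsubseteq>\<^bsub>M1 \<oplus>\<^sub>L M2\<^esub> h y" if "x \<in> D \<union> U" "y \<in> D \<union> U" for x y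
    using that f(2) g(2) le no by (auto simp: h_def ordinal_sum_def)
  then show ?thesis using bij unfolding order_iso_to_def by blast
qed

text \<open>The shared bounds keep their copies from \<open>D\<close>; their images in \<open>M2\<close> are the bounds, which the sum
  removes.\<close>

lemma order_iso_horizontal_sum:
  assumes D: "order_iso_to D leq M1" and U: "order_iso_to U leq M2" and zt: "D \<inter> U = {z, t}"
    and bounds: "\<And>x. x \<in> D \<union> U \<Longrightarrow> leq z x \<and> leq x t"
    and inc: "\<And>x y. x \<in> D \<Longrightarrow> y \<in> U \<Longrightarrow> leq x y \<Longrightarrow> x = z \<or> y = t"
      "\<And>x y. x \<in> D \<Longrightarrow> y \<in> U \<Longrightarrow> leq y x \<Longrightarrow> y = z \<or> x = t"
    and anti: "\<And>x y. x \<in> D \<union> U \<Longrightarrow> y \<in> D \<union> U \<Longrightarrow> leq x y \<Longrightarrow> leq y x \<Longrightarrow> x = y"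
  shows "order_iso_to (D \<union> U) leq (M1 \<boxplus>\<^sub>L M2)"
proof -
  obtain f where f: "bij_betw f D (carrier M1)" "\<forall>x\<in>D. \<forall>y\<in>D. leq x y \<longleftrightarrow> f x \<sqsubseteq>\<^bsub>M1\<^esub> f y"
    using D by (auto simp: order_iso_to_def)
  obtain g where g: "bij_betw g U (carrier M2)" "\<forall>x\<in>U. \<forall>y\<in>U. leq x y \<longleftrightarrow> g x \<sqsubseteq>\<^bsub>M2\<^esub> g y"
    using U by (auto simp: order_iso_to_def)
  have mem: "z \<in> D" "z \<in> U" "t \<in> D" "t \<in> U" using zt by auto
  have b1: "\<bottom>\<^bsub>M1\<^esub> = f z" by (rule bottom_image[OF f]) (use anti bounds mem in auto)
  have b2: "\<bottom>\<^bsub>M2\<^esub> = g z" by (rule bottom_image[OF g]) (use anti bounds mem in auto)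
  have t1: "\<top>\<^bsub>M1\<^esub> = f t" by (rule top_image[OF f]) (use anti bounds mem in auto)
  have t2: "\<top>\<^bsub>M2\<^esub> = g t" by (rule top_image[OF g]) (use anti bounds mem in auto)
  have injf: "f x = f y \<longleftrightarrow> x = y" if "x \<in> D" "y \<in> D" for x y
    using f(1) that by (auto simp: bij_betw_def inj_on_def)
  define h where "h x = (if x \<in> D then Inl (f x) else Inr (g x))" for x
  have "bij_betw h (D \<union> (U - {z, t})) (Inl ` carrier M1 \<union> Inr ` (carrier M2 - {g z, g t}))"
    unfolding h_def
  proof (rule bij_betw_disjoint_Un)
    show "bij_betw (\<lambda>x. Inl (f x)) D (Inl ` carrier M1)"
      using f(1) by (auto simp: bij_betw_def inj_on_def)
    have "g ` (U - {z, t}) = carrier M2 - {g z, g t}"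
      using g(1) mem inj_on_image_set_diff[of g U U "{z, t}"] by (auto simp: bij_betw_def)
    then have "(\<lambda>x. Inr (g x)) ` (U - {z, t}) = Inr ` (carrier M2 - {g z, g t})"
      by (simp add: image_image[symmetric])
    then show "bij_betw (\<lambda>x. Inr (g x)) (U - {z, t}) (Inr ` (carrier M2 - {g z, g t}))"
      using g(1) by (auto simp: bij_betw_def inj_on_def)
  qed (use zt in auto)
  moreover have "D \<union> (U - {z, t}) = D \<union> U" using mem by auto
  ultimately have bij: "bij_betw h (D \<union> U) (carrier (M1 \<boxplus>\<^sub>L M2))"
    by (simp add: horizontal_sum_def b2 t2)
  have DU: "leq x y \<longleftrightarrow> x = z" if "x \<in> D" "y \<in> U" "y \<notin> D" for x y
    using inc(1)[OF that(1,2)] bounds[of y] that mem by auto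
  have UD: "leq y x \<longleftrightarrow> x = t" if "x \<in> D" "y \<in> U" "y \<notin> D" for x y
    using inc(2)[OF that(1,2)] bounds[of y] that mem by auto
  have "leq x y \<longleftrightarrow> h x \<sqsubseteq>\<^bsub>M1 \<boxplus>\<^sub>L M2\<^esub> h y" if xy: "x \<in> D \<union> U" "y \<in> D \<union> U" for x y
  proof (cases "x \<in> D"; cases "y \<in> D")
    assume "x \<in> D" "y \<in> D"
    then show ?thesis using f(2) by (simp add: h_def horizontal_sum_def)
  next
    assume "x \<in> D" "y \<notin> D"
    then show ?thesis using DU[of x y] xy injf mem by (simp add: h_def horizontal_sum_def b1)
  next
    assume "x \<notin> D" "y \<in> D"
    then show ?thesis using UD[of y x] xy injf mem by (simp add: h_def horizontal_sum_def t1)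
  next
    assume "x \<notin> D" "y \<notin> D"
    then show ?thesis using g(2) xy by (simp add: h_def horizontal_sum_def)
  qed
  then show ?thesis using bij unfolding order_iso_to_def by blast
qed

lemma card_power: "card (carrier (lattice_power (chain 2) k)) = 2 ^ k"
  by (simp add: lattice_power_simps card_PiE)

lemma card_power_sum: "card (carrier (lattice_power (chain 2) k \<oplus>\<^sub>L chain 2)) = 2 ^ k + 1"
proof -
  let ?P = "carrier (lattice_power (chain 2) k)"
  have "carrier (lattice_power (chain 2) k \<oplus>\<^sub>L chain 2) = Inl ` ?P \<union> {Inr 1}"
    by (auto simp: ordinal_sum_def)
  moreover have "finite ?P" using card_power[of k] by (metis card.infinite power_not_zero zero_neq_numeral)
  ultimately show ?thesis
    using card_power[of k] card_image[of Inl ?P] by (simp add: card_insert_if image_iff)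
qed

section \<open>The two shapes as sums of chains\<close>

definition square_atom :: "nat \<Rightarrow> nat \<Rightarrow> nat" where
  "square_atom j = (\<lambda>i\<in>{..<2}. if i = j then 1 else 0)"

lemma power_bottom: "\<bottom>\<^bsub>lattice_power (chain 2) k\<^esub> = (\<lambda>i\<in>{..<k}. 0)"
  unfolding bottom_def
proof (rule some_equality)
  let ?M = "lattice_power (chain 2) k" and ?z = "\<lambda>i\<in>{..<k}. 0 :: nat"
  have z: "?z \<in> carrier ?M" by (simp add: lattice_power_simps)
  then show "least ?M ?z (carrier ?M)"
    unfolding least_def by (simp add: lattice_power_simps)
  fix m assume "least ?M m (carrier ?M)"
  then have m: "m \<in> {..<k} \<rightarrow>\<^sub>E {..<2}" "\<forall>i<k. m i \<le> ?z i"
    using z unfolding least_def lattice_power_simps by blast+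
  show "m = ?z"
  proof
    fix i
    show "m i = ?z i" using m(2) PiE_arb[OF m(1), of i] by (cases "i < k") auto
  qed
qed

lemma all_less_two: "(\<forall>i<2. P i) \<longleftrightarrow> P 0 \<and> P (1::nat)"
  by (auto simp: less_2_cases_iff)

lemma square_incomparable:
  assumes "f \<in> carrier (lattice_power (chain 2) 2)" "g \<in> carrier (lattice_power (chain 2) 2)"
    and "\<not> f \<sqsubseteq>\<^bsub>lattice_power (chain 2) 2\<^esub> g" "\<not> g \<sqsubseteq>\<^bsub>lattice_power (chain 2) 2\<^esub> f"
  shows "{f, g} = {square_atom 0, square_atom 1}"
proof -
  have m: "f \<in> {..<2} \<rightarrow>\<^sub>E {..<2}" "g \<in> {..<2} \<rightarrow>\<^sub>E {..<2}" using assms by (auto simp: lattice_power_simps)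
  have sq: "square_atom j \<in> {..<2} \<rightarrow>\<^sub>E {..<2}" for j by (auto simp: square_atom_def)
  have v: "f 0 < 2" "f 1 < 2" "g 0 < 2" "g 1 < 2"
    using PiE_mem[OF m(1), of 0] PiE_mem[OF m(1), of 1] PiE_mem[OF m(2), of 0] PiE_mem[OF m(2), of 1] by auto
  have n: "\<not> (f 0 \<le> g 0 \<and> f 1 \<le> g 1)" "\<not> (g 0 \<le> f 0 \<and> g 1 \<le> f 1)"
    using assms(3,4) unfolding lattice_power_simps all_less_two by auto
  have ext: "u = square_atom j" if "u \<in> {..<2} \<rightarrow>\<^sub>E {..<2}" "u 0 = (if j = 0 then 1 else 0)" "u 1 = (if j = 1 then 1 else 0)" for u j
  proof (rule PiE_ext[OF that(1) sq])
    fix i assume "i \<in> {..<2::nat}"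
    then have "i = 0 \<or> i = 1" by auto
    then show "u i = square_atom j i" using that(2,3) by (auto simp: square_atom_def)
  qed
  have "f 0 = 0 \<or> f 0 = 1" "f 1 = 0 \<or> f 1 = 1" "g 0 = 0 \<or> g 0 = 1" "g 1 = 0 \<or> g 1 = 1"
    using v by auto
  then have "f 0 = 1 \<and> f 1 = 0 \<and> g 0 = 0 \<and> g 1 = 1 \<or> f 0 = 0 \<and> f 1 = 1 \<and> g 0 = 1 \<and> g 1 = 0"
    using n by (elim disjE) simp_all
  then show ?thesis
    using ext[OF m(1), of 0] ext[OF m(1), of 1] ext[OF m(2), of 0] ext[OF m(2), of 1] by auto
qed

lemma square_atoms:
  "square_atom j \<in> carrier (lattice_power (chain 2) 2)"
  "\<not> square_atom 0 \<sqsubseteq>\<^bsub>lattice_power (chain 2) 2\<^esub> square_atom 1"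
  "\<not> square_atom 1 \<sqsubseteq>\<^bsub>lattice_power (chain 2) 2\<^esub> square_atom 0"
  unfolding lattice_power_simps all_less_two by (auto simp: square_atom_def)

context finite_lattice
begin

lemma order_iso_chain_iff: "order_iso_to A (\<preceq>) (chain (card A)) \<longleftrightarrow> R = {}"
proof
  assume "R = {}"
  then show "order_iso_to A (\<preceq>) (chain (card A))"
    using R_empty_iff finite_A antisym trans by (intro order_iso_chain) blast+
next
  assume "order_iso_to A (\<preceq>) (chain (card A))"
  then obtain h :: "'a \<Rightarrow> nat" where "\<forall>x\<in>A. \<forall>y\<in>A. x \<preceq> y \<longleftrightarrow> h x \<le> h y"
    by (auto simp: order_iso_to_def)
  then show "R = {}" unfolding R_empty_iff using nat_le_linear by blast
qed

lemma order_iso_square_nonchain: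
  assumes "order_iso_to A (\<preceq>) (lattice_power (chain 2) 2)" shows "R \<noteq> {}"
proof
  assume "R = {}"
  obtain h where h: "bij_betw h A (carrier (lattice_power (chain 2) 2))"
    "\<forall>x\<in>A. \<forall>y\<in>A. x \<preceq> y \<longleftrightarrow> h x \<sqsubseteq>\<^bsub>lattice_power (chain 2) 2\<^esub> h y"
    using assms by (auto simp: order_iso_to_def)
  obtain x y where "x \<in> A" "y \<in> A" "h x = square_atom 0" "h y = square_atom 1"
    using h(1) square_atoms(1) unfolding bij_betw_def by (metis imageE)
  then show False using h(2) square_atoms(2,3) \<open>R = {}\<close> R_empty_iff by metis
qed

lemma order_iso_square:
  assumes ab: "a \<parallel> b"
  shows "order_iso_to {a \<^bold>\<sqinter> b, a, b, a \<^bold>\<squnion> b} (\<preceq>) (lattice_power (chain 2) 2)"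
proof -
  have m: "a \<in> A" "b \<in> A" using ab incomparable_mem by blast+
  have ne: "a \<noteq> b" using ab refl by (auto simp: incomparable_def)
  define f where "f x = {y \<in> {a, b}. y \<preceq> x}" for x
  have l: "\<not> a \<preceq> b" "\<not> b \<preceq> a" "a \<preceq> a" "b \<preceq> b" "a \<preceq> a \<^bold>\<squnion> b" "b \<preceq> a \<^bold>\<squnion> b"
    using ab refl join_ge1 join_ge2 m by (auto simp: incomparable_def)
  have l2: "\<not> a \<preceq> a \<^bold>\<sqinter> b" "\<not> b \<preceq> a \<^bold>\<sqinter> b"
    using l(1,2) meet_le1[OF m] meet_le2[OF m] trans by blast+
  have f: "f (a \<^bold>\<sqinter> b) = {}" "f a = {a}" "f b = {b}" "f (a \<^bold>\<squnion> b) = {a, b}"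
    unfolding f_def using l l2 by auto
  have P: "Pow {a, b} = {{}, {a}, {b}, {a, b}}" by auto
  have "bij_betw f {a \<^bold>\<sqinter> b, a, b, a \<^bold>\<squnion> b} (Pow {a, b})"
    unfolding bij_betw_def P using f ne by (auto simp: inj_on_def)
  moreover have "x \<preceq> y \<longleftrightarrow> f x \<subseteq> f y" if xy: "x \<in> {a \<^bold>\<sqinter> b, a, b, a \<^bold>\<squnion> b}" "y \<in> {a \<^bold>\<sqinter> b, a, b, a \<^bold>\<squnion> b}" for x y
  proof
    show "x \<preceq> y \<Longrightarrow> f x \<subseteq> f y" using trans by (auto simp: f_def)
    have lm: "a \<^bold>\<sqinter> b \<preceq> z" if "z \<in> {a \<^bold>\<sqinter> b, a, b, a \<^bold>\<squnion> b}" for z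
      using that meet_le1[OF m] meet_le2[OF m] refl[OF meet_mem[OF m]] trans[OF meet_le1[OF m] l(5)] by blast
    assume s: "f x \<subseteq> f y"
    have up: "z \<preceq> y" if "z \<in> f x" for z using s that by (auto simp: f_def)
    consider "x = a \<^bold>\<sqinter> b" | "x = a" | "x = b" | "x = a \<^bold>\<squnion> b" using xy(1) by blast
    then show "x \<preceq> y"
    proof cases
      case 1 then show ?thesis using lm[OF xy(2)] by simp
    next
      case 2 then show ?thesis using up[of a] f(2) by simp
    next
      case 3 then show ?thesis using up[of b] f(3) by simp
    next
      case 4 then show ?thesis using up[of a] up[of b] f(4) join_least by simp
    qed
  qed
  ultimately have "order_iso_to {a \<^bold>\<sqinter> b, a, b, a \<^bold>\<squnion> b} (\<preceq>) (lattice_power (chain 2) (card {a, b}))"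
    using order_iso_to_transfer[OF order_iso_Pow[of "{a, b}"]] by blast
  moreover have "card {a, b} = 2" using ne by simp
  ultimately show ?thesis by metis
qed

text \<open>The elements above one atom form a chain with 0, because incomparable elements have meet 0; every
  nonzero element lies above one of the two atoms, and only 1 lies above both.\<close>

lemma horizontal_sum_order_iso:
  assumes h: two_chain_horizontal_sum and n: "card A \<ge> 5"
  shows "\<exists>k\<in>{3..card A - 2}. order_iso_to A (\<preceq>) (chain k \<boxplus>\<^sub>L chain (card A - k + 2))"
proof -
  obtain p0 q0 where pq0: "p0 \<noteq> q0" "atoms = {p0, q0}" using horizontal_sum_atoms[OF h] .
  define D where "D p = {x \<in> A. p \<preceq> x} \<union> {\<^bold>0}" for p
  have j1: "x \<^bold>\<squnion> y = \<^bold>1" and m0: "x \<^bold>\<sqinter> y = \<^bold>0" if "x \<parallel> y" for x y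
    using h that unfolding two_chain_horizontal_sum_def by blast+
  have Rne: "R \<noteq> {}"
    using h incomparable_join_R unfolding two_chain_horizontal_sum_def by blast
  have DA: "D p \<subseteq> A" for p using zero_mem by (auto simp: D_def)
  have finD: "finite (D p)" for p using DA finite_A finite_subset by blast
  have tot: "x \<preceq> y \<or> y \<preceq> x" if p: "p \<in> atoms" and xy: "x \<in> D p" "y \<in> D p" for p x y
  proof (rule ccontr)
    assume "\<not> (x \<preceq> y \<or> y \<preceq> x)"
    then have i: "x \<parallel> y" using xy DA by (auto simp: incomparable_def)
    then have "p \<preceq> x" "p \<preceq> y" using xy incomparable_not_bound[OF i] by (auto simp: D_def)
    then have "p \<preceq> \<^bold>0" using meet_greatest m0[OF i] by metis
    then show False using le_zero J_nonzero[OF atom_J[OF p]] by blast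
  qed
  have Dch: "order_iso_to (D p) (\<preceq>) (chain (card (D p)))" if "p \<in> atoms" for p
    by (rule order_iso_chain[OF finD]) (use tot[OF that] antisym trans in blast)+
  have card3: "card (D p) \<ge> 3" if p: "p \<in> atoms" for p
  proof -
    have pA: "p \<in> A" using J_mem atom_J p by blast
    have "p \<noteq> \<^bold>0" "p \<noteq> \<^bold>1" using J_nonzero[OF atom_J[OF p]] one_notin_atoms[OF Rne] p by auto
    then have "card {\<^bold>0, p, \<^bold>1} = 3" using nonchain_bounds[OF Rne] by auto
    moreover have "{\<^bold>0, p, \<^bold>1} \<subseteq> D p" using pA refl le_one one_mem by (auto simp: D_def)
    ultimately show ?thesis using card_mono[OF finD] by metis
  qed
  have main: "order_iso_to A (\<preceq>) (chain (card (D p)) \<boxplus>\<^sub>L chain (card (D q)))"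
    and sum: "card (D p) + card (D q) = card A + 2" if pq: "p \<noteq> q" "atoms = {p, q}" for p q
  proof -
    have at: "p \<in> atoms" "q \<in> atoms" using pq by auto
    have pqj: "p \<^bold>\<squnion> q = \<^bold>1" using j1 atoms_incomparable[OF at pq(1)] by blast
    have both: "x = \<^bold>1" if "p \<preceq> x" "q \<preceq> x" for x
      using join_least[OF that] pqj one_le by simp
    have nz: "p \<noteq> \<^bold>0" "q \<noteq> \<^bold>0" using J_nonzero atom_J at by blast+
    have int: "D p \<inter> D q = {\<^bold>0, \<^bold>1}"
      using both le_zero nz le_one one_mem J_mem[OF atom_J[OF at(1)]] J_mem[OF atom_J[OF at(2)]]
      unfolding D_def by blast
    have un: "D p \<union> D q = A"
    proof
      show "A \<subseteq> D p \<union> D q"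
      proof
        fix x assume x: "x \<in> A"
        show "x \<in> D p \<union> D q"
        proof (cases "x = \<^bold>0")
          case False
          obtain a where "a \<in> atoms" "a \<preceq> x" using atom_below[OF x False] .
          then show ?thesis using pq x by (auto simp: D_def)
        qed (simp add: D_def)
      qed
    qed (use DA in blast)
    have "\<^bold>0 \<noteq> \<^bold>1" using nonchain_bounds[OF Rne] .
    then show "card (D p) + card (D q) = card A + 2"
      using card_Un_Int[OF finD finD, of p q] int un by simp
    have cross: "x = \<^bold>0 \<or> y = \<^bold>1" if "x \<in> D p'" "y \<in> D q'" "x \<preceq> y" "{p', q'} = {p, q}" for x y p' q'
    proof (cases "x = \<^bold>0")
      case False
      then have "p' \<preceq> y" using that(1,3) trans by (auto simp: D_def)
      moreover have "y \<noteq> \<^bold>0" using False le_zero that(3) by blast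
      then have "q' \<preceq> y" using that(2) by (simp add: D_def)
      ultimately show ?thesis using both[of y] that(4) by (auto simp: doubleton_eq_iff)
    qed simp
    have "order_iso_to (D p \<union> D q) (\<preceq>) (chain (card (D p)) \<boxplus>\<^sub>L chain (card (D q)))"
    proof (rule order_iso_horizontal_sum[OF Dch[OF at(1)] Dch[OF at(2)] int])
      show "\<^bold>0 \<preceq> x \<and> x \<preceq> \<^bold>1" if "x \<in> D p \<union> D q" for x using that un zero_le le_one by blast
      show "x = \<^bold>0 \<or> y = \<^bold>1" if "x \<in> D p" "y \<in> D q" "x \<preceq> y" for x y using cross[OF that] by simp
      show "y = \<^bold>0 \<or> x = \<^bold>1" if "x \<in> D p" "y \<in> D q" "y \<preceq> x" for x y using cross[OF that(2,1,3)] by auto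
    qed (rule antisym)
    then show "order_iso_to A (\<preceq>) (chain (card (D p)) \<boxplus>\<^sub>L chain (card (D q)))" unfolding un .
  qed
  have wit: ?thesis if pq: "p \<noteq> q" "atoms = {p, q}" and q4: "card (D q) \<ge> 4" for p q
  proof -
    have "card (D p) \<in> {3..card A - 2}" "card A - card (D p) + 2 = card (D q)"
      using card3[of p] sum[OF pq] q4 n pq by auto
    then show ?thesis using main[OF pq] by metis
  qed
  \<comment> \<open>The range of \<open>k\<close> asks for a second chain with at least four elements; the two lengths add up to
     at least seven.\<close>
  have "card (D q0) \<ge> 4 \<or> card (D p0) \<ge> 4" using sum[OF pq0] n by linarith
  then show ?thesis using wit[OF pq0] wit[of q0 p0] pq0 by (auto simp: insert_commute)
qed

text \<open>Above two incomparable elements of the sum there is only the top, below them only the bottom, and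
  among three elements two lie in the same chain.\<close>

lemma order_iso_horizontal_sumD:
  assumes iso: "order_iso_to A (\<preceq>) (chain k \<boxplus>\<^sub>L chain l)" and kl: "k \<ge> 3" "l \<ge> 3"
  shows two_chain_horizontal_sum
proof -
  let ?M = "chain k \<boxplus>\<^sub>L chain l"
  obtain h where h: "bij_betw h A (carrier ?M)" and le: "\<forall>x\<in>A. \<forall>y\<in>A. x \<preceq> y \<longleftrightarrow> h x \<sqsubseteq>\<^bsub>?M\<^esub> h y"
    using iso by (auto simp: order_iso_to_def)
  have k0: "k > 0" "l > 0" using kl by auto
  have car: "carrier ?M = Inl ` {..<k} \<union> Inr ` ({..<l} - {0, l - 1})"
    using k0 by (simp add: horizontal_sum_def)
  have leM: "Inl i \<sqsubseteq>\<^bsub>?M\<^esub> Inl j \<longleftrightarrow> i \<le> j" "Inl i \<sqsubseteq>\<^bsub>?M\<^esub> Inr j \<longleftrightarrow> i = 0"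
    "Inr i \<sqsubseteq>\<^bsub>?M\<^esub> Inl j \<longleftrightarrow> j = k - 1" "Inr i \<sqsubseteq>\<^bsub>?M\<^esub> Inr j \<longleftrightarrow> i \<le> j" for i j
    using k0 by (simp_all add: horizontal_sum_def)
  have hm: "h x \<in> carrier ?M" if "x \<in> A" for x using bij_betwE[OF h] that by blast
  have inj: "x = y" if "x \<in> A" "y \<in> A" "h x = h y" for x y using h that by (auto simp: bij_betw_def inj_on_def)
  have inc: "\<not> h x \<sqsubseteq>\<^bsub>?M\<^esub> h y" "\<not> h y \<sqsubseteq>\<^bsub>?M\<^esub> h x" if "x \<parallel> y" for x y
    using that le by (auto simp: incomparable_def)
  have up: "w = Inl (k - 1)" if "u \<in> carrier ?M" "v \<in> carrier ?M" "w \<in> carrier ?M"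
    "\<not> u \<sqsubseteq>\<^bsub>?M\<^esub> v" "\<not> v \<sqsubseteq>\<^bsub>?M\<^esub> u" "u \<sqsubseteq>\<^bsub>?M\<^esub> w" "v \<sqsubseteq>\<^bsub>?M\<^esub> w" for u v w
    using that unfolding car by (auto simp: leM)
  have down: "w = Inl 0" if "u \<in> carrier ?M" "v \<in> carrier ?M" "w \<in> carrier ?M"
    "\<not> u \<sqsubseteq>\<^bsub>?M\<^esub> v" "\<not> v \<sqsubseteq>\<^bsub>?M\<^esub> u" "w \<sqsubseteq>\<^bsub>?M\<^esub> u" "w \<sqsubseteq>\<^bsub>?M\<^esub> v" for u v w
    using that unfolding car by (auto simp: leM)
  have "x \<^bold>\<sqinter> y = \<^bold>0 \<and> x \<^bold>\<squnion> y = \<^bold>1" if xy: "x \<parallel> y" for x y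
  proof
    have m: "x \<in> A" "y \<in> A" "x \<^bold>\<squnion> y \<in> A" "x \<^bold>\<sqinter> y \<in> A"
      using incomparable_mem[OF xy] join_mem meet_mem by blast+
    have "w = Inl (k - 1)" if "w = h z" "z \<in> A" "x \<preceq> z" "y \<preceq> z" for w z
      using up[OF hm[OF m(1)] hm[OF m(2)] _ inc[OF xy], of w] hm le m that by blast
    then have "h (x \<^bold>\<squnion> y) = h \<^bold>1" using m join_ge1 join_ge2 le_one one_mem by metis
    then show "x \<^bold>\<squnion> y = \<^bold>1" using inj m one_mem by blast
    have "w = Inl 0" if "w = h z" "z \<in> A" "z \<preceq> x" "z \<preceq> y" for w z
      using down[OF hm[OF m(1)] hm[OF m(2)] _ inc[OF xy], of w] hm le m that by blast
    then have "h (x \<^bold>\<sqinter> y) = h \<^bold>0" using m meet_le1 meet_le2 zero_le zero_mem by metis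
    then show "x \<^bold>\<sqinter> y = \<^bold>0" using inj m zero_mem by blast
  qed
  moreover have "\<not> x \<parallel> z" if xyz: "x \<parallel> y" "y \<parallel> z" for x y z
  proof
    assume xz: "x \<parallel> z"
    have "h x \<in> carrier ?M" "h y \<in> carrier ?M" "h z \<in> carrier ?M"
      using hm incomparable_mem xyz by blast+
    then show False using inc[OF xyz(1)] inc[OF xyz(2)] inc[OF xz] unfolding car by (auto simp: leM)
  qed
  moreover have "\<exists>x y. x \<parallel> y"
  proof -
    have "Inl 1 \<in> carrier ?M" "Inr 1 \<in> carrier ?M" unfolding car using kl by auto
    then obtain x y where "x \<in> A" "h x = Inl 1" "y \<in> A" "h y = Inr 1"
      using h unfolding bij_betw_def by (metis imageE)
    then have "x \<parallel> y" using le kl by (auto simp: incomparable_def leM)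
    then show ?thesis by blast
  qed
  ultimately show ?thesis unfolding two_chain_horizontal_sum_def by blast
qed

text \<open>Meet \<open>c\<close> and join \<open>d\<close> of the incomparable pair cut the lattice into the chain below \<open>c\<close>, the square, and
  the chain above \<open>d\<close>.\<close>

lemma diamond_order_iso:
  assumes single_inner_diamond
  shows "card A \<ge> 6" "\<exists>k\<in>{2..card A - 4}. order_iso_to A (\<preceq>)
    (chain k \<oplus>\<^sub>L lattice_power (chain 2) 2 \<oplus>\<^sub>L chain (card A - k - 2))"
proof -
  obtain a b where ab: "a \<parallel> b" and u: "\<And>x y. x \<parallel> y \<Longrightarrow> {x, y} = {a, b}"
    and nz: "a \<^bold>\<sqinter> b \<noteq> \<^bold>0" and n1: "a \<^bold>\<squnion> b \<noteq> \<^bold>1"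
    using assms unfolding single_inner_diamond_def by blast
  have m: "a \<in> A" "b \<in> A" using ab incomparable_mem by blast+
  define c d where "c = a \<^bold>\<sqinter> b" and "d = a \<^bold>\<squnion> b"
  have cd: "c \<preceq> a" "c \<preceq> b" "a \<preceq> d" "b \<preceq> d" "c \<in> A" "d \<in> A"
    using meet_le1 meet_le2 join_ge1 join_ge2 m meet_mem join_mem by (auto simp: c_def d_def)
  have cne: "c \<noteq> a" "c \<noteq> b" "d \<noteq> a" "d \<noteq> b"
    using meet_lt_incomparable[OF ab] incomparable_lt_join[OF ab] by (auto simp: lt_def c_def d_def)
  have cd2: "c \<preceq> d" "c \<noteq> d" using cd cne trans antisym by blast+
  define D U Q where "D = {x. x \<preceq> c}" and "U = {x. d \<preceq> x}" and "Q = {c, a, b, d}"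
  have fin: "finite D" "finite U" "D \<subseteq> A" "U \<subseteq> A"
  proof -
    show "D \<subseteq> A" "U \<subseteq> A" using leq_mem by (auto simp: D_def U_def)
    then show "finite D" "finite U" using finite_A finite_subset by blast+
  qed
  have ne: "a \<noteq> b" using ab refl by (auto simp: incomparable_def)
  have DQ: "D \<inter> Q = {c}"
    unfolding D_def Q_def using cd cd2 cne refl antisym by blast
  have DQU: "(D \<union> Q) \<inter> U = {d}"
    unfolding D_def Q_def U_def using cd cd2 cne refl antisym trans by blast
  have notab: "a \<notin> D" "b \<notin> D" "a \<notin> U" "b \<notin> U"
    unfolding D_def U_def using cd cne antisym by blast+
  have A_eq: "A = (D \<union> Q) \<union> U"
  proof
    show "A \<subseteq> (D \<union> Q) \<union> U"
    proof
      fix x assume x: "x \<in> A"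
      show "x \<in> (D \<union> Q) \<union> U"
      proof (cases "x = a \<or> x = b")
        case False
        have "\<not> x \<parallel> a" "\<not> x \<parallel> b" using u[of x a] u[of x b] False by blast+
        then have "x \<preceq> a \<or> a \<preceq> x" "x \<preceq> b \<or> b \<preceq> x" using x m by (auto simp: incomparable_def)
        moreover have "\<not> (x \<preceq> a \<and> b \<preceq> x)" "\<not> (a \<preceq> x \<and> x \<preceq> b)"
          using ab trans by (auto simp: incomparable_def)
        ultimately show ?thesis
          using meet_greatest[of x a b] join_least[of a x b] by (auto simp: D_def U_def c_def d_def)
      qed (auto simp: Q_def)
    qed
  qed (use fin cd m in \<open>auto simp: Q_def\<close>)
  have tot: "x \<preceq> y \<or> y \<preceq> x" if "x \<in> A" "y \<in> A" "x \<noteq> a" "x \<noteq> b" for x y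
    using u[of x y] that by (auto simp: incomparable_def)
  have isoD: "order_iso_to D (\<preceq>) (chain (card D))"
  proof (rule order_iso_chain[OF fin(1)])
    show "x \<preceq> y \<or> y \<preceq> x" if "x \<in> D" "y \<in> D" for x y
      using tot[of x y] that fin notab by blast
  qed (use antisym trans in blast)+
  have isoU: "order_iso_to U (\<preceq>) (chain (card U))"
  proof (rule order_iso_chain[OF fin(2)])
    show "x \<preceq> y \<or> y \<preceq> x" if "x \<in> U" "y \<in> U" for x y
      using tot[of x y] that fin notab by blast
  qed (use antisym trans in blast)+
  have cQ: "c \<preceq> y" "y \<preceq> d" if "y \<in> Q" for y
    using that cd cd2 refl by (auto simp: Q_def)
  have "order_iso_to (D \<union> Q) (\<preceq>) (chain (card D) \<oplus>\<^sub>L lattice_power (chain 2) 2)"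
  proof (rule order_iso_ordinal_sum[OF isoD _ DQ])
    show "order_iso_to Q (\<preceq>) (lattice_power (chain 2) 2)"
      using order_iso_square[OF ab] by (simp add: Q_def c_def d_def)
    show "x \<preceq> y" if "x \<in> D" "y \<in> Q" for x y
      using trans[OF _ cQ(1)[OF that(2)]] that(1) by (simp add: D_def)
  qed (rule antisym)
  then have iso: "order_iso_to A (\<preceq>) (chain (card D) \<oplus>\<^sub>L lattice_power (chain 2) 2 \<oplus>\<^sub>L chain (card U))"
    unfolding A_eq
  proof (rule order_iso_ordinal_sum[OF _ isoU DQU])
    show "x \<preceq> y" if "x \<in> D \<union> Q" "y \<in> U" for x y
    proof -
      have "x \<preceq> d" using that(1) trans[OF _ cd2(1)] cQ(2) by (auto simp: D_def)
      then show ?thesis using that(2) trans by (simp add: U_def)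
    qed
  qed (rule antisym)
  have "d \<notin> D" using DQ cd2(2) by (auto simp: Q_def)
  then have "D \<inter> U = {}" using DQU by auto
  then have dis: "D \<inter> ({a, b} \<union> U) = {}" "{a, b} \<inter> U = {}" using notab by auto
  have "A = D \<union> ({a, b} \<union> U)"
  proof -
    have "Q \<subseteq> D \<union> ({a, b} \<union> U)" "{a, b} \<subseteq> Q" using refl cd by (auto simp: Q_def D_def U_def)
    then show ?thesis unfolding A_eq by blast
  qed
  then have cA: "card A = card D + (2 + card U)"
    using fin(1,2) ne dis by (simp only: card_Un_disjoint finite_Un finite_insert finite.emptyI) simp
  have "card {\<^bold>0, c} \<le> card D"
    using fin zero_le[OF cd(5)] refl[OF cd(5)] by (intro card_mono) (auto simp: D_def)
  then have D2: "card D \<ge> 2" using nz c_def by (simp add: card_insert_if split: if_splits)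
  have "card {d, \<^bold>1} \<le> card U"
    using fin le_one[OF cd(6)] refl[OF cd(6)] by (intro card_mono) (auto simp: U_def)
  then have U2: "card U \<ge> 2" using n1 d_def by (simp add: card_insert_if split: if_splits)
  show "card A \<ge> 6" using cA D2 U2 by linarith
  have "card D \<in> {2..card A - 4}" "card U = card A - card D - 2" using cA D2 U2 by auto
  then show "\<exists>k\<in>{2..card A - 4}. order_iso_to A (\<preceq>)
    (chain k \<oplus>\<^sub>L lattice_power (chain 2) 2 \<oplus>\<^sub>L chain (card A - k - 2))"
    using iso by metis
qed

text \<open>The two atoms of the square are the only incomparable pair of the sum. The second element of the lower chain
  and the second element of the upper chain show that their meet and join are not the bounds.\<close>

lemma order_iso_diamondD:
  assumes iso: "order_iso_to A (\<preceq>) (chain k \<oplus>\<^sub>L lattice_power (chain 2) 2 \<oplus>\<^sub>L chain l)"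
    and kl: "k \<ge> 2" "l \<ge> 2"
  shows single_inner_diamond
proof -
  let ?C = "lattice_power (chain 2) 2"
  let ?M = "chain k \<oplus>\<^sub>L ?C \<oplus>\<^sub>L chain l"
  obtain h where h: "bij_betw h A (carrier ?M)" and le: "\<forall>x\<in>A. \<forall>y\<in>A. x \<preceq> y \<longleftrightarrow> h x \<sqsubseteq>\<^bsub>?M\<^esub> h y"
    using iso by (auto simp: order_iso_to_def)
  have k0: "k > 0" "l > 0" using kl by auto
  have car: "carrier ?M = Inl ` (Inl ` {..<k} \<union> Inr ` (carrier ?C - {\<bottom>\<^bsub>?C\<^esub>})) \<union> Inr ` ({..<l} - {0})"
    using k0 by (simp add: ordinal_sum_def)
  have leM: "Inl (Inl i) \<sqsubseteq>\<^bsub>?M\<^esub> Inl (Inl j) \<longleftrightarrow> i \<le> j" "Inl (Inl i) \<sqsubseteq>\<^bsub>?M\<^esub> Inl (Inr f)"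
    "\<not> Inl (Inr f) \<sqsubseteq>\<^bsub>?M\<^esub> Inl (Inl i)" "Inl (Inr f) \<sqsubseteq>\<^bsub>?M\<^esub> Inl (Inr g) \<longleftrightarrow> f \<sqsubseteq>\<^bsub>?C\<^esub> g"
    "Inl u \<sqsubseteq>\<^bsub>?M\<^esub> Inr i" "\<not> Inr i \<sqsubseteq>\<^bsub>?M\<^esub> Inl u" "Inr i \<sqsubseteq>\<^bsub>?M\<^esub> Inr j \<longleftrightarrow> i \<le> j" for i j f g u
    by (simp_all add: ordinal_sum_def)
  have hm: "h x \<in> carrier ?M" if "x \<in> A" for x using bij_betwE[OF h] that by blast
  have inj: "x = y" if "x \<in> A" "y \<in> A" "h x = h y" for x y using h that by (auto simp: bij_betw_def inj_on_def)
  have surj: "\<exists>x\<in>A. h x = w" if "w \<in> carrier ?M" for w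
    using bij_betw_imp_surj_on[OF h] that by (metis imageE)
  define e where "e = (\<lambda>i\<in>{..<2::nat}. 1::nat)"
  have e: "e \<in> carrier ?C" "e \<noteq> \<bottom>\<^bsub>?C\<^esub>" "square_atom i \<sqsubseteq>\<^bsub>?C\<^esub> e" for i
  proof -
    show "e \<in> carrier ?C" "square_atom i \<sqsubseteq>\<^bsub>?C\<^esub> e" by (auto simp: e_def square_atom_def lattice_power_simps)
    have "e 0 \<noteq> (\<lambda>i\<in>{..<2::nat}. 0::nat) 0" by (simp add: e_def)
    then show "e \<noteq> \<bottom>\<^bsub>?C\<^esub>" unfolding power_bottom by metis
  qed
  have s: "square_atom 0 \<noteq> \<bottom>\<^bsub>?C\<^esub>" "square_atom 1 \<noteq> \<bottom>\<^bsub>?C\<^esub>"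
  proof -
    have "square_atom 0 0 \<noteq> (\<lambda>i\<in>{..<2::nat}. 0::nat) 0" "square_atom 1 1 \<noteq> (\<lambda>i\<in>{..<2::nat}. 0::nat) 1"
      by (simp_all add: square_atom_def)
    then show "square_atom 0 \<noteq> \<bottom>\<^bsub>?C\<^esub>" "square_atom 1 \<noteq> \<bottom>\<^bsub>?C\<^esub>" unfolding power_bottom by metis+
  qed
  have mM: "Inl (Inr f) \<in> carrier ?M" if "f \<in> carrier ?C" "f \<noteq> \<bottom>\<^bsub>?C\<^esub>" for f
    unfolding car using that by simp
  have mM2: "Inl (Inl 0) \<in> carrier ?M" "Inl (Inl 1) \<in> carrier ?M" "Inr 1 \<in> carrier ?M"
    unfolding car using kl by auto
  obtain a where a: "a \<in> A" "h a = Inl (Inr (square_atom 0))"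
    using surj[OF mM[OF square_atoms(1) s(1)]] by blast
  obtain b where b: "b \<in> A" "h b = Inl (Inr (square_atom 1))"
    using surj[OF mM[OF square_atoms(1) s(2)]] by blast
  have "\<not> h a \<sqsubseteq>\<^bsub>?M\<^esub> h b" "\<not> h b \<sqsubseteq>\<^bsub>?M\<^esub> h a"
    unfolding a(2) b(2) leM(4) by (rule square_atoms(2,3))+
  then have ab: "a \<parallel> b" using a(1) b(1) le by (simp add: incomparable_def)
  have "{x, y} = {a, b}" if xy: "x \<parallel> y" for x y
  proof -
    have m: "x \<in> A" "y \<in> A" using incomparable_mem[OF xy] by auto
    have inc: "\<not> h x \<sqsubseteq>\<^bsub>?M\<^esub> h y" "\<not> h y \<sqsubseteq>\<^bsub>?M\<^esub> h x" using xy le by (auto simp: incomparable_def)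
    obtain f g where fg: "h x = Inl (Inr f)" "h y = Inl (Inr g)" "f \<in> carrier ?C" "g \<in> carrier ?C"
      using hm[OF m(1)] hm[OF m(2)] inc unfolding car by (auto simp: leM)
    have "{f, g} = {square_atom 0, square_atom 1}"
      by (rule square_incomparable[OF fg(3,4)]) (use inc[unfolded fg(1,2)] leM(4) in auto)
    then have "f = square_atom 0 \<and> g = square_atom 1 \<or> f = square_atom 1 \<and> g = square_atom 0"
      by (simp add: doubleton_eq_iff)
    then have "h x = h a \<and> h y = h b \<or> h x = h b \<and> h y = h a"
      unfolding fg(1,2) a(2) b(2) by blast
    then have "x = a \<and> y = b \<or> x = b \<and> y = a" using inj m a(1) b(1) by blast
    then show ?thesis by blast
  qed
  moreover have "a \<^bold>\<sqinter> b \<noteq> \<^bold>0"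
  proof
    assume z: "a \<^bold>\<sqinter> b = \<^bold>0"
    have zero: "x = \<^bold>0" if "x \<in> A" "h x = Inl (Inl i)" for x i
    proof -
      have "h x \<sqsubseteq>\<^bsub>?M\<^esub> h a" "h x \<sqsubseteq>\<^bsub>?M\<^esub> h b" unfolding that(2) a(2) b(2) by (rule leM(2))+
      then have "x \<preceq> a" "x \<preceq> b" using le that(1) a(1) b(1) by auto
      then show ?thesis using meet_greatest z le_zero by metis
    qed
    obtain x y where "x \<in> A" "h x = Inl (Inl 0)" "y \<in> A" "h y = Inl (Inl 1)"
      using surj[OF mM2(1)] surj[OF mM2(2)] by blast
    then show False using zero[of x 0] zero[of y 1] by simp
  qed
  moreover have "a \<^bold>\<squnion> b \<noteq> \<^bold>1"
  proof
    assume z: "a \<^bold>\<squnion> b = \<^bold>1"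
    have one: "x = \<^bold>1" if "a \<preceq> x" "b \<preceq> x" for x using that join_least z one_le by metis
    obtain x y where xy: "x \<in> A" "h x = Inl (Inr e)" "y \<in> A" "h y = Inr 1"
      using surj[OF mM[OF e(1,2)]] surj[OF mM2(3)] by blast
    have "h a \<sqsubseteq>\<^bsub>?M\<^esub> h x" "h b \<sqsubseteq>\<^bsub>?M\<^esub> h x" "h a \<sqsubseteq>\<^bsub>?M\<^esub> h y" "h b \<sqsubseteq>\<^bsub>?M\<^esub> h y"
      unfolding xy(2,4) a(2) b(2) by (simp_all only: leM e(3))
    then have "a \<preceq> x" "b \<preceq> x" "a \<preceq> y" "b \<preceq> y" using le xy(1,3) a(1) b(1) by auto
    then have "x = y" using one by metis
    then show False using xy by simp
  qed
  ultimately show ?thesis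
    unfolding single_inner_diamond_def using ab by (intro exI[of _ a] exI[of _ b] conjI allI impI)
qed

end

section \<open>The congruence lattice up to isomorphism\<close>

context finite_wdl
begin

lemma K_Inter:
  assumes S: "S \<subseteq> K" "S \<noteq> {}" shows "\<Inter>S \<in> K"
proof -
  have c: "r \<in> congs" if "r \<in> S" for r using that S K_congs by blast
  have "equiv A (\<Inter>S)"
  proof (rule equivI)
    obtain r where r: "r \<in> S" using S(2) by blast
    have "r \<subseteq> A \<times> A" using cong_mem[OF c[OF r]] by auto
    then show "\<Inter>S \<subseteq> A \<times> A" using r by blast
    show "refl_on A (\<Inter>S)" using cong_refl[OF c] by (auto intro: refl_onI)
    show "sym (\<Inter>S)" using cong_sym[OF c] by (auto intro: symI)
    show "Relation.trans (\<Inter>S)" using cong_trans[OF c] by (blast intro: transI)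
  qed
  moreover have "(x \<^bold>\<sqinter> y, x' \<^bold>\<sqinter> y') \<in> r \<and> (x \<^bold>\<squnion> y, x' \<^bold>\<squnion> y') \<in> r"
    if "(x, x') \<in> r" "(y, y') \<in> r" "r \<in> S" for x x' y y' r
    using that c[OF that(3)] by (simp add: congs_def)
  moreover have "(wc x, wc y) \<in> r \<and> (dwc x, dwc y) \<in> r" if "(x, y) \<in> r" "r \<in> S" for x y r
    using that S(1) K_wc K_dwc by blast
  ultimately show ?thesis by (simp add: K_def congs_def)
qed

abbreviation Klattice :: "('a \<times> 'a) set gorder" where
  "Klattice \<equiv> \<lparr>carrier = K, eq = (=), le = (\<subseteq>)\<rparr>"

lemma lattice_K: "lattice Klattice"
proof (rule latticeI)
  fix r s assume rs: "r \<in> carrier Klattice" "s \<in> carrier Klattice"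
  let ?U = "{t \<in> K. r \<subseteq> t \<and> s \<subseteq> t}"
  have "t \<subseteq> A \<times> A" if "t \<in> K" for t using cong_mem[OF K_congs[OF that]] by auto
  then have "A \<times> A \<in> ?U" using full_K rs by auto
  then have "\<Inter>?U \<in> K" by (intro K_Inter) auto
  moreover have "r \<subseteq> \<Inter>?U" "s \<subseteq> \<Inter>?U" by auto
  moreover have "\<Inter>?U \<subseteq> t" if "t \<in> K" "r \<subseteq> t" "s \<subseteq> t" for t using that by blast
  ultimately have "is_lub Klattice (\<Inter>?U) {r, s}"
    unfolding is_lub_pair_iff[OF rs] by simp
  then show "\<exists>t. is_lub Klattice t {r, s}" by blast
  have "r \<inter> s \<in> K" using K_Inter[of "{r, s}"] rs by simp
  then have "is_glb Klattice (r \<inter> s) {r, s}"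
    unfolding is_glb_pair_iff[OF rs] by simp
  then show "\<exists>t. is_glb Klattice t {r, s}" by blast
qed auto

lemma E_order_iso:
  assumes S: "S \<subseteq> K" "E ` S = Pow F" "finite F"
  shows "order_iso_to S (\<subseteq>) (lattice_power (chain 2) (card F))"
proof (rule order_iso_to_transfer[OF order_iso_Pow[OF S(3)]])
  have c: "S \<subseteq> congs" using S(1) K_congs by blast
  show "bij_betw E S (Pow F)"
    unfolding bij_betw_def using S(2) inj_on_subset[OF E_inj c] by blast
  show "r \<subseteq> s \<longleftrightarrow> E r \<subseteq> E s" if "r \<in> S" "s \<in> S" for r s
    using E_mono E_reflects that c by blast
qed

lemma K_isomorphic_power:
  assumes "E ` K = Pow F" "finite F"
  shows "Klattice \<cong>\<^sub>L lattice_power (chain 2) (card F)"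
proof (rule order_iso_imp_isomorphic[OF lattice_K])
  show "order_iso_to (carrier Klattice) (\<sqsubseteq>\<^bsub>Klattice\<^esub>) (lattice_power (chain 2) (card F))"
    using E_order_iso[OF order_refl assms] by simp
qed (simp add: lattice_power_simps)

text \<open>The proper congruences form a copy of the powerset of \<open>F\<close>; their greatest element \<open>c\<close> and the full
  congruence form the chain on top.\<close>

lemma K_isomorphic_power_sum:
  assumes E: "E ` P = Pow F" "finite F"
  shows "Klattice \<cong>\<^sub>L lattice_power (chain 2) (card F) \<oplus>\<^sub>L chain 2"
proof (rule order_iso_imp_isomorphic[OF lattice_K])
  have "F \<in> E ` P" using E(1) by simp
  then obtain c where c: "c \<in> P" "E c = F" by blast
  have ne: "c \<noteq> A \<times> A" using c by (simp add: P_def)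
  have PK: "P \<subseteq> K" by (auto simp: P_def)
  have sub: "r \<subseteq> A \<times> A" if "r \<in> K" for r using cong_mem[OF K_congs[OF that]] by auto
  have below: "r \<subseteq> c" if "r \<in> P" for r
  proof (rule E_reflects[OF P_congs[OF that] P_congs[OF c(1)]])
    have "E r \<in> Pow F" using that E(1) by blast
    then show "E r \<subseteq> E c" using c(2) by simp
  qed
  have "order_iso_to {c, A \<times> A} (\<subseteq>) (chain (card {c, A \<times> A}))"
    by (rule order_iso_chain) (use sub c PK in auto)
  then have two: "order_iso_to {c, A \<times> A} (\<subseteq>) (chain 2)" using ne by (simp add: numeral_2_eq_2)
  have "order_iso_to (P \<union> {c, A \<times> A}) (\<subseteq>) (lattice_power (chain 2) (card F) \<oplus>\<^sub>L chain 2)"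
  proof (rule order_iso_ordinal_sum[OF E_order_iso[OF PK E] two])
    show "P \<inter> {c, A \<times> A} = {c}" using c by (auto simp: P_def)
    show "r \<subseteq> s" if "r \<in> P" "s \<in> {c, A \<times> A}" for r s
      using that below sub PK by blast
  qed auto
  moreover have "P \<union> {c, A \<times> A} = K" using full_K c PK by (auto simp: P_def)
  ultimately show "order_iso_to (carrier Klattice) (\<sqsubseteq>\<^bsub>Klattice\<^esub>) (lattice_power (chain 2) (card F) \<oplus>\<^sub>L chain 2)"
    by simp
qed (simp add: ordinal_sum_def)

definition complemented :: "('a \<Rightarrow> 'a) \<Rightarrow> bool" where
  "complemented c \<longleftrightarrow> (\<forall>x\<in>A. x \<^bold>\<sqinter> c x = \<^bold>0 \<and> x \<^bold>\<squnion> c x = \<^bold>1)"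

text \<open>Complements in the square are unique, so a complementation of it swaps the two atoms, and one value of each
  operation determines it.\<close>

lemma four_cases:
  assumes n: "card A = 4" and R: "R \<noteq> {}"
  shows "complemented wc \<and> complemented dwc \<Longrightarrow> Klattice \<cong>\<^sub>L lattice_power (chain 2) 2"
    and "\<not> (complemented wc \<and> complemented dwc) \<Longrightarrow> card P = 1"
proof -
  obtain a b where A: "A = {\<^bold>0, a, b, \<^bold>1}" and ab: "a \<parallel> b" and mt: "a \<^bold>\<sqinter> b = \<^bold>0" and jn: "a \<^bold>\<squnion> b = \<^bold>1"
    and at: "J = {a, b}" "atoms = {a, b}" using four_elements[OF n R] .
  have m: "a \<in> A" "b \<in> A" using ab incomparable_mem by blast+
  note b01 = incomparable_not_bound[OF ab]
  have ne: "a \<noteq> b" using ab refl m by (auto simp: incomparable_def)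
  have un: "x = b" if x: "x \<in> A" "a \<^bold>\<sqinter> x = \<^bold>0" "a \<^bold>\<squnion> x = \<^bold>1" for x
  proof -
    have "x \<noteq> \<^bold>0" using x(3) join_absorb(2)[OF zero_le[OF m(1)]] b01 by auto
    moreover have "x \<noteq> a" using x(2) meet_absorb(1)[OF refl[OF m(1)]] b01 by auto
    moreover have "x \<noteq> \<^bold>1" using x(2) meet_absorb(1)[OF le_one[OF m(1)]] b01 by auto
    ultimately show ?thesis using x(1) unfolding A by blast
  qed
  have cb: "complemented c" if ca: "c a = b" "c b = a" "c \<^bold>0 = \<^bold>1" "c \<^bold>1 = \<^bold>0" for c
  proof -
    have "b \<^bold>\<sqinter> a = \<^bold>0" "b \<^bold>\<squnion> a = \<^bold>1" using mt jn meet_commute join_commute m by metis+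
    moreover have "\<^bold>0 \<^bold>\<sqinter> \<^bold>1 = \<^bold>0" "\<^bold>0 \<^bold>\<squnion> \<^bold>1 = \<^bold>1" "\<^bold>1 \<^bold>\<sqinter> \<^bold>0 = \<^bold>0" "\<^bold>1 \<^bold>\<squnion> \<^bold>0 = \<^bold>1"
      using meet_absorb[OF zero_le[OF one_mem]] join_absorb[OF zero_le[OF one_mem]] by auto
    ultimately show ?thesis unfolding complemented_def unfolding A using ca mt jn by simp
  qed
  have wb: "wc b = a" if "wc a = b"
  proof -
    have "wc b \<preceq> a" using wc_wc[OF m(1)] that by simp
    moreover have "wc b \<noteq> \<^bold>0"
      using join_wc[OF m(2)] join_absorb(2)[OF zero_le[OF m(2)]] b01 by auto
    ultimately show ?thesis using below_atom[of a "wc b"] at by blast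
  qed
  have db: "dwc b = a" if "dwc a = b"
  proof -
    have "a \<preceq> dwc b" using dwc_dwc[OF m(1)] that by simp
    moreover have "dwc b \<noteq> \<^bold>1"
      using meet_dwc[OF m(2)] meet_absorb(1)[OF le_one[OF m(2)]] b01 by auto
    moreover have "dwc b \<in> {\<^bold>0, a, b, \<^bold>1}" using dwc_mem[OF m(2)] unfolding A .
    moreover have "\<not> a \<preceq> \<^bold>0" "\<not> a \<preceq> b" using le_zero b01 ab by (auto simp: incomparable_def)
    ultimately show ?thesis by auto
  qed
  show "Klattice \<cong>\<^sub>L lattice_power (chain 2) 2" if "complemented wc \<and> complemented dwc"
  proof -
    have "wc a = b" "dwc a = b"
      using that un wc_mem dwc_mem m(1) unfolding complemented_def by blast+
    then have "E ` K = Pow {a, b}" using four_boolean[OF A ab jn at] wb db by blast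
    then have "Klattice \<cong>\<^sub>L lattice_power (chain 2) (card {a, b})" by (rule K_isomorphic_power) simp
    moreover have "card {a, b} = 2" using ne by simp
    ultimately show ?thesis by metis
  qed
  show "card P = 1" if "\<not> (complemented wc \<and> complemented dwc)"
  proof (rule four_not_boolean[OF A ab jn at])
    show "wc a \<noteq> b \<or> dwc a \<noteq> b"
      using that cb[of wc] cb[of dwc] wb db wc_zero wc_one dwc_zero dwc_one by blast
  qed
qed

lemma P_singleton_isomorphic:
  assumes "card P = 1" "\<^bold>0 \<noteq> \<^bold>1"
  shows "Klattice \<cong>\<^sub>L lattice_power (chain 2) 0 \<oplus>\<^sub>L chain 2"
proof -
  have P: "P = {Id_on A}" using assms Id_P by (auto simp: card_1_singleton_iff)
  have "lower_cover j \<noteq> j" if "j \<in> J" for j using lower_cover(1)[OF that] by (simp add: lt_def)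
  then have "E (Id_on A) = {}" by (fastforce simp: E_def)
  then have "E ` P = Pow {}" using P by simp
  then show ?thesis using K_isomorphic_power_sum[of "{}"] by simp
qed

lemma small_chain:
  assumes "card A \<le> 3" shows "R = {}"
proof (rule ccontr)
  assume R: "R \<noteq> {}"
  then obtain x y where xy: "x \<parallel> y" using R_join by blast
  have "x \<noteq> y" using xy refl by (auto simp: incomparable_def)
  then have "card {\<^bold>0, x, y, \<^bold>1} = 4"
    using incomparable_not_bound[OF xy] nonchain_bounds[OF R] by auto
  moreover have "card {\<^bold>0, x, y, \<^bold>1} \<le> card A"
    by (rule card_mono[OF finite_A]) (use incomparable_mem[OF xy] zero_mem one_mem in auto)
  ultimately show False using assms by linarith
qed

lemma one_element: assumes "card A = 1" shows "card K = 1"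
proof -
  obtain z where A: "A = {z}" using assms by (auto simp: card_1_singleton_iff)
  have "r = A \<times> A" if r: "r \<in> K" for r
  proof
    show "r \<subseteq> A \<times> A" using cong_mem[OF K_congs[OF r]] by auto
    have "(z, z) \<in> r" by (rule cong_refl[OF K_congs[OF r]]) (simp add: A)
    then show "A \<times> A \<subseteq> r" unfolding A by simp
  qed
  then have "K = {A \<times> A}" using full_K by blast
  then show ?thesis by simp
qed

end

section \<open>The largest numbers of congruences\<close>

lemma finite_wdl_of:
  fixes L :: "'a gorder" (structure)
  assumes "weakly_dicomplemented_lattice L wc dwc" "finite (carrier L)"
  shows "finite_wdl (carrier L) (\<lambda>x y. x \<in> carrier L \<and> y \<in> carrier L \<and> x \<sqsubseteq> y)
    (\<sqinter>) (\<squnion>) \<bottom> \<top> wc dwc"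
proof -
  interpret weakly_dicomplemented_lattice L wc dwc by fact
  show ?thesis
  proof unfold_locales
    show "finite (carrier L)" by fact
    fix x y z
    show "x \<in> carrier L \<Longrightarrow> y \<in> carrier L \<Longrightarrow> (x \<sqinter> y) \<squnion> (x \<sqinter> wc y) = x" by (rule wc_split)
    show "x \<in> carrier L \<Longrightarrow> y \<in> carrier L \<Longrightarrow> (x \<squnion> y) \<sqinter> (x \<squnion> dwc y) = x" by (rule dwc_split)
    show "x \<in> carrier L \<and> y \<in> carrier L \<and> x \<sqsubseteq> y \<Longrightarrow> y \<in> carrier L \<and> z \<in> carrier L \<and> y \<sqsubseteq> z \<Longrightarrow>
      x \<in> carrier L \<and> z \<in> carrier L \<and> x \<sqsubseteq> z" using le_trans by blast
    show "x \<in> carrier L \<and> y \<in> carrier L \<and> x \<sqsubseteq> y \<Longrightarrow> y \<in> carrier L \<and> x \<in> carrier L \<and> y \<sqsubseteq> x \<Longrightarrow> x = y"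
      using le_antisym by blast
    show "z \<in> carrier L \<and> x \<in> carrier L \<and> z \<sqsubseteq> x \<Longrightarrow> z \<in> carrier L \<and> y \<in> carrier L \<and> z \<sqsubseteq> y \<Longrightarrow>
      z \<in> carrier L \<and> x \<sqinter> y \<in> carrier L \<and> z \<sqsubseteq> x \<sqinter> y" using meet_le by simp
    show "x \<in> carrier L \<and> z \<in> carrier L \<and> x \<sqsubseteq> z \<Longrightarrow> y \<in> carrier L \<and> z \<in> carrier L \<and> y \<sqsubseteq> z \<Longrightarrow>
      x \<squnion> y \<in> carrier L \<and> z \<in> carrier L \<and> x \<squnion> y \<sqsubseteq> z" using join_le by simp
  qed (auto simp: meet_left meet_right join_left join_right wc_closed dwc_closed wc_antitone dwc_antitone
      wc_wc_le dwc_dwc_ge)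
qed

lemma order_iso_to_cong:
  assumes "\<And>x y. x \<in> S \<Longrightarrow> y \<in> S \<Longrightarrow> leq x y \<longleftrightarrow> leq' x y"
  shows "order_iso_to S leq M \<longleftrightarrow> order_iso_to S leq' M"
  unfolding order_iso_to_def using assms by (metis (no_types, lifting))

lemma powi_below:
  assumes "n \<ge> 4"
  shows "(2::real) powi (int n - 1) = 8 * real (2 ^ (n - 4))"
    "(2::real) powi (int n - 2) = 4 * real (2 ^ (n - 4))"
    "(2::real) powi (int n - 3) = 2 * real (2 ^ (n - 4))"
    "(2::real) powi (int n - 4) = real (2 ^ (n - 4))"
proof -
  obtain m where n: "n = m + 4" using le_Suc_ex[OF assms] by (auto simp: add.commute)
  have "int n - 1 = int (m + 3)" "int n - 2 = int (m + 2)" "int n - 3 = int (m + 1)"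
    "int n - 4 = int m" using n by auto
  then show "(2::real) powi (int n - 1) = 8 * real (2 ^ (n - 4))"
    "(2::real) powi (int n - 2) = 4 * real (2 ^ (n - 4))"
    "(2::real) powi (int n - 3) = 2 * real (2 ^ (n - 4))"
    "(2::real) powi (int n - 4) = real (2 ^ (n - 4))"
    unfolding n by (simp_all only: power_int_of_nat power_add) simp_all
qed

theorem corollary7p8:
  fixes L :: "'a gorder" and wc dwc :: "'a \<Rightarrow> 'a" and n :: nat
  assumes "n \<ge> 1"
    and "lattice L" and "card (carrier L) = n"
    and "weakly_dicomplemented_lattice L wc dwc"
  shows
    "let K = Con L wc dwc;
         N = real (card (carrier K));
         C22 = lattice_power (chain 2) 2;
         boolean = (boolean_complementation L wc \<and> boolean_complementation L dwc)
     in
      \<comment> \<open>(1)\<close>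
      N \<le> 2 powi (int n - 1)
      \<and>
      \<comment> \<open>(2)\<close>
      (N = 2 powi (int n - 1) \<longleftrightarrow> n \<in> {1, 2})
      \<and>
      \<comment> \<open>(3)\<close>
      (n \<noteq> 3 \<longrightarrow> (N = 2 powi (int n - 2) \<longleftrightarrow> n = 4 \<and> K \<cong>\<^sub>L C22)) \<and>
      (n = 4 \<and> K \<cong>\<^sub>L C22 \<longleftrightarrow> L \<cong>\<^sub>L C22 \<and> boolean)
      \<and>
      \<comment> \<open>(4)\<close>
      (n \<noteq> 1 \<longrightarrow> \<not> L \<cong>\<^sub>L C22 \<or> \<not> boolean \<longrightarrow>
        (N < 2 powi (int n - 1) \<longleftrightarrow> N \<le> 2 powi (int n - 3) + 1))
      \<and>
      \<comment> \<open>(5)\<close>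
      (N = 2 powi (int n - 3) + 1 \<longleftrightarrow>
        n \<ge> 3 \<and> K \<cong>\<^sub>L lattice_power (chain 2) (n - 3) \<oplus>\<^sub>L chain 2) \<and>
      (n \<ge> 3 \<and> K \<cong>\<^sub>L lattice_power (chain 2) (n - 3) \<oplus>\<^sub>L chain 2 \<longleftrightarrow>
        n \<ge> 3 \<and> L \<cong>\<^sub>L chain n)
      \<and>
      \<comment> \<open>(6)\<close>
      (n \<noteq> 1 \<longrightarrow> (N \<le> 2 powi (int n - 3) \<longleftrightarrow> N \<le> 2 powi (int n - 4) + 1))
      \<and>
      \<comment> \<open>(7)\<close>
      (N = 2 powi (int n - 4) + 1 \<longleftrightarrow>
        n \<ge> 4 \<and> K \<cong>\<^sub>L lattice_power (chain 2) (n - 4) \<oplus>\<^sub>L chain 2) \<and>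
      (n \<noteq> 4 \<longrightarrow>
        (n \<ge> 4 \<and> K \<cong>\<^sub>L lattice_power (chain 2) (n - 4) \<oplus>\<^sub>L chain 2 \<longleftrightarrow>
          (n \<ge> 5 \<and> (\<exists>k\<in>{3..n - 2}. L \<cong>\<^sub>L chain k \<boxplus>\<^sub>L chain (n - k + 2)) \<and>
             trivial_weak_dicomplementation L wc dwc) \<or>
          (n \<ge> 6 \<and> (\<exists>k\<in>{2..n - 4}. L \<cong>\<^sub>L chain k \<oplus>\<^sub>L C22 \<oplus>\<^sub>L chain (n - k - 2)))))"
proof -
  have fin: "finite (carrier L)" using assms(1,3) card.infinite by fastforce
  interpret F: finite_wdl "carrier L" "\<lambda>x y. x \<in> carrier L \<and> y \<in> carrier L \<and> x \<sqsubseteq>\<^bsub>L\<^esub> y"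
    "(\<sqinter>\<^bsub>L\<^esub>)" "(\<squnion>\<^bsub>L\<^esub>)" "\<bottom>\<^bsub>L\<^esub>" "\<top>\<^bsub>L\<^esub>" wc dwc
    by (rule finite_wdl_of[OF assms(4) fin])
  have n: "card (carrier L) = n" by fact
  define K where "K = Con L wc dwc"
  define NK where "NK = card (carrier K)"
  have K: "K = F.Klattice"
    by (simp add: K_def Con_def F.K_def F.congs_def lattice_congruence_def)
  have NK: "NK = card F.P + 1" using F.card_K by (simp add: NK_def K)
  \<comment> \<open>Lattice isomorphisms are translated into order isomorphisms for the order confined to the
     carrier.\<close>
  have iso: "L \<cong>\<^sub>L M \<longleftrightarrow> order_iso_to (carrier L) (\<lambda>x y. x \<in> carrier L \<and> y \<in> carrier L \<and> x \<sqsubseteq>\<^bsub>L\<^esub> y) M"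
    if "eq M = (=)" for M :: "'m gorder"
  proof -
    have "order_iso_to (carrier L) (\<lambda>x y. x \<in> carrier L \<and> y \<in> carrier L \<and> x \<sqsubseteq>\<^bsub>L\<^esub> y) M \<longleftrightarrow>
      order_iso_to (carrier L) (\<sqsubseteq>\<^bsub>L\<^esub>) M" by (rule order_iso_to_cong) simp
    then show ?thesis
      using order_iso_imp_isomorphic[OF assms(2) that] isomorphic_imp_order_iso by blast
  qed
  have chain: "L \<cong>\<^sub>L chain n \<longleftrightarrow> F.R = {}"
    using iso[of "chain n"] F.order_iso_chain_iff n by simp
  have square: "L \<cong>\<^sub>L lattice_power (chain 2) 2 \<longleftrightarrow> n = 4 \<and> F.R \<noteq> {}"
  proof
    assume i: "L \<cong>\<^sub>L lattice_power (chain 2) 2"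
    then have "n = 4" using isomorphic_card[OF i] n card_power[of 2] by simp
    moreover have "F.R \<noteq> {}"
      using F.order_iso_square_nonchain i iso[of "lattice_power (chain 2) 2"] by (simp add: lattice_power_simps)
    ultimately show "n = 4 \<and> F.R \<noteq> {}" by blast
  next
    assume h: "n = 4 \<and> F.R \<noteq> {}"
    then have c4: "card (carrier L) = 4" and Rne: "F.R \<noteq> {}" using n by auto
    obtain a b where A: "carrier L = {\<bottom>\<^bsub>L\<^esub>, a, b, \<top>\<^bsub>L\<^esub>}" and ab: "F.incomparable a b"
      and m: "a \<sqinter>\<^bsub>L\<^esub> b = \<bottom>\<^bsub>L\<^esub>" "a \<squnion>\<^bsub>L\<^esub> b = \<top>\<^bsub>L\<^esub>"
      by (rule F.four_elements[OF c4 Rne])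
    have "order_iso_to {a \<sqinter>\<^bsub>L\<^esub> b, a, b, a \<squnion>\<^bsub>L\<^esub> b}
      (\<lambda>x y. x \<in> carrier L \<and> y \<in> carrier L \<and> x \<sqsubseteq>\<^bsub>L\<^esub> y) (lattice_power (chain 2) 2)"
      by (rule F.order_iso_square[OF ab])
    then have "order_iso_to (carrier L) (\<lambda>x y. x \<in> carrier L \<and> y \<in> carrier L \<and> x \<sqsubseteq>\<^bsub>L\<^esub> y)
      (lattice_power (chain 2) 2)" unfolding m A[symmetric] .
    then show "L \<cong>\<^sub>L lattice_power (chain 2) 2"
      using iso[of "lattice_power (chain 2) 2"] by (simp add: lattice_power_simps)
  qed
  have horizontal: "(\<exists>k\<in>{3..n - 2}. L \<cong>\<^sub>L chain k \<boxplus>\<^sub>L chain (n - k + 2)) \<longleftrightarrow> F.two_chain_horizontal_sum"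
    if "n \<ge> 5"
  proof -
    have "L \<cong>\<^sub>L chain k \<boxplus>\<^sub>L chain l \<longleftrightarrow>
      order_iso_to (carrier L) (\<lambda>x y. x \<in> carrier L \<and> y \<in> carrier L \<and> x \<sqsubseteq>\<^bsub>L\<^esub> y) (chain k \<boxplus>\<^sub>L chain l)" for k l
      by (rule iso) (simp add: horizontal_sum_def)
    moreover have "n - k + 2 \<ge> 3" if "k \<in> {3..n - 2}" for k using that by auto
    ultimately show ?thesis
      using F.horizontal_sum_order_iso F.order_iso_horizontal_sumD n that by fastforce
  qed
  have diamond: "n \<ge> 6 \<and> (\<exists>k\<in>{2..n - 4}. L \<cong>\<^sub>L chain k \<oplus>\<^sub>L lattice_power (chain 2) 2 \<oplus>\<^sub>L chain (n - k - 2))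
    \<longleftrightarrow> F.single_inner_diamond"
  proof -
    have "L \<cong>\<^sub>L chain k \<oplus>\<^sub>L lattice_power (chain 2) 2 \<oplus>\<^sub>L chain l \<longleftrightarrow>
      order_iso_to (carrier L) (\<lambda>x y. x \<in> carrier L \<and> y \<in> carrier L \<and> x \<sqsubseteq>\<^bsub>L\<^esub> y)
        (chain k \<oplus>\<^sub>L lattice_power (chain 2) 2 \<oplus>\<^sub>L chain l)" for k l
      by (rule iso) (simp add: ordinal_sum_def)
    moreover have "n - k - 2 \<ge> 2" if "n \<ge> 6" "k \<in> {2..n - 4}" for k using that by auto
    ultimately show ?thesis
      using F.diamond_order_iso F.order_iso_diamondD n by fastforce
  qed
  have trivial: "trivial_weak_dicomplementation L wc dwc \<longleftrightarrow> F.wc_trivial \<and> F.dwc_trivial"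
    using F.wc_one F.dwc_zero
    by (auto simp: trivial_weak_dicomplementation_def F.wc_trivial_def F.dwc_trivial_def)
  define boolean where "boolean \<longleftrightarrow> boolean_complementation L wc \<and> boolean_complementation L dwc"
  have boolean: "boolean \<longleftrightarrow> F.complemented wc \<and> F.complemented dwc"
    using F.wc_mem F.dwc_mem by (auto simp: boolean_def boolean_complementation_def F.complemented_def)
  have card_C22: "NK = 4" if "K \<cong>\<^sub>L lattice_power (chain 2) 2"
    using isomorphic_card[OF that] card_power[of 2] NK_def by simp
  have card_sum: "NK = 2 ^ k + 1" if "K \<cong>\<^sub>L lattice_power (chain 2) k \<oplus>\<^sub>L chain 2" for k
    using isomorphic_card[OF that] card_power_sum[of k] NK_def by simp
  have ch: "K \<cong>\<^sub>L lattice_power (chain 2) (n - 3) \<oplus>\<^sub>L chain 2" if "F.R = {}" "n \<ge> 3"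
    by (rule F.chain_realisation[OF that(1)])
      (use that n F.K_isomorphic_power_sum K in \<open>metis+\<close>)
  have nch: "NK \<le> 2 ^ (n - 4) + 1"
    "NK = 2 ^ (n - 4) + 1 \<longleftrightarrow> F.two_chain_horizontal_sum \<and> F.wc_trivial \<and> F.dwc_trivial \<or> F.single_inner_diamond"
    if "F.R \<noteq> {}" "n \<ge> 5"
    using F.nonchain_bound[OF that(1)] n that(2) by (simp_all add: NK_def K)
  have shapes: "F.R \<noteq> {}" "K \<cong>\<^sub>L lattice_power (chain 2) (n - 4) \<oplus>\<^sub>L chain 2"
    if h: "F.two_chain_horizontal_sum \<and> F.wc_trivial \<and> F.dwc_trivial \<or> F.single_inner_diamond"
  proof -
    obtain G where G: "finite G" "card G = card (carrier L) - 4" "F.E ` F.P = Pow G" "F.R \<noteq> {}"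
      using h
    proof
      assume "F.two_chain_horizontal_sum \<and> F.wc_trivial \<and> F.dwc_trivial"
      then have h: F.two_chain_horizontal_sum F.wc_trivial F.dwc_trivial by auto
      show thesis by (rule F.horizontal_realisation[OF h]) (rule that)
    next
      assume h: "F.single_inner_diamond"
      show thesis by (rule F.diamond_realisation[OF h]) (rule that)
    qed
    show "F.R \<noteq> {}" by fact
    show "K \<cong>\<^sub>L lattice_power (chain 2) (n - 4) \<oplus>\<^sub>L chain 2"
      using F.K_isomorphic_power_sum[OF G(3,1)] G(2) n K by simp
  qed
  have dia6: "n \<ge> 6" if "F.single_inner_diamond" using diamond that by blast
  have horizontal_or: "n \<ge> 5 \<and> (\<exists>k\<in>{3..n - 2}. L \<cong>\<^sub>L chain k \<boxplus>\<^sub>L chain (n - k + 2)) \<and> T \<longleftrightarrow>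
    n \<ge> 5 \<and> F.two_chain_horizontal_sum \<and> T" for T using horizontal by blast
  note red = NK_def[symmetric] boolean_def[symmetric] chain square trivial diamond horizontal_or
  consider "n = 1" | "n = 2" | "n = 3" | "n = 4" "F.R = {}" | "n = 4" "F.R \<noteq> {}" "boolean"
    | "n = 4" "F.R \<noteq> {}" "\<not> boolean" | "n \<ge> 5" "F.R = {}" | "n \<ge> 5" "F.R \<noteq> {}"
    using \<open>n \<ge> 1\<close> by linarith
  then show ?thesis
  proof cases
    case 1
    then have "NK = 1" using F.one_element n by (simp add: NK_def K)
    then show ?thesis unfolding Let_def unfolding K_def[symmetric] unfolding red using 1 dia6 card_sum by (auto simp: power_int_minus)
  next
    case 2
    then have "NK = 2" using F.two_elements n NK by simp
    then show ?thesis unfolding Let_def unfolding K_def[symmetric] unfolding red using 2 dia6 by (auto simp: power_int_minus)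
  next
    case 3
    then have i: "F.R = {}" "K \<cong>\<^sub>L lattice_power (chain 2) (n - 3) \<oplus>\<^sub>L chain 2"
      using F.small_chain n ch by auto
    then show ?thesis unfolding Let_def unfolding K_def[symmetric] unfolding red using 3 dia6 card_sum[OF i(2)] by (auto simp: power_int_minus)
  next
    case 4
    then have i: "K \<cong>\<^sub>L lattice_power (chain 2) (n - 3) \<oplus>\<^sub>L chain 2" using ch by auto
    then have N3: "NK = 3" using card_sum[OF i] 4 by simp
    show ?thesis unfolding Let_def unfolding K_def[symmetric] unfolding red using 4 dia6 N3 i card_C22 card_sum[of 0] by auto
  next
    case 5
    then have i: "K \<cong>\<^sub>L lattice_power (chain 2) 2" using F.four_cases(1) n boolean K by auto
    then have N4: "NK = 4" by (rule card_C22)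
    show ?thesis unfolding Let_def unfolding K_def[symmetric] unfolding red using 5 dia6 N4 i card_sum[of 0] card_sum[of 1] by auto
  next
    case 6
    then have c1: "card F.P = 1" using F.four_cases(2) n boolean by auto
    then have N2: "NK = 2" using NK by simp
    have i: "K \<cong>\<^sub>L lattice_power (chain 2) 0 \<oplus>\<^sub>L chain 2"
      using F.P_singleton_isomorphic[OF c1 F.nonchain_bounds[OF 6(2)]] K by simp
    show ?thesis unfolding Let_def unfolding K_def[symmetric] unfolding red using 6 dia6 N2 i card_C22 card_sum[of 1] by auto
  next
    case 7
    \<comment> \<open>All powers are multiples of \<open>q\<close>, which makes the comparisons linear.\<close>
    define q where "q = (2::nat) ^ (n - 4)"
    have "2 ^ 1 \<le> q" unfolding q_def using 7 by (intro power_increasing) auto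
    then have q: "q \<ge> 2" by simp
    have "n - 3 = Suc (n - 4)" using 7 by simp
    then have s: "(2::nat) ^ (n - 3) = 2 * q" by (simp add: q_def)
    have "n \<ge> 4" using 7 by simp
    note pw = powi_below[OF this, folded q_def]
    have i: "K \<cong>\<^sub>L lattice_power (chain 2) (n - 3) \<oplus>\<^sub>L chain 2" using ch 7 by auto
    then have N: "NK = 2 * q + 1" using card_sum[OF i] s by simp
    have j: "\<not> K \<cong>\<^sub>L lattice_power (chain 2) (n - 4) \<oplus>\<^sub>L chain 2"
      using card_sum[of "n - 4"] N q by (auto simp: q_def[symmetric])
    have k: "\<not> (F.two_chain_horizontal_sum \<and> F.wc_trivial \<and> F.dwc_trivial \<or> F.single_inner_diamond)"
      using shapes(1) 7 by blast
    show ?thesis unfolding Let_def unfolding K_def[symmetric] unfolding red pw using 7 N i j k q by auto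
  next
    case 8
    define q where "q = (2::nat) ^ (n - 4)"
    have "2 ^ 1 \<le> q" unfolding q_def using 8 by (intro power_increasing) auto
    then have q: "q \<ge> 2" by simp
    have "n - 3 = Suc (n - 4)" using 8 by simp
    then have s: "(2::nat) ^ (n - 3) = 2 * q" by (simp add: q_def)
    have "n \<ge> 4" using 8 by simp
    note pw = powi_below[OF this, folded q_def]
    note N = nch[OF 8(2,1), folded q_def]
    have i: "\<not> K \<cong>\<^sub>L lattice_power (chain 2) (n - 3) \<oplus>\<^sub>L chain 2"
      using card_sum[of "n - 3"] N(1) q s by auto
    have j: "K \<cong>\<^sub>L lattice_power (chain 2) (n - 4) \<oplus>\<^sub>L chain 2 \<longleftrightarrow> NK = q + 1"
      using card_sum[of "n - 4"] shapes(2) N(2) by (auto simp: q_def[symmetric])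
    show ?thesis unfolding Let_def unfolding K_def[symmetric] unfolding red pw j using 8 N i q by auto
  qed
qed

end
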